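(* Let $\kappa>0$, let $\mathcal U\subset\mathbb R^3$ be an exterior region, and let $\psi$ be a radiation solution of the Helmholtz equation $-\Delta\psi=\kappa^2\psi$ in $\mathcal U$. Let $\mathcal B$ be an open bounded domain in $\mathbb R^3$ whose boundary $Y=\partial\mathcal B$ is real-analytic and connected, such that $\overline{\mathcal B}=\mathcal B\cup Y\subset\mathcal U$ and $\kappa$ is not a Dirichlet eigenvalue for $\mathcal B$. Let $\mathcal D$ be an arbitrary non-empty open domain of $Y$. Then $\psi$ on $\mathcal U$ is uniquely determined by $\operatorname{Im}\psi$ on $\mathcal D$. That is, if $\psi_1,\psi_2$ are two radiation solutions in $\mathcal U$ (for the same $\kappa$) and $\operatorname{Im}\psi_1=\operatorname{Im}\psi_2$ on $\mathcal D$, then $\psi_1=\psi_2$ on $\mathcal U$.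
   Context: An exterior region $\mathcal U$ in $\mathbb R^3$ is an open unbounded connected set consisting of all points in the exterior of a closed bounded regular surface $S$. A radiation solution in $\mathcal U$ is a complex-valued function $\psi$, of class $C^2$ in the closure of $\mathcal U$, satisfying $-\Delta\psi(x)=\kappa^2\psi(x)$ for $x\in\mathcal U$ and the Sommerfeld radiation condition $|x|\left(\frac{\partial}{\partial|x|}-i\kappa\right)\psi(x)\to0$ as $|x|\to+\infty$, uniformly in $x/|x|$. "$\kappa$ is not a Dirichlet eigenvalue for $\mathcal B$" means that the only solution of $-\Delta u=\kappa^2u$ in $\mathcal B$ with $u=0$ on $\partial\mathcal B$ is $u=0$ (i.e. $\kappa^2$ is not an eigenvalue of the Dirichlet Laplacian $-\Delta$ in $\mathcal B$). "Open domain of $Y$" means open in the relative topology of $Y$. *)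

theory Defs
  imports "HOL-Analysis.Analysis"
begin

definition C1_on :: "'a::real_normed_vector set \<Rightarrow> ('a \<Rightarrow> 'b::real_normed_vector) \<Rightarrow> bool" where
  "C1_on W f \<longleftrightarrow>
     (\<exists>f' :: 'a \<Rightarrow> 'a \<Rightarrow>\<^sub>L 'b.
        (\<forall>x\<in>W. (f has_derivative blinfun_apply (f' x)) (at x)) \<and> continuous_on W f')"

text \<open>For an open set \<open>U\<close> and \<open>U \<subseteq> A \<subseteq> closure U\<close>: \<open>f\<close> is of class \<open>C\<^sup>2\<close> in \<open>U\<close>, and
  \<open>f\<close> and its derivatives up to order two extend continuously to \<open>A\<close>. (The values of \<open>f'\<close> and
  \<open>f''\<close> on \<open>A - U\<close> are not tied to \<open>f\<close> otherwise.) Thus \<open>C2_upto U U\<close> is the class \<open>C\<^sup>2(U)\<close>, and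
  \<open>C2_upto U (closure U)\<close> is the class \<open>C\<^sup>2\<close> in the closure of \<open>U\<close>.\<close>

definition C2_upto ::
    "'a::real_normed_vector set \<Rightarrow> 'a set \<Rightarrow> ('a \<Rightarrow> 'b::real_normed_vector) \<Rightarrow> bool" where
  "C2_upto U A f \<longleftrightarrow>
     (\<exists>(f' :: 'a \<Rightarrow> 'a \<Rightarrow>\<^sub>L 'b) (f'' :: 'a \<Rightarrow> 'a \<Rightarrow>\<^sub>L ('a \<Rightarrow>\<^sub>L 'b)).
        (\<forall>x\<in>U. (f has_derivative blinfun_apply (f' x)) (at x)) \<and>
        (\<forall>x\<in>U. (f' has_derivative blinfun_apply (f'' x)) (at x)) \<and>
        continuous_on A f \<and> continuous_on A f' \<and> continuous_on A f'')"

definition dir_deriv ::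
    "'a::real_normed_vector \<Rightarrow> ('a \<Rightarrow> 'b::real_normed_vector) \<Rightarrow> 'a \<Rightarrow> 'b" where
  "dir_deriv b f x = vector_derivative (\<lambda>t. f (x + t *\<^sub>R b)) (at 0)"

definition laplacian :: "('a::euclidean_space \<Rightarrow> 'b::real_normed_vector) \<Rightarrow> 'a \<Rightarrow> 'b" where
  "laplacian f x = (\<Sum>b\<in>Basis. dir_deriv b (dir_deriv b f) x)"

definition real_analytic_on :: "(real^2) set \<Rightarrow> (real^2 \<Rightarrow> 'b::real_normed_vector) \<Rightarrow> bool" where
  "real_analytic_on W f \<longleftrightarrow>
     (\<forall>u\<in>W. \<exists>r>0. \<exists>a :: nat \<times> nat \<Rightarrow> 'b. \<forall>w\<in>ball u r.
        ((\<lambda>(m, n). ((w$1 - u$1) ^ m * (w$2 - u$2) ^ n) *\<^sub>R a (m, n)) has_sum f w) UNIV)"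

text \<open>Embedded surface without boundary in \<open>\<real>\<^sup>3\<close>, given by local parametrizations that are immersions
  and homeomorphisms onto relatively open pieces of \<open>S\<close>. The smoothness class \<open>K\<close> of the
  parametrizations must imply differentiability.\<close>

definition embedded_surface ::
    "((real^2) set \<Rightarrow> (real^2 \<Rightarrow> real^3) \<Rightarrow> bool) \<Rightarrow> (real^3) set \<Rightarrow> bool" where
  "embedded_surface K S \<longleftrightarrow>
     (\<forall>p\<in>S. \<exists>V W \<sigma> \<tau>. open V \<and> p \<in> V \<and> open W \<and> K W \<sigma> \<and>
        (\<forall>u\<in>W. inj (frechet_derivative \<sigma> (at u))) \<and>
        homeomorphism W (S \<inter> V) \<sigma> \<tau>)"

abbreviation regular_surface :: "(real^3) set \<Rightarrow> bool" where
  "regular_surface \<equiv> embedded_surface C1_on"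

abbreviation real_analytic_surface :: "(real^3) set \<Rightarrow> bool" where
  "real_analytic_surface \<equiv> embedded_surface real_analytic_on"

text \<open>\<open>outside S\<close> is the union of the unbounded components of the complement of \<open>S\<close>, here a single
  component.\<close>

definition exterior_region :: "(real^3) set \<Rightarrow> bool" where
  "exterior_region U \<longleftrightarrow> open U \<and> connected U \<and> \<not> bounded U \<and>
     (\<exists>S. S \<noteq> {} \<and> closed S \<and> bounded S \<and> regular_surface S \<and> U = outside S)"

text \<open>Points are written as \<open>r *\<^sub>R \<omega>\<close> with \<open>r = norm x\<close> and \<open>\<omega>\<close> in the unit sphere, so the
  radial derivative is the derivative in \<open>r\<close>.\<close>

definition sommerfeld :: "real \<Rightarrow> (real^3 \<Rightarrow> complex) \<Rightarrow> bool" where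
  "sommerfeld \<kappa> \<psi> \<longleftrightarrow>
     uniform_limit (sphere 0 1)
       (\<lambda>r \<omega>. of_real r *
          (vector_derivative (\<lambda>s. \<psi> (s *\<^sub>R \<omega>)) (at r) - \<i> * of_real \<kappa> * \<psi> (r *\<^sub>R \<omega>)))
       (\<lambda>_. 0) at_top"

definition helmholtz_on :: "real \<Rightarrow> (real^3) set \<Rightarrow> (real^3 \<Rightarrow> complex) \<Rightarrow> bool" where
  "helmholtz_on \<kappa> U \<psi> \<longleftrightarrow> (\<forall>x\<in>U. - laplacian \<psi> x = of_real (\<kappa>\<^sup>2) * \<psi> x)"

definition radiation_solution :: "real \<Rightarrow> (real^3) set \<Rightarrow> (real^3 \<Rightarrow> complex) \<Rightarrow> bool" where
  "radiation_solution \<kappa> U \<psi> \<longleftrightarrow>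
     C2_upto U (closure U) \<psi> \<and> helmholtz_on \<kappa> U \<psi> \<and> sommerfeld \<kappa> \<psi>"

text \<open>Eigenfunctions are taken in the classical sense: \<open>C\<^sup>2\<close> in \<open>B\<close> and continuous on the closure.\<close>

definition dirichlet_eigenvalue :: "real \<Rightarrow> (real^3) set \<Rightarrow> bool" where
  "dirichlet_eigenvalue \<kappa> B \<longleftrightarrow>
     (\<exists>u. C2_upto B B u \<and> continuous_on (closure B) u \<and> helmholtz_on \<kappa> B u \<and>
        (\<forall>x\<in>frontier B. u x = 0) \<and> (\<exists>x\<in>B. u x \<noteq> 0))"

end

theory Submission
  imports Defs "HOL-Complex_Analysis.Complex_Analysis"
begin

text \<open>
  Let \<open>\<psi> = \<psi>\<^sub>1 - \<psi>\<^sub>2\<close> and \<open>v = Im \<psi>\<close>. Solutions of the Helmholtz equation are real-analytic along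
  real-analytic curves: near a point they are volume potentials \<open>\<integral> exp (i\<kappa>|x - y|) / |x - y| f y dy\<close>
  whose density \<open>f\<close> (produced by a cutoff) vanishes near that point, and the kernel extends
  holomorphically in \<open>x\<close>. Hence \<open>v = 0\<close> on \<open>D\<close> gives \<open>v = 0\<close> on \<open>Y\<close> by connectedness, on \<open>B\<close> since \<open>\<kappa>\<close>
  is not a Dirichlet eigenvalue, and on \<open>U\<close> by unique continuation, so \<open>\<psi>\<close> is real. For a real function the
  real and imaginary parts of the radiation condition say that \<open>\<psi>\<close> and its radial derivative are
  \<open>o(1/r)\<close>. Therefore \<open>\<psi>\<close> is represented far out with either of the kernels
  \<open>exp (\<plusminus>i\<kappa>|x - y|) / |x - y|\<close>. On a ray this reads
  \<open>r \<psi> = exp (i\<kappa>r) g (1/r) = exp (-i\<kappa>r) h (1/r)\<close> with \<open>g\<close>, \<open>h\<close> holomorphic at \<open>0\<close>, which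
  forces \<open>g = 0\<close> because of the essential singularity of \<open>exp (2i\<kappa>/z)\<close>.
\<close>

section \<open>A compactly supported cutoff\<close>

text \<open>The main obstacle is the singularity of the fundamental solution. The kernel is smoothed
  by replacing |x - y|^2 with |x - y|^2 + e^2; its defect in the Helmholtz equation is then, up to a
  constant factor, an explicit approximate identity. Functions are cut off and integrated over the
  whole space, so integration by parts is mere translation invariance and no boundary term appears.
  Only points off the support of the density are represented. Analyticity along curves turns every
  identity theorem into the one-variable one: segments serve for open sets, images of segments under
  charts serve for Y. Why a real solution admits both kernels: a cutoff in the shell rho <= |y| <= 2
  rho costs an error of order rho^3 (volume) times 1/rho (kernel) times rho^-2 (cutoff) times the
  suprema of |psi| and |y . grad psi|. The powers of rho cancel, so it suffices that these suprema
  tend to 0, whatever the sign of k. For the wave exp(ikr)/r the term y . grad psi stays of order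
  one, which is why the radiation condition normally selects one sign.\<close>

lemma DERIV_max_0_power:
  "((\<lambda>s::real. max 0 s ^ Suc (Suc n)) has_real_derivative real (Suc (Suc n)) * max 0 s ^ Suc n) (at s)"
proof -
  consider "s < 0" | "s > 0" | "s = 0" by linarith
  then show ?thesis
  proof cases
    case 1
    have "((\<lambda>s::real. 0::real) has_real_derivative 0) (at s)" by simp
    then have "((\<lambda>s::real. max 0 s ^ Suc (Suc n)) has_real_derivative 0) (at s)"
      by (rule has_field_derivative_transform_within_open[where S="{..<0}"]) (use 1 in auto)
    with 1 show ?thesis by simp
  next
    case 2
    have "((\<lambda>s::real. s ^ Suc (Suc n)) has_real_derivative real (Suc (Suc n)) * s ^ Suc n) (at s)"
      by (rule derivative_eq_intros refl | simp)+
    then have "((\<lambda>s::real. max 0 s ^ Suc (Suc n)) has_real_derivative real (Suc (Suc n)) * s ^ Suc n) (at s)"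
      by (rule has_field_derivative_transform_within_open[where S="{0<..}"]) (use 2 in auto)
    with 2 show ?thesis by simp
  next
    \<comment> \<open>The kink is harmless because the exponent is at least 2: the difference
      quotient is bounded by \<open>\<bar>h\<bar> ^ Suc n\<close>.\<close>
    case 3
    have lim: "((\<lambda>h::real. max 0 h ^ Suc (Suc n) / h) \<longlongrightarrow> 0) (at 0)"
    proof (rule Lim_null_comparison)
      show "\<forall>\<^sub>F h in at (0::real). norm (max 0 h ^ Suc (Suc n) / h) \<le> \<bar>h\<bar> ^ Suc n"
      proof (intro always_eventually allI)
        fix h :: real
        show "norm (max 0 h ^ Suc (Suc n) / h) \<le> \<bar>h\<bar> ^ Suc n"
        proof (cases "h > 0")
          case False
          then have "max 0 h = 0" by simp
          then show ?thesis by (metis abs_ge_zero div_0 norm_zero power_0_Suc zero_le_power)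
        qed simp
      qed
      have "((\<lambda>h::real. \<bar>h\<bar> ^ Suc n) \<longlongrightarrow> \<bar>0\<bar> ^ Suc n) (at 0)"
        by (intro tendsto_intros)
      then show "((\<lambda>h::real. \<bar>h\<bar> ^ Suc n) \<longlongrightarrow> 0) (at 0)" by simp
    qed
    with 3 show ?thesis by (simp add: DERIV_def)
  qed
qed

text \<open>\<open>- q'\<close> is the quadratic B-spline with knots 1, 2, 3, 4, so \<open>q\<close>
  is piecewise cubic and of class C^2, enough for the Laplacian of a cutoff. The end knots 1 and 4
  are squares: as a function of the squared norm, \<open>q\<close> passes from 1 to 0 between radius
  1 and radius 2, and no square root is differentiated at the origin.\<close>

lemma smooth_step:
  obtains q q' q'' :: "real \<Rightarrow> real" and A :: real
  where "\<And>s. (q has_real_derivative q' s) (at s)" "\<And>s. (q' has_real_derivative q'' s) (at s)"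
    "continuous_on UNIV q''"
    "\<And>s. s \<le> 1 \<Longrightarrow> q s = 1 \<and> q' s = 0 \<and> q'' s = 0"
    "\<And>s. s \<ge> 4 \<Longrightarrow> q s = 0 \<and> q' s = 0 \<and> q'' s = 0"
    "\<And>s. \<bar>q' s\<bar> \<le> A" "\<And>s. \<bar>q'' s\<bar> \<le> A"
proof -
  define m where "m = (\<lambda>n (s::real). max 0 s ^ n)"
  \<comment> \<open>A third finite difference of the truncated cubic; past the last knot it is the
    third difference of \<open>s ^ 3\<close>, which is 3! = 6.\<close>
  define q where "q s = 1 - (m 3 (s - 1) - 3 * m 3 (s - 2) + 3 * m 3 (s - 3) - m 3 (s - 4)) / 6" for s
  define q' where "q' s = - (m 2 (s - 1) - 3 * m 2 (s - 2) + 3 * m 2 (s - 3) - m 2 (s - 4)) / 2" for s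
  define q'' where "q'' s = - (m 1 (s - 1) - 3 * m 1 (s - 2) + 3 * m 1 (s - 3) - m 1 (s - 4))" for s
  have m3: "(m 3 has_real_derivative 3 * m 2 s) (at s)" for s
    using DERIV_max_0_power[of 1 s] unfolding m_def by (simp add: numeral_eq_Suc)
  have m2: "(m 2 has_real_derivative 2 * m 1 s) (at s)" for s
    using DERIV_max_0_power[of 0 s] unfolding m_def by (simp add: numeral_eq_Suc)
  have shift: "((\<lambda>s. F (s - c)) has_real_derivative D) (at s)"
    if "(F has_real_derivative D) (at (s - c))" for F :: "real \<Rightarrow> real" and D s c
  proof -
    have "s + h - c = s - c + h" for h by simp
    with that show ?thesis by (simp only: DERIV_def)
  qed
  have dm3 [derivative_intros]: "((\<lambda>s. m 3 (s - c)) has_real_derivative 3 * m 2 (s - c)) (at s)" for s c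
    by (rule shift[OF m3])
  have dm2 [derivative_intros]: "((\<lambda>s. m 2 (s - c)) has_real_derivative 2 * m 1 (s - c)) (at s)" for s c
    by (rule shift[OF m2])
  have 1: "(q has_real_derivative q' s) (at s)" for s
    unfolding q_def [abs_def] q'_def
    by (auto intro!: derivative_eq_intros simp: field_simps)
  have 2: "(q' has_real_derivative q'' s) (at s)" for s
    unfolding q''_def q'_def [abs_def]
    by (auto intro!: derivative_eq_intros simp: field_simps)
  have 3: "continuous_on UNIV q''"
    unfolding q''_def [abs_def] m_def by (intro continuous_intros)
  have 4: "q s = 1 \<and> q' s = 0 \<and> q'' s = 0" if "s \<le> 1" for s
    using that by (simp add: q_def q'_def q''_def m_def)
  have 5: "q s = 0 \<and> q' s = 0 \<and> q'' s = 0" if "s \<ge> 4" for s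
  proof -
    have "m n (s - c) = (s - c) ^ n" if "c \<in> {1, 2, 3, 4}" for n c
      using that \<open>s \<ge> 4\<close> by (auto simp: m_def)
    then show ?thesis
      unfolding q_def q'_def q''_def by (simp add: power2_eq_square power3_eq_cube algebra_simps)
  qed
  have c2: "continuous_on {1..4} q''" using 3 continuous_on_subset by blast
  have c1: "continuous_on {1..4} q'"
    by (meson 2 DERIV_continuous_on has_field_derivative_at_within)
  obtain B where B: "\<And>s. s \<in> {1..4} \<Longrightarrow> norm (q' s) \<le> B"
    using continuous_on_compact_bound[OF compact_Icc c1] by metis
  obtain B' where B': "\<And>s. s \<in> {1..4} \<Longrightarrow> norm (q'' s) \<le> B'"
    using continuous_on_compact_bound[OF compact_Icc c2] by metis
  define A where "A = \<bar>B\<bar> + \<bar>B'\<bar>"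
  have 6: "\<bar>q' s\<bar> \<le> A \<and> \<bar>q'' s\<bar> \<le> A" for s
  proof (cases "s \<in> {1..4}")
    case True
    with B[OF True] B'[OF True] show ?thesis unfolding A_def by auto
  next
    case False
    then have "q' s = 0 \<and> q'' s = 0" using 4[of s] 5[of s] by auto
    then show ?thesis unfolding A_def by simp
  qed
  show thesis by (rule that[of q q' q'' A]) (fact 1 2 3 4 5 conjunct1[OF 6] conjunct2[OF 6])+
qed

section \<open>Integration by parts for compactly supported functions\<close>

lemma integral_lborel_affine:
  fixes f :: "'a::euclidean_space \<Rightarrow> 'b::{banach, second_countable_topology}"
  assumes [measurable]: "f \<in> borel_measurable borel" and c: "c \<noteq> 0"
  shows "(\<integral>x. f x \<partial>lborel) = \<bar>c\<bar> ^ DIM('a) *\<^sub>R (\<integral>x. f (t + c *\<^sub>R x) \<partial>lborel)"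
  by (subst lborel_affine[OF c, of t]) (simp add: integral_density integral_distr)

lemma integrable_continuous_bounded_support:
  fixes f :: "'a::euclidean_space \<Rightarrow> 'b::{banach, second_countable_topology}"
  assumes "continuous_on UNIV f" and "\<And>x. norm x > M \<Longrightarrow> f x = 0"
  shows "integrable lborel f"
proof -
  have "integrable lborel (\<lambda>x. indicator (cball 0 M) x *\<^sub>R f x)"
    by (rule borel_integrable_compact) (auto intro: continuous_on_subset[OF assms(1)])
  moreover have "(\<lambda>x. indicator (cball 0 M) x *\<^sub>R f x) = f"
    using assms(2) by (force simp: indicator_def)
  ultimately show ?thesis by simp
qed

lemma bounded_continuous_bounded_support:
  fixes f :: "'a::euclidean_space \<Rightarrow> 'b::real_normed_vector"
  assumes "continuous_on UNIV f" and "\<And>x. norm x > M \<Longrightarrow> f x = 0"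
  obtains B where "B \<ge> 0" "\<And>x. norm (f x) \<le> B"
proof -
  have "bounded (f ` cball 0 M)"
    using assms(1) by (intro compact_imp_bounded compact_continuous_image) (auto intro: continuous_on_subset)
  then obtain B where B: "\<And>x. norm x \<le> M \<Longrightarrow> norm (f x) \<le> B"
    unfolding bounded_iff by (metis image_eqI mem_cball_0)
  have "norm (f x) \<le> \<bar>B\<bar>" for x
    using B[of x] assms(2)[of x] by (cases "norm x \<le> M") auto
  with that[of "\<bar>B\<bar>"] show thesis by auto
qed

lemma has_vector_derivative_along_line:
  fixes g :: "'a::real_vector \<Rightarrow> 'b::real_normed_vector"
  assumes "\<And>x. ((\<lambda>t. g (x + t *\<^sub>R b)) has_vector_derivative g' x) (at 0)"
  shows "((\<lambda>t. g (x + t *\<^sub>R b)) has_vector_derivative g' (x + s *\<^sub>R b)) (at s)"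
proof -
  have "((\<lambda>t. g ((x + s *\<^sub>R b) + t *\<^sub>R b)) has_vector_derivative g' (x + s *\<^sub>R b)) (at (s - s))"
    using assms[of "x + s *\<^sub>R b"] by simp
  moreover have "((\<lambda>t. t - s) has_vector_derivative 1) (at s)"
    by (auto intro!: derivative_eq_intros)
  ultimately have "((\<lambda>t. g ((x + s *\<^sub>R b) + t *\<^sub>R b)) \<circ> (\<lambda>t. t - s) has_vector_derivative 1 *\<^sub>R g' (x + s *\<^sub>R b)) (at s)"
    by (intro vector_diff_chain_at) auto
  moreover have "x + s *\<^sub>R b + (t - s) *\<^sub>R b = x + t *\<^sub>R b" for t
    by (simp add: algebra_simps)
  ultimately show ?thesis by (simp add: o_def)
qed

text \<open>By translation invariance all difference quotients of \<open>g\<close> have integral \<open>0\<close>.\<close>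

lemma integral_partial_derivative_eq_0:
  fixes g g' :: "'a::euclidean_space \<Rightarrow> complex"
  assumes cont: "continuous_on UNIV g" "continuous_on UNIV g'"
    and der: "\<And>x. ((\<lambda>t. g (x + t *\<^sub>R b)) has_vector_derivative g' x) (at 0)"
    and supp: "\<And>x. norm x > M \<Longrightarrow> g x = 0" "\<And>x. norm x > M \<Longrightarrow> g' x = 0"
  shows "(\<integral>x. g' x \<partial>lborel) = 0"
proof -
  obtain B where B: "B \<ge> 0" "\<And>x. norm (g' x) \<le> B"
    using bounded_continuous_bounded_support[OF cont(2) supp(2)] by blast
  define d where "d n = 1 / real (Suc n)" for n
  define f where "f n x = (g (x + d n *\<^sub>R b) - g x) /\<^sub>R d n" for n x
  have d: "0 < d n" "d n \<le> 1" for n by (auto simp: d_def)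
  have d0: "d \<longlonglongrightarrow> 0" unfolding d_def by (rule LIMSEQ_inverse_real_of_nat[unfolded inverse_eq_divide])
  have gi: "integrable lborel g" by (rule integrable_continuous_bounded_support[OF cont(1) supp(1)])
  have [measurable]: "g \<in> borel_measurable borel" "g' \<in> borel_measurable borel"
    using cont by (auto intro: borel_measurable_continuous_onI)
  have tr: "integrable lborel (\<lambda>x. g (x + c))" "(\<integral>x. g (x + c) \<partial>lborel) = (\<integral>x. g x \<partial>lborel)" for c
  proof -
    have "integrable (distr lborel borel ((+) c)) g" using gi by (simp add: lborel_distr_plus)
    then show "integrable lborel (\<lambda>x. g (x + c))"
      by (subst (asm) integrable_distr_eq) (auto simp: add.commute)
    show "(\<integral>x. g (x + c) \<partial>lborel) = (\<integral>x. g x \<partial>lborel)"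
      using integral_lborel_affine[of g 1 c] by (simp add: add.commute)
  qed
  have int0: "(\<integral>x. f n x \<partial>lborel) = 0" for n
    unfolding f_def using tr gi by simp
  \<comment> \<open>Since \<open>d n\<close> is at most 1, enlarging the support radius by
    \<open>norm b\<close> covers all quotients at once.\<close>
  have bound: "norm (f n x) \<le> B * indicator (cball 0 (M + norm b)) x" for n x
  proof (cases "norm x \<le> M + norm b")
    case True
    have "norm (g (x + d n *\<^sub>R b) - g (x + 0 *\<^sub>R b)) \<le> B * norm (d n - 0)"
    proof (rule differentiable_bound[where S="{0..d n}"])
      show "((\<lambda>t. g (x + t *\<^sub>R b)) has_derivative (\<lambda>h. h *\<^sub>R g' (x + s *\<^sub>R b))) (at s within {0..d n})" for s
        using has_vector_derivative_along_line[OF der, of x s]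
        by (auto simp: has_vector_derivative_def intro: has_derivative_at_withinI)
      show "onorm (\<lambda>h. h *\<^sub>R g' (x + s *\<^sub>R b)) \<le> B" for s
      proof (rule onorm_le)
        fix h :: real
        show "norm (h *\<^sub>R g' (x + s *\<^sub>R b)) \<le> B * norm h"
          using mult_right_mono[OF B(2)[of "x + s *\<^sub>R b"], of "\<bar>h\<bar>"] by (simp add: mult.commute)
      qed
    qed (use d[of n] in auto)
    then have "norm (f n x) \<le> B"
      unfolding f_def norm_scaleR using d[of n] by (simp add: field_simps)
    with True show ?thesis by simp
  next
    case False
    have "norm (d n *\<^sub>R b) \<le> norm b" using d[of n] by (simp add: mult_left_le_one_le)
    moreover have "norm x \<le> norm (x + d n *\<^sub>R b) + norm (d n *\<^sub>R b)"
      by (metis add_diff_cancel norm_triangle_ineq4)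
    ultimately have "norm (x + d n *\<^sub>R b) > M" using False by linarith
    moreover have "norm x > M" using False norm_ge_zero[of b] by linarith
    ultimately show ?thesis using supp(1) False by (simp add: f_def)
  qed
  have lim: "(\<lambda>n. f n x) \<longlonglongrightarrow> g' x" for x
  proof -
    have 1: "((\<lambda>t. norm (g (x + t *\<^sub>R b) - g x - t *\<^sub>R g' x) / norm t) \<longlongrightarrow> 0) (at 0)"
      using der[of x] by (simp add: has_vector_derivative_def has_derivative_at)
    have 2: "norm (g (x + t *\<^sub>R b) - g x - t *\<^sub>R g' x) / norm t =
        norm ((g (x + t *\<^sub>R b) - g x) /\<^sub>R t - g' x)" if "t \<noteq> 0" for t
    proof -
      have "norm (g (x + t *\<^sub>R b) - g x - t *\<^sub>R g' x) / norm t =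
          norm ((g (x + t *\<^sub>R b) - g x - t *\<^sub>R g' x) /\<^sub>R t)"
        by (simp add: divide_inverse mult.commute)
      also have "(g (x + t *\<^sub>R b) - g x - t *\<^sub>R g' x) /\<^sub>R t = (g (x + t *\<^sub>R b) - g x) /\<^sub>R t - g' x"
        using that by (simp add: scaleR_diff_right)
      finally show ?thesis .
    qed
    have "((\<lambda>t. norm ((g (x + t *\<^sub>R b) - g x) /\<^sub>R t - g' x)) \<longlongrightarrow> 0) (at 0)"
    proof (rule Lim_transform_eventually[OF 1])
      show "\<forall>\<^sub>F t in at 0. norm (g (x + t *\<^sub>R b) - g x - t *\<^sub>R g' x) / norm t =
          norm ((g (x + t *\<^sub>R b) - g x) /\<^sub>R t - g' x)"
        unfolding eventually_at_filter by (rule always_eventually) (use 2 in blast)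
    qed
    then have *: "((\<lambda>t. (g (x + t *\<^sub>R b) - g x) /\<^sub>R t) \<longlongrightarrow> g' x) (at 0)"
      by (rule LIM_zero_cancel[OF tendsto_norm_zero_cancel])
    have "filterlim d (at 0) sequentially"
    proof -
      have "d n \<noteq> 0" for n using d(1)[of n] by simp
      with d0 show ?thesis by (simp add: filterlim_at)
    qed
    from filterlim_compose[OF * this] show ?thesis
      unfolding f_def .
  qed
  have "(\<lambda>n. \<integral>x. f n x \<partial>lborel) \<longlonglongrightarrow> (\<integral>x. g' x \<partial>lborel)"
  proof (rule integral_dominated_convergence[where w="\<lambda>x. B * indicator (cball 0 (M + norm b)) x"])
    show "integrable lborel (\<lambda>x::'a. B * indicator (cball 0 (M + norm b)) x)"
      by (intro integrable_mult_right integrable_real_indicator) (use emeasure_bounded_finite[of "cball (0::'a) (M + norm b)"] in auto)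
    show "f n \<in> borel_measurable lborel" for n unfolding f_def by measurable
  qed (use lim bound in auto)
  then show ?thesis by (simp add: int0 LIMSEQ_const_iff)
qed

text \<open>\<open>g b\<close> and \<open>h b\<close> are the first and second derivatives in
  direction \<open>b\<close>; the product rule for pure second derivatives produces no mixed ones.
  Carrying the derivatives as data gives the Laplacian of a product as an explicit formula, and
  derivatives along lines make gluing and vanishing local checks.\<close>

definition C2_partials ::
    "'a::euclidean_space set \<Rightarrow> ('a \<Rightarrow> complex) \<Rightarrow> ('a \<Rightarrow> 'a \<Rightarrow> complex) \<Rightarrow> ('a \<Rightarrow> 'a \<Rightarrow> complex) \<Rightarrow> bool"
  where
  "C2_partials U f g h \<longleftrightarrow> continuous_on U f \<and>
     (\<forall>b\<in>Basis. continuous_on U (g b) \<and> continuous_on U (h b) \<and>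
       (\<forall>x\<in>U. ((\<lambda>t. f (x + t *\<^sub>R b)) has_vector_derivative g b x) (at 0) \<and>
              ((\<lambda>t. g b (x + t *\<^sub>R b)) has_vector_derivative h b x) (at 0)))"

lemma C2_partials_subset: "C2_partials U f g h \<Longrightarrow> V \<subseteq> U \<Longrightarrow> C2_partials V f g h"
  unfolding C2_partials_def by (meson continuous_on_subset subsetD)

lemma C2_partials_zero: "C2_partials U (\<lambda>x. 0) (\<lambda>b x. 0) (\<lambda>b x. 0)"
  by (auto simp: C2_partials_def)

lemma has_vector_derivative_line_cong:
  fixes f g :: "'a::euclidean_space \<Rightarrow> 'b::real_normed_vector"
  assumes "open U" "x \<in> U" "\<And>y. y \<in> U \<Longrightarrow> f y = g y"
    and "((\<lambda>t. f (x + t *\<^sub>R b)) has_vector_derivative D) (at 0)"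
  shows "((\<lambda>t. g (x + t *\<^sub>R b)) has_vector_derivative D) (at 0)"
proof (rule has_vector_derivative_transform_within_open[OF assms(4)])
  show "open ((\<lambda>t. x + t *\<^sub>R b) -` U)"
    by (intro open_vimage assms(1) continuous_intros)
qed (use assms in auto)

lemma C2_partials_cong:
  assumes U: "open U" and P: "C2_partials U f g h"
    and eq: "\<And>y. y \<in> U \<Longrightarrow> f y = f' y" "\<And>b y. b \<in> Basis \<Longrightarrow> y \<in> U \<Longrightarrow> g b y = g' b y"
      "\<And>b y. b \<in> Basis \<Longrightarrow> y \<in> U \<Longrightarrow> h b y = h' b y"
  shows "C2_partials U f' g' h'"
  unfolding C2_partials_def
proof (intro conjI ballI)
  show "continuous_on U f'" using P eq(1) unfolding C2_partials_def by (blast intro: continuous_on_eq)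
  fix b :: 'a assume b: "b \<in> Basis"
  show "continuous_on U (g' b)" "continuous_on U (h' b)"
    using P eq(2,3)[OF b] b unfolding C2_partials_def by (blast intro: continuous_on_eq)+
  fix x assume x: "x \<in> U"
  have d: "((\<lambda>t. f (x + t *\<^sub>R b)) has_vector_derivative g b x) (at 0)"
    "((\<lambda>t. g b (x + t *\<^sub>R b)) has_vector_derivative h b x) (at 0)"
    using P b x unfolding C2_partials_def by auto
  show "((\<lambda>t. f' (x + t *\<^sub>R b)) has_vector_derivative g' b x) (at 0)"
    using has_vector_derivative_line_cong[OF U x eq(1) d(1)] eq(2)[OF b x] by simp
  show "((\<lambda>t. g' b (x + t *\<^sub>R b)) has_vector_derivative h' b x) (at 0)"
    using has_vector_derivative_line_cong[OF U x eq(2)[OF b] d(2)] eq(3)[OF b x] by simp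
qed

lemma C2_partials_Un:
  assumes "open U" "open V" "C2_partials U f g h" "C2_partials V f g h"
  shows "C2_partials (U \<union> V) f g h"
  using assms unfolding C2_partials_def by (auto intro: continuous_on_open_Un)

text \<open>Line derivatives at a point of an open set depend on \<open>f\<close> in that set only.
  This is how supports pass from a function to its derivative data in the later integrability
  arguments.\<close>

lemma C2_partials_eq_0:
  assumes U: "C2_partials U f g h" and V: "open V" "V \<subseteq> U" and 0: "\<And>x. x \<in> V \<Longrightarrow> f x = 0"
    and b: "b \<in> Basis" and x: "x \<in> V"
  shows "g b x = 0" "h b x = 0"
proof -
  have g0: "g b y = 0" if y: "y \<in> V" for y
  proof -
    have "((\<lambda>t. (\<lambda>_. 0) (y + t *\<^sub>R b)) has_vector_derivative (g b y)) (at 0)"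
      using has_vector_derivative_line_cong[OF V(1) y, of f "\<lambda>_. 0"] 0 U b y V(2)
      unfolding C2_partials_def by blast
    then show ?thesis by (metis has_vector_derivative_const vector_derivative_at)
  qed
  then show "g b x = 0" using x .
  have "((\<lambda>t. (\<lambda>_. 0) (x + t *\<^sub>R b)) has_vector_derivative (h b x)) (at 0)"
    using has_vector_derivative_line_cong[OF V(1) x, of "g b" "\<lambda>_. 0"] g0 U b x V(2)
    unfolding C2_partials_def by blast
  then show "h b x = 0" by (metis has_vector_derivative_const vector_derivative_at)
qed

lemma C2_partials_mult:
  assumes "C2_partials U f f' f''" "C2_partials U g g' g''"
  shows "C2_partials U (\<lambda>x. f x * g x) (\<lambda>b x. f x * g' b x + f' b x * g x)
           (\<lambda>b x. f x * g'' b x + 2 * f' b x * g' b x + f'' b x * g x)"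
  unfolding C2_partials_def
proof (intro conjI ballI)
  show "continuous_on U (\<lambda>x. f x * g x)"
    using assms unfolding C2_partials_def by (auto intro!: continuous_intros)
  fix b :: 'a assume b: "b \<in> Basis"
  show "continuous_on U (\<lambda>x. f x * g' b x + f' b x * g x)"
    "continuous_on U (\<lambda>x. f x * g'' b x + 2 * f' b x * g' b x + f'' b x * g x)"
    using assms b unfolding C2_partials_def by (auto intro!: continuous_intros)
  fix x assume x: "x \<in> U"
  have d: "((\<lambda>t. f (x + t *\<^sub>R b)) has_vector_derivative f' b x) (at 0)"
    "((\<lambda>t. f' b (x + t *\<^sub>R b)) has_vector_derivative f'' b x) (at 0)"
    "((\<lambda>t. g (x + t *\<^sub>R b)) has_vector_derivative g' b x) (at 0)"
    "((\<lambda>t. g' b (x + t *\<^sub>R b)) has_vector_derivative g'' b x) (at 0)"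
    using assms b x unfolding C2_partials_def by auto
  show "((\<lambda>t. f (x + t *\<^sub>R b) * g (x + t *\<^sub>R b)) has_vector_derivative f x * g' b x + f' b x * g x) (at 0)"
    using has_vector_derivative_mult[OF d(1,3)] by simp
  show "((\<lambda>t. f (x + t *\<^sub>R b) * g' b (x + t *\<^sub>R b) + f' b (x + t *\<^sub>R b) * g (x + t *\<^sub>R b))
     has_vector_derivative f x * g'' b x + 2 * f' b x * g' b x + f'' b x * g x) (at 0)"
    using has_vector_derivative_add[OF has_vector_derivative_mult[OF d(1,4)] has_vector_derivative_mult[OF d(2,3)]]
    by (simp add: algebra_simps)
qed

text \<open>On \<open>V\<close> the product and its data are 0 whatever \<open>g\<close> is outside
  \<open>U\<close>, on \<open>U\<close> the product rule applies, and the two open pieces glue. In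
  this way a solution known only locally becomes a C^2 function on the whole space.\<close>

lemma C2_partials_cutoff:
  assumes "open U" "open V" "U \<union> V = UNIV" and f: "C2_partials UNIV f f' f''"
    and g: "C2_partials U g g' g''" and 0: "\<And>x. x \<in> V \<Longrightarrow> f x = 0"
  shows "C2_partials UNIV (\<lambda>x. f x * g x) (\<lambda>b x. f x * g' b x + f' b x * g x)
           (\<lambda>b x. f x * g'' b x + 2 * f' b x * g' b x + f'' b x * g x)"
proof -
  let ?P = "\<lambda>W. C2_partials W (\<lambda>x. f x * g x) (\<lambda>b x. f x * g' b x + f' b x * g x)
           (\<lambda>b x. f x * g'' b x + 2 * f' b x * g' b x + f'' b x * g x)"
  have z: "f' b x = 0" "f'' b x = 0" if "b \<in> Basis" "x \<in> V" for b x
    using C2_partials_eq_0[OF f assms(2) subset_UNIV 0 that] by simp_all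
  have "?P V"
    by (rule C2_partials_cong[OF assms(2) C2_partials_zero]) (simp_all add: 0 z)
  moreover have "?P U"
    by (rule C2_partials_mult[OF C2_partials_subset[OF f subset_UNIV] g])
  ultimately have "?P (U \<union> V)"
    by (intro C2_partials_Un assms(1,2))
  then show ?thesis by (simp only: assms(3))
qed

text \<open>The shift \<open>c\<close> has two uses: \<open>c = e\<^sup>2\<close> keeps the argument
  of a singular profile away from 0, and \<open>c = 0\<close> treats cutoffs. Working with the
  squared norm keeps the inner function polynomial along every line.\<close>

lemma C2_partials_radial:
  fixes x :: "'a::euclidean_space" and K :: "real \<Rightarrow> complex"
  assumes K: "\<And>s. s \<ge> c \<Longrightarrow> (K has_vector_derivative K' s) (at s)"
    and K': "\<And>s. s \<ge> c \<Longrightarrow> (K' has_vector_derivative K'' s) (at s)"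
    and K'': "continuous_on {c..} K''"
  shows "C2_partials UNIV (\<lambda>y. K ((norm (y - x))\<^sup>2 + c))
     (\<lambda>b y. of_real (2 * ((y - x) \<bullet> b)) * K' ((norm (y - x))\<^sup>2 + c))
     (\<lambda>b y. 2 * K' ((norm (y - x))\<^sup>2 + c) + of_real (4 * ((y - x) \<bullet> b)\<^sup>2) * K'' ((norm (y - x))\<^sup>2 + c))"
proof -
  have cK: "continuous_on {c..} K" "continuous_on {c..} K'"
    using K K' by (meson atLeast_iff continuous_at_imp_continuous_on has_vector_derivative_continuous)+
  have cc: "continuous_on UNIV (\<lambda>y. F ((norm (y - x))\<^sup>2 + c))" if "continuous_on {c..} F" for F :: "real \<Rightarrow> complex"
    by (rule continuous_on_compose2[OF that]) (auto intro!: continuous_intros)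
  have s: "((\<lambda>t. (norm (y + t *\<^sub>R b - x))\<^sup>2 + c) has_vector_derivative 2 * ((y - x) \<bullet> b)) (at 0)" for y b
  proof -
    have "(norm (y + t *\<^sub>R b - x))\<^sup>2 + c = (norm (y - x))\<^sup>2 + 2 * t * ((y - x) \<bullet> b) + t\<^sup>2 * (norm b)\<^sup>2 + c" for t
    proof -
      have "y + t *\<^sub>R b - x = (y - x) + t *\<^sub>R b" by simp
      then show ?thesis
        unfolding power2_norm_eq_inner
        by (simp only: inner_add_left inner_add_right inner_scaleR_left inner_scaleR_right
            inner_commute[of b "y - x"]) (simp add: power2_eq_square distrib_left)
    qed
    moreover have "((\<lambda>t. (norm (y - x))\<^sup>2 + 2 * t * ((y - x) \<bullet> b) + t\<^sup>2 * (norm b)\<^sup>2 + c) has_real_derivative 2 * ((y - x) \<bullet> b)) (at 0)"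
      by (auto intro!: derivative_eq_intros)
    ultimately show ?thesis by (simp add: has_real_derivative_iff_has_vector_derivative)
  qed
  have ch: "((\<lambda>t. F ((norm (y + t *\<^sub>R b - x))\<^sup>2 + c)) has_vector_derivative
       of_real (2 * ((y - x) \<bullet> b)) * F' ((norm (y - x))\<^sup>2 + c)) (at 0)"
    if "\<And>s. s \<ge> c \<Longrightarrow> (F has_vector_derivative F' s) (at s)" for F F' :: "real \<Rightarrow> complex" and y b
    using vector_diff_chain_at[OF s, of F "F' ((norm (y - x))\<^sup>2 + c)" y b] that[of "(norm (y - x))\<^sup>2 + c"]
    by (simp add: o_def scaleR_conv_of_real)
  show ?thesis
    unfolding C2_partials_def
  proof (intro conjI ballI)
    show "continuous_on UNIV (\<lambda>y. K ((norm (y - x))\<^sup>2 + c))" by (rule cc[OF cK(1)])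
    fix b :: 'a assume b: "b \<in> Basis"
    show "continuous_on UNIV (\<lambda>y. of_real (2 * ((y - x) \<bullet> b)) * K' ((norm (y - x))\<^sup>2 + c))"
      by (intro continuous_on_mult cc[OF cK(2)] continuous_intros)
    show "continuous_on UNIV (\<lambda>y. 2 * K' ((norm (y - x))\<^sup>2 + c) + of_real (4 * ((y - x) \<bullet> b)\<^sup>2) * K'' ((norm (y - x))\<^sup>2 + c))"
      by (intro continuous_on_mult continuous_on_add cc[OF cK(2)] cc[OF K''] continuous_intros)
    fix y :: 'a
    show "((\<lambda>t. K ((norm (y + t *\<^sub>R b - x))\<^sup>2 + c)) has_vector_derivative
       of_real (2 * ((y - x) \<bullet> b)) * K' ((norm (y - x))\<^sup>2 + c)) (at 0)"
      by (rule ch[OF K])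
    have l: "((\<lambda>t. complex_of_real (2 * ((y + t *\<^sub>R b - x) \<bullet> b))) has_vector_derivative 2) (at 0)"
    proof -
      have "((\<lambda>t. 2 * ((y + t *\<^sub>R b - x) \<bullet> b)) has_real_derivative 2) (at 0)"
        using b by (auto intro!: derivative_eq_intros simp: inner_add_left inner_diff_left)
      then show ?thesis
        using has_vector_derivative_of_real[of "\<lambda>t. 2 * ((y + t *\<^sub>R b - x) \<bullet> b)" 2]
        by (simp add: has_real_derivative_iff_has_vector_derivative)
    qed
    show "((\<lambda>t. of_real (2 * ((y + t *\<^sub>R b - x) \<bullet> b)) * K' ((norm (y + t *\<^sub>R b - x))\<^sup>2 + c)) has_vector_derivative
       2 * K' ((norm (y - x))\<^sup>2 + c) + of_real (4 * ((y - x) \<bullet> b)\<^sup>2) * K'' ((norm (y - x))\<^sup>2 + c)) (at 0)"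
      using has_vector_derivative_mult[OF l ch[OF K', of y b]] by (simp add: algebra_simps power2_eq_square)
  qed
qed

lemma sum_inner_Basis_power2: "(\<Sum>b\<in>Basis. (x \<bullet> b)\<^sup>2) = (norm (x::'a::euclidean_space))\<^sup>2"
  by (subst power2_norm_eq_inner, subst euclidean_inner, simp add: power2_eq_square)

text \<open>In each direction the difference of the two integrands is the derivative of phi w' - w
  phi', because the products of first derivatives cancel; its integral is 0 since \<open>w\<close>
  has bounded support. The other function may have full support, as the smoothed kernel
  does.\<close>

lemma green_identity:
  fixes \<phi> w :: "'a::euclidean_space \<Rightarrow> complex"
  assumes \<phi>: "C2_partials UNIV \<phi> \<phi>' \<phi>''" and w: "C2_partials UNIV w w' w''"
    and supp: "\<And>x. norm x > M \<Longrightarrow> w x = 0"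
  shows "(\<integral>x. \<phi> x * (\<Sum>b\<in>Basis. w'' b x) \<partial>lborel) = (\<integral>x. w x * (\<Sum>b\<in>Basis. \<phi>'' b x) \<partial>lborel)"
proof -
  have op: "open {x::'a. norm x > M}" by (intro open_Collect_less continuous_intros)
  have supp': "w' b x = 0" "w'' b x = 0" if "norm x > M" "b \<in> Basis" for x b
    using C2_partials_eq_0[OF w op _ _ that(2)] supp that(1) by auto
  have *: "integrable lborel (\<lambda>x. \<phi> x * w'' b x)" "integrable lborel (\<lambda>x. w x * \<phi>'' b x)"
    "(\<integral>x. \<phi> x * w'' b x \<partial>lborel) = (\<integral>x. w x * \<phi>'' b x \<partial>lborel)" if b: "b \<in> Basis" for b
  proof -
    have c: "continuous_on UNIV \<phi>" "continuous_on UNIV w" "continuous_on UNIV (\<phi>' b)" "continuous_on UNIV (w' b)"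
      "continuous_on UNIV (\<phi>'' b)" "continuous_on UNIV (w'' b)"
      using \<phi> w b unfolding C2_partials_def by auto
    show i: "integrable lborel (\<lambda>x. \<phi> x * w'' b x)" "integrable lborel (\<lambda>x. w x * \<phi>'' b x)"
      by (rule integrable_continuous_bounded_support[where M=M];
          use c supp supp' b in \<open>auto intro!: continuous_intros\<close>)+
    have "(\<integral>x. \<phi> x * w'' b x - w x * \<phi>'' b x \<partial>lborel) = 0"
    proof (rule integral_partial_derivative_eq_0[where g="\<lambda>x. \<phi> x * w' b x - w x * \<phi>' b x" and b=b and M=M])
      fix x
      have d: "((\<lambda>t. \<phi> (x + t *\<^sub>R b)) has_vector_derivative \<phi>' b x) (at 0)"
        "((\<lambda>t. \<phi>' b (x + t *\<^sub>R b)) has_vector_derivative \<phi>'' b x) (at 0)"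
        "((\<lambda>t. w (x + t *\<^sub>R b)) has_vector_derivative w' b x) (at 0)"
        "((\<lambda>t. w' b (x + t *\<^sub>R b)) has_vector_derivative w'' b x) (at 0)"
        using \<phi> w b unfolding C2_partials_def by auto
      show "((\<lambda>t. \<phi> (x + t *\<^sub>R b) * w' b (x + t *\<^sub>R b) - w (x + t *\<^sub>R b) * \<phi>' b (x + t *\<^sub>R b))
         has_vector_derivative \<phi> x * w'' b x - w x * \<phi>'' b x) (at 0)"
        using has_vector_derivative_diff[OF has_vector_derivative_mult[OF d(1,4)] has_vector_derivative_mult[OF d(3,2)]]
        by (simp add: algebra_simps)
    qed (use c supp supp' b in \<open>auto intro!: continuous_intros\<close>)
    then show "(\<integral>x. \<phi> x * w'' b x \<partial>lborel) = (\<integral>x. w x * \<phi>'' b x \<partial>lborel)"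
      using i by simp
  qed
  show ?thesis
    by (simp add: sum_distrib_left Bochner_Integration.integral_sum * cong: sum.cong)
qed

section \<open>Regularized fundamental solutions\<close>

lemma integrable_powr_tail: "integrable lborel (\<lambda>t::real. (1 + t\<^sup>2) powr (- 5 / 6))"
proof -
  let ?f = "\<lambda>t::real. indicator {1..} t *\<^sub>R t powr (- 5 / 3)"
  have hi: "((\<lambda>t::real. t powr (- 5 / 3)) has_integral - (1 powr (- 5 / 3 + 1)) / (- 5 / 3 + 1)) {1..}"
    by (rule has_integral_powr_to_inf) auto
  have "(\<lambda>t::real. t powr (- 5 / 3)) absolutely_integrable_on {1..}"
    by (rule nonnegative_absolutely_integrable_1) (use hi in \<open>auto simp: integrable_on_def\<close>)
  then have i1: "set_integrable lebesgue {1..} (\<lambda>t::real. t powr (- 5 / 3))"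
    .
  have f1: "integrable lborel ?f"
    using i1 unfolding set_integrable_def
    by (subst (asm) integrable_completion) auto
  have f2: "integrable lborel (\<lambda>t. ?f (- t))"
    using lborel_integrable_real_affine[OF f1, of "-1" 0] by simp
  have f3: "integrable lborel (\<lambda>t::real. indicator {-1..1} t *\<^sub>R (1::real))"
    by (rule borel_integrable_compact) auto
  show ?thesis
  proof (rule Bochner_Integration.integrable_bound[OF Bochner_Integration.integrable_add[OF Bochner_Integration.integrable_add[OF f1 f2] f3]])
    have "norm ((1 + t\<^sup>2) powr (- 5 / 6)) \<le> norm (?f t + ?f (- t) + indicator {-1..1} t *\<^sub>R 1)" for t :: real
    proof (cases "\<bar>t\<bar> \<le> 1")
      case True
      have "(1 + t\<^sup>2) powr (- 5 / 6) \<le> 1"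
        using powr_mono2'[of "-5/6" 1 "1 + t\<^sup>2"] by simp
      moreover have "?f t \<ge> 0" "?f (- t) \<ge> 0" "indicator {-1..1} t *\<^sub>R 1 = (1::real)"
        using True by (auto simp: indicator_def)
      moreover have "(1 + t\<^sup>2) powr (- 5 / 6) \<ge> 0" by simp
      ultimately show ?thesis unfolding real_norm_def by linarith
    next
      case False
      have "(1 + t\<^sup>2) powr (- 5 / 6) \<le> (t\<^sup>2) powr (- 5 / 6)"
        using False powr_mono2'[of "-5/6" "t\<^sup>2" "1 + t\<^sup>2"] by auto
      also have "(t\<^sup>2) powr (- 5 / 6) = \<bar>t\<bar> powr (- 5 / 3)"
      proof -
        have "t\<^sup>2 = \<bar>t\<bar> powr 2" using False by (simp add: powr_numeral)
        then show ?thesis by (simp only: powr_powr) simp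
      qed
      also have "\<bar>t\<bar> powr (- 5 / 3) \<le> norm (?f t + ?f (- t) + indicator {-1..1} t *\<^sub>R 1)"
        using False by (auto simp: indicator_def abs_if)
      finally show ?thesis by simp
    qed
    then show "AE t in lborel. norm ((1 + t\<^sup>2) powr (- 5 / 6)) \<le> norm (?f t + ?f (- t) + indicator {-1..1} t *\<^sub>R 1)"
      by simp
  qed simp
qed

text \<open>Every coordinate satisfies 1 + y_b^2 <= 1 + |y|^2, and 3 * 5/6 = 5/2, so the integrand
  is at most the product over the three coordinates of (1 + y_b^2)^(-5/6). Each factor decays like
  |t|^(-5/3), and the integral of the product is a product of line integrals.\<close>

lemma integrable_bracket_power5:
  "integrable lborel (\<lambda>y::real^3. 1 / sqrt (1 + (norm y)\<^sup>2) ^ 5)"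
proof -
  define p where "p t = (1 + t\<^sup>2) powr (- 5 / 6)" for t :: real
  have [measurable]: "p \<in> borel_measurable borel" unfolding p_def by measurable
  have le: "1 / sqrt (1 + (norm y)\<^sup>2) ^ 5 \<le> (\<Prod>b\<in>Basis. p (y \<bullet> b))" for y :: "real^3"
  proof -
    have 1: "p (y \<bullet> b) \<ge> (1 + (norm y)\<^sup>2) powr (- 5 / 6)" if "b \<in> Basis" for b
      unfolding p_def
    proof (rule powr_mono2')
      have "(y \<bullet> b)\<^sup>2 \<le> (norm y)\<^sup>2"
        using Basis_le_norm[OF that, of y] by (simp add: abs_le_square_iff [symmetric])
      then show "1 + (y \<bullet> b)\<^sup>2 \<le> 1 + (norm y)\<^sup>2" by simp
    qed (auto simp: add_pos_nonneg)
    have "((1 + (norm y)\<^sup>2) powr (- 5 / 6)) ^ 3 = 1 / sqrt (1 + (norm y)\<^sup>2) ^ 5"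
    proof -
      have pos: "1 + (norm y)\<^sup>2 > 0" by (simp add: add_pos_nonneg)
      have "sqrt (1 + (norm y)\<^sup>2) ^ 5 = (1 + (norm y)\<^sup>2) powr (5 / 2)"
        using pos by (simp add: powr_half_sqrt [symmetric] powr_powr flip: powr_numeral)
      moreover have "((1 + (norm y)\<^sup>2) powr (- 5 / 6)) ^ 3 = (1 + (norm y)\<^sup>2) powr (- 5 / 2)"
        using pos by (simp add: powr_powr flip: powr_numeral)
      ultimately show ?thesis by (simp only:) (simp add: powr_minus_divide)
    qed
    moreover have "(\<Prod>b\<in>(Basis::(real^3) set). (1 + (norm y)\<^sup>2) powr (- 5 / 6)) \<le> (\<Prod>b\<in>Basis. p (y \<bullet> b))"
      by (rule prod_mono) (use 1 in auto)
    ultimately show ?thesis by (simp add: DIM_cart)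
  qed
  have pi: "integrable lborel p" using integrable_powr_tail unfolding p_def .
  have fin: "(\<integral>\<^sup>+t. ennreal (p t) \<partial>lborel) < \<infinity>"
    using pi unfolding integrable_iff_bounded by (simp add: p_def)
  show ?thesis
  proof (rule integrableI_bounded)
    have "(\<integral>\<^sup>+y. ennreal (norm (1 / sqrt (1 + (norm (y::real^3))\<^sup>2) ^ 5)) \<partial>lborel)
        \<le> (\<integral>\<^sup>+y. (\<Prod>b\<in>Basis. ennreal (p ((y::real^3) \<bullet> b))) \<partial>lborel)"
      by (rule nn_integral_mono) (use le in \<open>auto simp: prod_ennreal p_def intro!: ennreal_leI\<close>)
    also have "\<dots> = (\<Prod>b\<in>(Basis::(real^3) set). (\<integral>\<^sup>+t. ennreal (p t) \<partial>lborel))"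
      by (rule nn_integral_lborel_prod) auto
    also have "\<dots> < \<infinity>"
      using fin by (simp add: power_less_top_ennreal)
    finally show "(\<integral>\<^sup>+y. ennreal (norm (1 / sqrt (1 + (norm (y::real^3))\<^sup>2) ^ 5)) \<partial>lborel) < \<infinity>" .
  qed measurable
qed

text \<open>The value is \<open>4\<pi>\<close>; only its being nonzero matters.\<close>

definition kernel_const :: complex where
  "kernel_const = 3 * of_real (\<integral>y. 1 / sqrt (1 + (norm (y::real^3))\<^sup>2) ^ 5 \<partial>lborel)"

lemma kernel_const_nonzero: "kernel_const \<noteq> 0"
proof -
  let ?f = "\<lambda>y::real^3. 1 / sqrt (1 + (norm y)\<^sup>2) ^ 5"
  have pos: "?f y > 0" for y by (simp add: add_pos_nonneg)
  have "integral\<^sup>L lborel ?f \<noteq> 0"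
  proof
    assume "integral\<^sup>L lborel ?f = 0"
    then have "AE y in lborel. ?f y = 0"
      using integral_nonneg_eq_0_iff_AE[OF integrable_bracket_power5] pos by (simp add: less_imp_le)
    then have "AE y in (lborel :: (real^3) measure). False"
      by (rule AE_mp) (use pos in \<open>auto simp: less_le\<close>)
    then have "emeasure lborel (UNIV :: (real^3) set) = 0"
      by (simp add: AE_iff_measurable[where N=UNIV])
    then show False by (simp add: emeasure_lborel_UNIV)
  qed
  then show ?thesis by (simp add: kernel_const_def)
qed

section \<open>The spherical kernel as a function of the squared distance\<close>

text \<open>The argument \<open>s\<close> is the squared distance, so that \<open>s = |x - y|\<^sup>2 + e\<^sup>2\<close> is a smooth
  regularization to which \<open>C2_partials_radial\<close> applies; at \<open>s = 0\<close> division by zero gives \<open>0\<close>.\<close>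

definition spherical_kernel :: "real \<Rightarrow> real \<Rightarrow> complex" where
  "spherical_kernel k s = exp (\<i> * k * complex_of_real (sqrt s)) / complex_of_real (sqrt s)"

definition spherical_kernel' :: "real \<Rightarrow> real \<Rightarrow> complex" where
  "spherical_kernel' k s = exp (\<i> * k * complex_of_real (sqrt s)) *
     (\<i> * k / (2 * complex_of_real (sqrt s) ^ 2) - 1 / (2 * complex_of_real (sqrt s) ^ 3))"

definition spherical_kernel'' :: "real \<Rightarrow> real \<Rightarrow> complex" where
  "spherical_kernel'' k s = exp (\<i> * k * complex_of_real (sqrt s)) *
     (3 / (4 * complex_of_real (sqrt s) ^ 5) - 3 * \<i> * k / (4 * complex_of_real (sqrt s) ^ 4)
        - of_real k ^ 2 / (4 * complex_of_real (sqrt s) ^ 3))"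

lemma has_vector_derivative_sqrt_chain:
  assumes "s > 0" "(F has_field_derivative D) (at (of_real (sqrt s)))"
  shows "((\<lambda>s. F (of_real (sqrt s))) has_vector_derivative (D / (2 * of_real (sqrt s)))) (at s)"
proof -
  have "((\<lambda>t. F (of_real t)) has_vector_derivative D) (at (sqrt s))"
    using has_vector_derivative_real_field[OF assms(2)] by simp
  moreover have "(sqrt has_vector_derivative (inverse (sqrt s) / 2)) (at s)"
    using DERIV_real_sqrt[OF assms(1)] by (simp add: has_real_derivative_iff_has_vector_derivative)
  ultimately have "((\<lambda>t. F (of_real t)) \<circ> sqrt has_vector_derivative (inverse (sqrt s) / 2) *\<^sub>R D) (at s)"
    by (intro vector_diff_chain_at)
  then show ?thesis by (simp add: o_def scaleR_conv_of_real field_simps)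
qed

lemma spherical_kernel_deriv:
  assumes "s > 0"
  shows "(spherical_kernel k has_vector_derivative spherical_kernel' k s) (at s)"
proof -
  define z where "z = complex_of_real (sqrt s)"
  have z: "z \<noteq> 0" using assms by (simp add: z_def)
  have "((\<lambda>z. exp (\<i> * k * z) / z) has_field_derivative exp (\<i> * k * z) * (\<i> * k / z - 1 / z ^ 2)) (at z)"
    using z by (auto intro!: derivative_eq_intros simp: field_simps power2_eq_square)
  from has_vector_derivative_sqrt_chain[OF assms this[unfolded z_def]]
  have "(spherical_kernel k has_vector_derivative (exp (\<i> * k * z) * (\<i> * k / z - 1 / z ^ 2) / (2 * z))) (at s)"
    unfolding spherical_kernel_def [abs_def] z_def .
  also have "exp (\<i> * k * z) * (\<i> * k / z - 1 / z ^ 2) / (2 * z) = spherical_kernel' k s"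
    unfolding spherical_kernel'_def z_def [symmetric]
    using z by (simp add: field_simps eval_nat_numeral)
  finally show ?thesis .
qed

lemma spherical_kernel'_deriv:
  assumes "s > 0"
  shows "(spherical_kernel' k has_vector_derivative spherical_kernel'' k s) (at s)"
proof -
  define z where "z = complex_of_real (sqrt s)"
  have z: "z \<noteq> 0" using assms by (simp add: z_def)
  let ?D = "exp (\<i> * k * z) * (3 / (4 * z ^ 5) - 3 * \<i> * k / (4 * z ^ 4) - of_real k ^ 2 / (4 * z ^ 3))"
  have "((\<lambda>z. exp (\<i> * k * z) * (\<i> * k / (2 * z ^ 2) - 1 / (2 * z ^ 3))) has_field_derivative 2 * z * ?D) (at z)"
    using z by (auto intro!: derivative_eq_intros simp: field_simps eval_nat_numeral)
  from has_vector_derivative_sqrt_chain[OF assms this[unfolded z_def]]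
  have "(spherical_kernel' k has_vector_derivative (2 * z * ?D / (2 * z))) (at s)"
    unfolding spherical_kernel'_def [abs_def] z_def .
  also have "2 * z * ?D / (2 * z) = spherical_kernel'' k s"
    unfolding spherical_kernel''_def z_def [symmetric] using z by simp
  finally show ?thesis .
qed

text \<open>In dimension three the Laplacian of K(r^2) is 6 K' + 4 s K'' at s = r^2, so this is the
  radial Helmholtz equation for exp(ikr)/r.\<close>

lemma spherical_kernel_ode:
  assumes "s > 0"
  shows "6 * spherical_kernel' k s + 4 * s * spherical_kernel'' k s + of_real (k\<^sup>2) * spherical_kernel k s = 0"
proof -
  define z where "z = complex_of_real (sqrt s)"
  have z: "z \<noteq> 0" "complex_of_real s = z\<^sup>2"
    using assms by (simp_all add: z_def flip: of_real_power)
  show ?thesis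
    unfolding spherical_kernel'_def spherical_kernel''_def spherical_kernel_def z(2) z_def [symmetric]
    using z(1) by (simp add: field_simps eval_nat_numeral)
qed

lemma continuous_on_spherical_kernel:
  "continuous_on {0<..} (spherical_kernel k)" "continuous_on {0<..} (spherical_kernel'' k)"
  unfolding spherical_kernel_def [abs_def] spherical_kernel''_def [abs_def]
  by (auto intro!: continuous_intros)

text \<open>At s = |y - x|^2 + e^2 the Laplacian of the smoothed kernel is 6 K' + 4 (s - e^2) K''.
  Compared with the radial equation only the defect -4 e^2 K'' survives, and Green's identity moves
  the operator from \<open>w\<close> to the kernel.\<close>

lemma regularized_representation:
  fixes x :: "real^3"
  assumes w: "C2_partials UNIV w w' w''" and supp: "\<And>y. norm y > M \<Longrightarrow> w y = 0" and e: "e > 0"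
  shows "(\<integral>y. spherical_kernel k ((norm (y - x))\<^sup>2 + e\<^sup>2) * ((\<Sum>b\<in>Basis. w'' b y) + of_real (k\<^sup>2) * w y) \<partial>lborel)
     = (\<integral>y. - 4 * of_real e ^ 2 * spherical_kernel'' k ((norm (y - x))\<^sup>2 + e\<^sup>2) * w y \<partial>lborel)"
proof -
  have e2: "s > 0" if "s \<ge> e\<^sup>2" for s :: real using that e by (smt (verit) zero_less_power)
  let ?s = "\<lambda>y. (norm (y - x))\<^sup>2 + e\<^sup>2"
  have sp: "?s y > 0" for y using e by (simp add: add_nonneg_pos)
  let ?h = "\<lambda>b y. 2 * spherical_kernel' k (?s y) + of_real (4 * ((y - x) \<bullet> b)\<^sup>2) * spherical_kernel'' k (?s y)"
  have \<phi>: "C2_partials UNIV (\<lambda>y. spherical_kernel k (?s y))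
       (\<lambda>b y. of_real (2 * ((y - x) \<bullet> b)) * spherical_kernel' k (?s y)) ?h"
    by (rule C2_partials_radial)
      (use e2 in \<open>auto intro!: spherical_kernel_deriv spherical_kernel'_deriv
          continuous_on_subset[OF continuous_on_spherical_kernel(2)]\<close>)
  have cw: "continuous_on UNIV w" and cw'': "\<And>b. b \<in> Basis \<Longrightarrow> continuous_on UNIV (w'' b)"
    and ck: "continuous_on UNIV (\<lambda>y. spherical_kernel k (?s y))"
    and ch: "\<And>b. b \<in> Basis \<Longrightarrow> continuous_on UNIV (?h b)"
    using w \<phi> unfolding C2_partials_def by auto
  have op: "open {y::real^3. norm y > M}" by (intro open_Collect_less continuous_intros)
  have supp'': "w'' b y = 0" if "norm y > M" "b \<in> Basis" for y b
    using C2_partials_eq_0[OF w op _ _ that(2)] supp that(1) by auto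
  have i1: "integrable lborel (\<lambda>y. spherical_kernel k (?s y) * (\<Sum>b\<in>Basis. w'' b y))"
    by (rule integrable_continuous_bounded_support[where M=M])
      (use supp'' in \<open>auto intro!: continuous_intros ck cw''\<close>)
  have i2: "integrable lborel (\<lambda>y. spherical_kernel k (?s y) * (of_real (k\<^sup>2) * w y))"
    by (rule integrable_continuous_bounded_support[where M=M])
      (use supp in \<open>auto intro!: continuous_intros ck cw\<close>)
  have i3: "integrable lborel (\<lambda>y. w y * (\<Sum>b\<in>Basis. ?h b y))"
    by (rule integrable_continuous_bounded_support[where M=M])
      (use supp in \<open>auto simp only: mult_zero_left intro!: continuous_on_mult continuous_on_sum ch cw\<close>)
  have sum: "(\<Sum>b\<in>Basis. ?h b y) + of_real (k\<^sup>2) * spherical_kernel k (?s y) = - 4 * of_real e ^ 2 * spherical_kernel'' k (?s y)" for y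
  proof -
    have "(\<Sum>b\<in>Basis. ?h b y) = 6 * spherical_kernel' k (?s y) + of_real (\<Sum>b\<in>Basis. 4 * ((y - x) \<bullet> b)\<^sup>2) * spherical_kernel'' k (?s y)"
      by (simp add: sum.distrib sum_distrib_right)
    also have "(\<Sum>b\<in>Basis. 4 * ((y - x) \<bullet> b)\<^sup>2) = 4 * ?s y - 4 * e\<^sup>2"
      by (simp add: sum_inner_Basis_power2 flip: sum_distrib_left)
    finally show ?thesis
      using spherical_kernel_ode[OF sp, of k y] by (simp add: algebra_simps) (simp add: add_eq_0_iff2)
  qed
  have "(\<integral>y. spherical_kernel k (?s y) * ((\<Sum>b\<in>Basis. w'' b y) + of_real (k\<^sup>2) * w y) \<partial>lborel)
     = (\<integral>y. w y * (\<Sum>b\<in>Basis. ?h b y) \<partial>lborel) + (\<integral>y. spherical_kernel k (?s y) * (of_real (k\<^sup>2) * w y) \<partial>lborel)"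
    using green_identity[OF \<phi> w supp] i1 i2 by (simp add: distrib_left)
  also have "\<dots> = (\<integral>y. w y * (\<Sum>b\<in>Basis. ?h b y) + spherical_kernel k (?s y) * (of_real (k\<^sup>2) * w y) \<partial>lborel)"
    by (rule Bochner_Integration.integral_add[OF i3 i2, symmetric])
  also have "\<dots> = (\<integral>y. - 4 * of_real e ^ 2 * spherical_kernel'' k (?s y) * w y \<partial>lborel)"
    unfolding sum [symmetric] by (simp add: algebra_simps)
  finally show ?thesis .
qed

section \<open>Volume representation of solutions\<close>

lemma norm_spherical_kernel: "norm (spherical_kernel k s) = 1 / sqrt \<bar>s\<bar>" if "s \<ge> 0"
  using that by (simp add: spherical_kernel_def norm_divide norm_exp_imaginary)

text \<open>Substitute y = x + e z: the volume factor e^3 and the prefactor e^2 cancel the fifth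
  power of e in the leading term of the kernel. What remains is S^-5 times a function of e S alone,
  with value -4 * 3/4 = -3 at 0; this is the origin of the 3 in \<open>kernel_const\<close>.\<close>

lemma spherical_kernel''_scaled:
  assumes e: "e > 0" and S: "S = sqrt (1 + (norm z)\<^sup>2)"
  shows "of_real (e ^ 3) * (- 4 * of_real e ^ 2 * spherical_kernel'' k ((norm (e *\<^sub>R z))\<^sup>2 + e\<^sup>2))
     = exp (\<i> * k * of_real (e * S)) * (- 3 + 3 * \<i> * k * of_real (e * S) + of_real (k * (e * S)) ^ 2)
         * of_real (1 / S ^ 5)"
proof -
  have "(norm (e *\<^sub>R z))\<^sup>2 + e\<^sup>2 = e\<^sup>2 * (1 + (norm z)\<^sup>2)"
    by (simp add: power_mult_distrib algebra_simps)
  then have sq: "sqrt ((norm (e *\<^sub>R z))\<^sup>2 + e\<^sup>2) = e * S"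
    using e by (simp add: real_sqrt_mult S)
  have "S > 0" unfolding S by (simp add: add_pos_nonneg)
  define a b where "a = complex_of_real e" and "b = complex_of_real S"
  have "a \<noteq> 0" "b \<noteq> 0" using e \<open>S > 0\<close> by (auto simp: a_def b_def)
  then show ?thesis
    unfolding spherical_kernel''_def sq
    by (simp add: a_def [symmetric] b_def [symmetric]) (simp add: field_simps eval_nat_numeral)
qed

text \<open>Let e tend to 0 in \<open>regularized_representation\<close>. On the left the density
  vanishes near \<open>x\<close>, so the singularity is never met; on the right the rescaled defect
  concentrates at \<open>x\<close> and leaves -3 times the integral of S^-5 times
  \<open>w x\<close>.\<close>

lemma representation_compact_support:
  fixes x :: "real^3"
  assumes w: "C2_partials UNIV w w' w''" and supp: "\<And>y. norm y > M \<Longrightarrow> w y = 0"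
    and f: "\<And>y. f y = (\<Sum>b\<in>Basis. w'' b y) + of_real (k\<^sup>2) * w y"
    and d: "d > 0" and f0: "\<And>y. dist y x < d \<Longrightarrow> f y = 0"
  shows "(\<integral>y. spherical_kernel k ((norm (y - x))\<^sup>2) * f y \<partial>lborel) = - kernel_const * w x"
proof -
  define e where "e n = 1 / real (Suc n)" for n
  have e: "0 < e n" "e n \<le> 1" for n by (auto simp: e_def)
  have e0: "e \<longlonglongrightarrow> 0" unfolding e_def by (rule LIMSEQ_inverse_real_of_nat[unfolded inverse_eq_divide])
  have cw: "continuous_on UNIV w" and cw'': "\<And>b. b \<in> Basis \<Longrightarrow> continuous_on UNIV (w'' b)"
    using w unfolding C2_partials_def by auto
  have op: "open {y::real^3. norm y > M}" by (intro open_Collect_less continuous_intros)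
  have supp'': "w'' b y = 0" if "norm y > M" "b \<in> Basis" for y b
    using C2_partials_eq_0[OF w op _ _ that(2)] supp that(1) by auto
  have cf: "continuous_on UNIV f" by (subst continuous_on_cong[OF refl f]) (intro continuous_intros cw cw'')
  have suppf: "norm y > M \<Longrightarrow> f y = 0" for y using supp supp'' by (simp add: f)
  have fi: "integrable lborel f" by (rule integrable_continuous_bounded_support[OF cf suppf])
  have [measurable]: "f \<in> borel_measurable borel" "w \<in> borel_measurable borel"
    using cf cw by (auto intro: borel_measurable_continuous_onI)
  have [measurable]: "spherical_kernel k \<in> borel_measurable borel" "spherical_kernel'' k \<in> borel_measurable borel"
    unfolding spherical_kernel_def [abs_def] spherical_kernel''_def [abs_def] by measurable
  have lim1: "(\<lambda>n. \<integral>y. spherical_kernel k ((norm (y - x))\<^sup>2 + (e n)\<^sup>2) * f y \<partial>lborel)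
     \<longlonglongrightarrow> (\<integral>y. spherical_kernel k ((norm (y - x))\<^sup>2) * f y \<partial>lborel)"
  \<comment> \<open>Outside the ball of radius \<open>d\<close> the smoothed kernel is at most
    \<open>1 / d\<close>, inside it \<open>f\<close> is 0.\<close>
  proof (rule integral_dominated_convergence[where w="\<lambda>y. norm (f y) / d"])
    show "integrable lborel (\<lambda>y. norm (f y) / d)" using fi by simp
    show "AE y in lborel. (\<lambda>n. spherical_kernel k ((norm (y - x))\<^sup>2 + (e n)\<^sup>2) * f y)
        \<longlonglongrightarrow> spherical_kernel k ((norm (y - x))\<^sup>2) * f y"
    proof (rule AE_I2)
      fix y
      show "(\<lambda>n. spherical_kernel k ((norm (y - x))\<^sup>2 + (e n)\<^sup>2) * f y)
        \<longlonglongrightarrow> spherical_kernel k ((norm (y - x))\<^sup>2) * f y"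
      proof (cases "y = x")
        case True
        then have "f y = 0" using f0[of y] d by simp
        then show ?thesis by simp
      next
        case False
        have "isCont (spherical_kernel k) ((norm (y - x))\<^sup>2)"
          using continuous_on_spherical_kernel(1)[of k] False
          by (subst (asm) continuous_on_eq_continuous_at) auto
        moreover have "(\<lambda>n. (norm (y - x))\<^sup>2 + (e n)\<^sup>2) \<longlonglongrightarrow> (norm (y - x))\<^sup>2 + 0\<^sup>2"
          by (intro tendsto_intros e0)
        ultimately have "(\<lambda>n. spherical_kernel k ((norm (y - x))\<^sup>2 + (e n)\<^sup>2)) \<longlonglongrightarrow> spherical_kernel k ((norm (y - x))\<^sup>2)"
          using isCont_tendsto_compose[where g="spherical_kernel k"] by (metis power_zero_numeral add_0_right)
        then show ?thesis by (intro tendsto_mult tendsto_const)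
      qed
    qed
    show "AE y in lborel. norm (spherical_kernel k ((norm (y - x))\<^sup>2 + (e n)\<^sup>2) * f y) \<le> norm (f y) / d" for n
    proof (rule AE_I2)
      fix y
      show "norm (spherical_kernel k ((norm (y - x))\<^sup>2 + (e n)\<^sup>2) * f y) \<le> norm (f y) / d"
      proof (cases "dist y x < d")
        case True
        then show ?thesis using f0 by simp
      next
        case False
        have "d\<^sup>2 \<le> (norm (y - x))\<^sup>2 + (e n)\<^sup>2"
          using False d by (auto simp: dist_norm not_less intro!: add_increasing2 power_mono)
        then have "d \<le> sqrt ((norm (y - x))\<^sup>2 + (e n)\<^sup>2)" using d by (simp add: real_le_rsqrt)
        then have "norm (spherical_kernel k ((norm (y - x))\<^sup>2 + (e n)\<^sup>2)) \<le> 1 / d"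
          using d by (simp add: norm_spherical_kernel divide_left_mono frac_le)
        from mult_right_mono[OF this norm_ge_zero[of "f y"]]
        show ?thesis by (simp add: norm_mult)
      qed
    qed
  qed measurable
  define S where "S z = sqrt (1 + (norm (z::real^3))\<^sup>2)" for z
  have [measurable]: "S \<in> borel_measurable borel" unfolding S_def [abs_def] by measurable
  have S: "S z \<ge> 1" "S z \<le> 1 + norm z" for z
    unfolding S_def using norm_ge_zero[of z] by (auto intro!: real_le_lsqrt simp: power2_eq_square algebra_simps)
  define P where "P r = exp (\<i> * k * of_real r) * (- 3 + 3 * \<i> * k * of_real r + of_real (k * r) ^ 2)" for r :: real
  have [measurable]: "P \<in> borel_measurable borel" unfolding P_def [abs_def] by measurable
  have cP: "isCont P r" for r unfolding P_def [abs_def] by (intro continuous_intros)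
  have rhs: "(\<integral>y. - 4 * of_real (e n) ^ 2 * spherical_kernel'' k ((norm (y - x))\<^sup>2 + (e n)\<^sup>2) * w y \<partial>lborel)
      = (\<integral>z. P (e n * S z) * of_real (1 / S z ^ 5) * w (x + e n *\<^sub>R z) \<partial>lborel)" for n
  proof -
    have "(\<integral>y. - 4 * of_real (e n) ^ 2 * spherical_kernel'' k ((norm (y - x))\<^sup>2 + (e n)\<^sup>2) * w y \<partial>lborel)
      = of_real (e n ^ 3) * (\<integral>z. - 4 * of_real (e n) ^ 2 * spherical_kernel'' k ((norm (x + e n *\<^sub>R z - x))\<^sup>2 + (e n)\<^sup>2) * w (x + e n *\<^sub>R z) \<partial>lborel)"
      using integral_lborel_affine[of "\<lambda>y. - 4 * of_real (e n) ^ 2 * spherical_kernel'' k ((norm (y - x))\<^sup>2 + (e n)\<^sup>2) * w y" "e n" x] e[of n]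
      by (simp add: scaleR_conv_of_real)
    also have "\<dots> = (\<integral>z. of_real (e n ^ 3) * (- 4 * of_real (e n) ^ 2 * spherical_kernel'' k ((norm (e n *\<^sub>R z))\<^sup>2 + (e n)\<^sup>2)) * w (x + e n *\<^sub>R z) \<partial>lborel)"
      by (subst integral_mult_right_zero [symmetric]) (simp only: mult.assoc add_diff_cancel_left')
    also have "\<dots> = (\<integral>z. P (e n * S z) * of_real (1 / S z ^ 5) * w (x + e n *\<^sub>R z) \<partial>lborel)"
      unfolding P_def by (subst spherical_kernel''_scaled[OF e(1) S_def]) (rule refl)
    finally show ?thesis .
  qed
  obtain B where B: "B \<ge> 0" "\<And>y. norm (w y) \<le> B"
    using bounded_continuous_bounded_support[OF cw supp] by blast
  \<comment> \<open>Where \<open>w (x + e n *\<^sub>R z)\<close> is nonzero,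
    \<open>e n * norm z\<close> is at most \<open>\<bar>M\<bar> + norm x\<close>; together with
    \<open>e n \<le> 1\<close> this gives \<open>e n * S z \<le> R\<close>. Hence \<open>A\<close>
    bounds the factor \<open>P\<close> times \<open>w\<close> uniformly in \<open>n\<close>,
    although \<open>P\<close> itself grows quadratically.\<close>
  define R where "R = 1 + \<bar>M\<bar> + norm x"
  define A where "A = (3 + 3 * \<bar>k\<bar> * R + (k * R)\<^sup>2) * B"
  have lim2: "(\<lambda>n. \<integral>z. P (e n * S z) * of_real (1 / S z ^ 5) * w (x + e n *\<^sub>R z) \<partial>lborel)
      \<longlonglongrightarrow> (\<integral>z. P 0 * of_real (1 / S z ^ 5) * w x \<partial>lborel)"
  proof (rule integral_dominated_convergence[where w="\<lambda>z. A * (1 / S z ^ 5)"])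
    show "integrable lborel (\<lambda>z. A * (1 / S z ^ 5))"
      unfolding S_def by (intro integrable_mult_right integrable_bracket_power5)
    show "AE z in lborel. (\<lambda>n. P (e n * S z) * of_real (1 / S z ^ 5) * w (x + e n *\<^sub>R z)) \<longlonglongrightarrow> P 0 * of_real (1 / S z ^ 5) * w x"
    proof (rule AE_I2)
      fix z
      have "(\<lambda>n. e n * S z) \<longlonglongrightarrow> 0 * S z" by (intro tendsto_intros e0)
      then have 1: "(\<lambda>n. P (e n * S z)) \<longlonglongrightarrow> P 0" using isCont_tendsto_compose[OF cP] by (metis mult_zero_left)
      have "(\<lambda>n. x + e n *\<^sub>R z) \<longlonglongrightarrow> x + 0 *\<^sub>R z" by (intro tendsto_intros e0)
      moreover have "isCont w x" using cw by (simp add: continuous_on_eq_continuous_at)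
      ultimately have 2: "(\<lambda>n. w (x + e n *\<^sub>R z)) \<longlonglongrightarrow> w x" using isCont_tendsto_compose[where g=w] by (metis scaleR_zero_left add_0_right)
      show "(\<lambda>n. P (e n * S z) * of_real (1 / S z ^ 5) * w (x + e n *\<^sub>R z)) \<longlonglongrightarrow> P 0 * of_real (1 / S z ^ 5) * w x"
        by (intro tendsto_mult 1 2 tendsto_const)
    qed
    show "AE z in lborel. norm (P (e n * S z) * of_real (1 / S z ^ 5) * w (x + e n *\<^sub>R z)) \<le> A * (1 / S z ^ 5)" for n
    proof (rule AE_I2)
      fix z
      have "norm (P (e n * S z)) * norm (w (x + e n *\<^sub>R z)) \<le> A"
      proof (cases "norm (x + e n *\<^sub>R z) \<le> M")
        case False
        then show ?thesis using supp[of "x + e n *\<^sub>R z"] B(1) by (simp add: A_def R_def)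
      next
        case True
        have "e n * norm z = norm (x + e n *\<^sub>R z - x)" using e[of n] by simp
        also have "\<dots> \<le> \<bar>M\<bar> + norm x" using True norm_triangle_ineq4[of "x + e n *\<^sub>R z" x] by linarith
        finally have "e n * norm z \<le> \<bar>M\<bar> + norm x" .
        moreover have "e n * S z \<le> e n * (1 + norm z)" using S(2)[of z] e(1)[of n] by simp
        ultimately have r: "e n * S z \<le> R" using e(2)[of n] unfolding R_def by (simp add: distrib_left)
        have r0: "e n * S z \<ge> 0" using S(1)[of z] e(1)[of n] by simp
        have "norm (P (e n * S z)) = norm (- 3 + 3 * \<i> * k * of_real (e n * S z) + of_real (k * (e n * S z)) ^ 2)"
          unfolding P_def norm_mult by (simp add: norm_exp_imaginary)
        also have "\<dots> \<le> norm (- 3 + 3 * \<i> * k * of_real (e n * S z)) + norm (complex_of_real (k * (e n * S z)) ^ 2)"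
          by (rule norm_triangle_ineq)
        also have "norm (- 3 + 3 * \<i> * k * of_real (e n * S z)) \<le> norm (- 3 :: complex) + norm (3 * \<i> * k * of_real (e n * S z))"
          by (rule norm_triangle_ineq)
        also have "norm (3 * \<i> * k * of_real (e n * S z)) = 3 * \<bar>k\<bar> * (e n * S z)"
          using e(1)[of n] S(1)[of z] by (simp add: norm_mult abs_mult)
        also have "\<dots> \<le> 3 * \<bar>k\<bar> * R" using r by (intro mult_left_mono) auto
        also have "norm (complex_of_real (k * (e n * S z)) ^ 2) = (\<bar>k\<bar> * (e n * S z))\<^sup>2"
          using e(1)[of n] S(1)[of z] by (simp add: norm_power norm_mult abs_mult)
        also have "\<dots> \<le> (\<bar>k\<bar> * R)\<^sup>2"
          using r r0 by (intro power_mono mult_left_mono) auto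
        also have "\<dots> = (k * R)\<^sup>2" by (simp add: power_mult_distrib)
        finally have "norm (P (e n * S z)) \<le> 3 + 3 * \<bar>k\<bar> * R + (k * R)\<^sup>2" by simp
        then show ?thesis
          unfolding A_def using B
          by (intro mult_mono) (auto intro: order_trans[OF norm_ge_zero])
      qed
      from mult_right_mono[OF this, of "1 / S z ^ 5"] S(1)[of z]
      show "norm (P (e n * S z) * of_real (1 / S z ^ 5) * w (x + e n *\<^sub>R z)) \<le> A * (1 / S z ^ 5)"
        by (simp add: norm_mult norm_divide norm_power field_simps)
    qed
  qed measurable
  have "(\<integral>z. P 0 * of_real (1 / S z ^ 5) * w x \<partial>lborel) = P 0 * (\<integral>z. of_real (1 / S z ^ 5) \<partial>lborel) * w x"
    by (simp only: integral_mult_left_zero integral_mult_right_zero)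
  also have "(\<integral>z. complex_of_real (1 / S z ^ 5) \<partial>lborel) = of_real (\<integral>z. 1 / S z ^ 5 \<partial>lborel)"
    by (rule integral_complex_of_real)
  finally have I: "(\<integral>z. P 0 * of_real (1 / S z ^ 5) * w x \<partial>lborel) = - kernel_const * w x"
    by (simp add: P_def kernel_const_def S_def)
  have eq: "(\<integral>y. spherical_kernel k ((norm (y - x))\<^sup>2 + (e n)\<^sup>2) * f y \<partial>lborel) =
      (\<integral>z. P (e n * S z) * of_real (1 / S z ^ 5) * w (x + e n *\<^sub>R z) \<partial>lborel)" for n
    unfolding rhs [symmetric] f by (rule regularized_representation[OF w supp e(1)])
  show ?thesis
    using LIMSEQ_unique[OF lim1 lim2[folded eq]] I by simp
qed

lemma integrable_spherical_kernel_mult: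
  fixes x :: "real^3"
  assumes cf: "continuous_on UNIV f" and supp: "\<And>y. norm y > M \<Longrightarrow> f y = 0"
    and d: "d > 0" and f0: "\<And>y. dist y x < d \<Longrightarrow> f y = 0"
  shows "integrable lborel (\<lambda>y. spherical_kernel k ((norm (y - x))\<^sup>2) * f y)"
proof (rule Bochner_Integration.integrable_bound)
  have [measurable]: "f \<in> borel_measurable borel" using cf by (rule borel_measurable_continuous_onI)
  have [measurable]: "spherical_kernel k \<in> borel_measurable borel"
    unfolding spherical_kernel_def [abs_def] by measurable
  show "integrable lborel (\<lambda>y. norm (f y) / d)"
    using integrable_continuous_bounded_support[OF cf supp] by simp
  show "(\<lambda>y. spherical_kernel k ((norm (y - x))\<^sup>2) * f y) \<in> borel_measurable lborel" by measurable
  show "AE y in lborel. norm (spherical_kernel k ((norm (y - x))\<^sup>2) * f y) \<le> norm (norm (f y) / d)"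
  proof (rule AE_I2)
    fix y
    show "norm (spherical_kernel k ((norm (y - x))\<^sup>2) * f y) \<le> norm (norm (f y) / d)"
    proof (cases "dist y x < d")
      case True
      then show ?thesis using f0 by simp
    next
      case False
      then have "norm (spherical_kernel k ((norm (y - x))\<^sup>2)) \<le> 1 / d"
        using d by (simp add: norm_spherical_kernel frac_le dist_norm)
      from mult_right_mono[OF this norm_ge_zero[of "f y"]]
      show ?thesis using d by (simp add: norm_mult)
    qed
  qed
qed

text \<open>Cut \<open>w\<close> off between radius rho and 2 rho and apply the compact case to the
  product; only terms in this shell separate the outcome from the claim. The sign of
  \<open>k\<close> is free: the equation contains \<open>k\<^sup>2\<close> alone and the kernel is
  estimated by its absolute value.\<close>

lemma representation_decaying:
  fixes x :: "real^3"
  assumes w: "C2_partials UNIV w w' w''"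
    and f: "\<And>y. f y = (\<Sum>b\<in>Basis. w'' b y) + of_real (k\<^sup>2) * w y"
    and f0: "\<And>y. norm y \<ge> M \<Longrightarrow> f y = 0" and x: "norm x > M"
    and decay: "\<And>d. d > 0 \<Longrightarrow> \<exists>r. \<forall>y. norm y \<ge> r \<longrightarrow>
       norm y * norm (w y) \<le> d \<and> norm (\<Sum>b\<in>Basis. of_real (y \<bullet> b) * w' b y) \<le> d"
  shows "(\<integral>y. spherical_kernel k ((norm (y - x))\<^sup>2) * f y \<partial>lborel) = - kernel_const * w x"
proof -
  obtain q q' q'' :: "real \<Rightarrow> real" and A :: real where q:
    "\<And>s. (q has_real_derivative q' s) (at s)" "\<And>s. (q' has_real_derivative q'' s) (at s)"
    "continuous_on UNIV q''"
    "\<And>s. s \<le> 1 \<Longrightarrow> q s = 1 \<and> q' s = 0 \<and> q'' s = 0"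
    "\<And>s. s \<ge> 4 \<Longrightarrow> q s = 0 \<and> q' s = 0 \<and> q'' s = 0"
    "\<And>s. \<bar>q' s\<bar> \<le> A" "\<And>s. \<bar>q'' s\<bar> \<le> A"
    using smooth_step by metis
  have A: "A \<ge> 0" using q(6)[of 0] by linarith
  have cw: "continuous_on UNIV w" and cw'': "\<And>b. b \<in> Basis \<Longrightarrow> continuous_on UNIV (w'' b)"
    using w unfolding C2_partials_def by auto
  have cf: "continuous_on UNIV f" by (subst continuous_on_cong[OF refl f]) (intro continuous_intros cw cw'')
  let ?K = "\<lambda>y. spherical_kernel k ((norm (y - x))\<^sup>2)"
  have intf: "integrable lborel (\<lambda>y. ?K y * f y)"
  proof (rule integrable_spherical_kernel_mult[OF cf, where M=M and d="norm x - M"])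
    fix y assume "dist y x < norm x - M"
    then have "norm y \<ge> M" using norm_triangle_ineq2[of x y] by (simp add: dist_norm norm_minus_commute)
    then show "f y = 0" by (rule f0)
  qed (use f0 x in auto)
  define V where "V = unit_ball_vol 3"
  have V: "V \<ge> 0" by (simp add: V_def)
  \<comment> \<open>416 = 26 * 2 * 8: the shell bound for \<open>g\<close>, the kernel bound
    \<open>2 / \<rho>\<close>, and the volume \<open>V * (2 * \<rho>) ^ 3\<close>; all powers of
    \<open>\<rho>\<close> cancel.\<close>
  have bound: "norm ((\<integral>y. ?K y * f y \<partial>lborel) - (- kernel_const * w x)) \<le> 416 * A * V * d" if d: "d > 0" for d
  proof -
    obtain r where r: "\<And>y. norm y \<ge> r \<Longrightarrow> norm y * norm (w y) \<le> d"
      "\<And>y. norm y \<ge> r \<Longrightarrow> norm (\<Sum>b\<in>Basis. of_real (y \<bullet> b) * w' b y) \<le> d"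
      using decay[OF d] by metis
    \<comment> \<open>Beyond \<open>\<rho>\<close> the density \<open>f\<close> is 0 and the decay
      bounds hold. The entry \<open>2 * norm x + 1\<close> puts \<open>x\<close> well inside and
      makes \<open>norm (y - x)\<close> at least \<open>\<rho> / 2\<close> when
      \<open>norm y\<close> exceeds \<open>\<rho>\<close>.\<close>
    define \<rho> where "\<rho> = max (max 1 r) (max M (2 * norm x + 1))"
    have \<rho>: "\<rho> \<ge> 1" "\<rho> \<ge> r" "\<rho> \<ge> M" "\<rho> \<ge> 2 * norm x + 1" "\<rho> > 0" by (auto simp: \<rho>_def)
    define N where "N = (\<lambda>y::real^3. (norm y)\<^sup>2)"
    define \<eta> \<eta>' \<eta>'' where "\<eta> s = complex_of_real (q (s / \<rho>\<^sup>2))" and "\<eta>' s = complex_of_real (q' (s / \<rho>\<^sup>2) / \<rho>\<^sup>2)"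
      and "\<eta>'' s = complex_of_real (q'' (s / \<rho>\<^sup>2) / \<rho> ^ 4)" for s
    have dq: "((\<lambda>s. F (s / \<rho>\<^sup>2)) has_real_derivative F' (s / \<rho>\<^sup>2) / \<rho>\<^sup>2) (at s)"
      if "\<And>s. (F has_real_derivative F' s) (at s)" for F F' :: "real \<Rightarrow> real" and s
    proof -
      have "((\<lambda>s. s / \<rho>\<^sup>2) has_real_derivative 1 / \<rho>\<^sup>2) (at s)"
        by (rule DERIV_cdivide[OF DERIV_ident])
      from DERIV_chain2[OF that this] show ?thesis by simp
    qed
    have \<eta>1: "(\<eta> has_vector_derivative \<eta>' s) (at s)" for s
      unfolding \<eta>_def [abs_def] \<eta>'_def
      by (intro has_vector_derivative_of_real) (simp add: dq[OF q(1)])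
    have \<eta>2: "(\<eta>' has_vector_derivative \<eta>'' s) (at s)" for s
    proof -
      have "((\<lambda>s. q' (s / \<rho>\<^sup>2) / \<rho>\<^sup>2) has_real_derivative q'' (s / \<rho>\<^sup>2) / \<rho>\<^sup>2 / \<rho>\<^sup>2) (at s)"
        by (intro DERIV_cdivide dq[OF q(2)])
      also have "q'' (s / \<rho>\<^sup>2) / \<rho>\<^sup>2 / \<rho>\<^sup>2 = q'' (s / \<rho>\<^sup>2) / \<rho> ^ 4" by (simp add: eval_nat_numeral)
      finally show ?thesis unfolding \<eta>''_def \<eta>'_def [abs_def] by (intro has_vector_derivative_of_real) simp
    qed
    have "continuous_on {0..} (\<lambda>s. q'' (s / \<rho>\<^sup>2))"
      by (rule continuous_on_compose2[OF q(3)]) (use \<rho>(5) in \<open>auto intro!: continuous_intros\<close>)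
    then have \<eta>3: "continuous_on {0..} \<eta>''"
      unfolding \<eta>''_def [abs_def]
      by (intro continuous_on_of_real continuous_on_divide continuous_on_const) (use \<rho>(5) in auto)
    define h where "h b y = 2 * \<eta>' (N y) + of_real (4 * (y \<bullet> b)\<^sup>2) * \<eta>'' (N y)" for b y
    have C\<eta>: "C2_partials UNIV (\<lambda>y. \<eta> (N y)) (\<lambda>b y. of_real (2 * (y \<bullet> b)) * \<eta>' (N y)) h"
      using C2_partials_radial[of 0 \<eta> \<eta>' \<eta>'' "0 :: real^3", OF \<eta>1 \<eta>2 \<eta>3] by (simp add: N_def h_def [abs_def])
    define g where "g y = (\<Sum>b\<in>Basis. \<eta> (N y) * w'' b y + 2 * (of_real (2 * (y \<bullet> b)) * \<eta>' (N y)) * w' b y + h b y * w y)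
       + of_real (k\<^sup>2) * (\<eta> (N y) * w y)" for y
    \<comment> \<open>Apart from the first term, everything contains a derivative of the cutoff and
      so lives in the shell. The gradient of a radial cutoff sees only the radial derivative of
      \<open>w\<close>, which is what the decay hypothesis controls.\<close>
    have geq: "g y = \<eta> (N y) * f y + (4 * \<eta>' (N y) * (\<Sum>b\<in>Basis. of_real (y \<bullet> b) * w' b y)
         + (6 * \<eta>' (N y) + 4 * of_real (N y) * \<eta>'' (N y)) * w y)" for y
    proof -
      have "(\<Sum>b\<in>Basis. h b y) = 6 * \<eta>' (N y) + of_real (\<Sum>b\<in>Basis. 4 * (y \<bullet> b)\<^sup>2) * \<eta>'' (N y)"
        by (simp add: h_def sum.distrib sum_distrib_right)
      also have "(\<Sum>b\<in>Basis. 4 * (y \<bullet> b)\<^sup>2) = 4 * N y"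
        by (simp add: N_def sum_inner_Basis_power2 flip: sum_distrib_left)
      finally have h: "(\<Sum>b\<in>Basis. h b y) = 6 * \<eta>' (N y) + of_real (4 * N y) * \<eta>'' (N y)" .
      have "g y = \<eta> (N y) * (\<Sum>b\<in>Basis. w'' b y) + 4 * \<eta>' (N y) * (\<Sum>b\<in>Basis. of_real (y \<bullet> b) * w' b y)
         + (\<Sum>b\<in>Basis. h b y) * w y + of_real (k\<^sup>2) * (\<eta> (N y) * w y)"
        unfolding g_def sum.distrib sum_distrib_left sum_distrib_right by (simp add: mult_ac)
      then show ?thesis unfolding h f by (simp add: algebra_simps)
    qed
    have Nle: "N y / \<rho>\<^sup>2 \<le> 1" if "norm y \<le> \<rho>" for y
      using that \<rho>(5) by (simp add: N_def power_mono)
    have Nge: "N y / \<rho>\<^sup>2 \<ge> 4" if "norm y \<ge> 2 * \<rho>" for y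
    proof -
      have "(2 * \<rho>)\<^sup>2 \<le> (norm y)\<^sup>2" using that \<rho>(5) by (intro power_mono) auto
      then show ?thesis using \<rho>(5) by (simp add: N_def field_simps)
    qed
    have in_: "g y = f y" if "norm y \<le> \<rho>" for y
      using q(4)[OF Nle[OF that]] by (simp add: geq \<eta>_def \<eta>'_def \<eta>''_def)
    have out: "g y = 0" "\<eta> (N y) = 0" if "norm y \<ge> 2 * \<rho>" for y
      using q(5)[OF Nge[OF that]] by (simp_all add: geq \<eta>_def \<eta>'_def \<eta>''_def)
    \<comment> \<open>26 = 4 + 6 + 16: the gradient term gives 4, and the Laplacian of the cutoff
      gives 6 and 4 * 4, because \<open>N y \<le> 4 * \<rho>\<^sup>2\<close>.\<close>
    have mid: "norm (g y) \<le> 26 * A * d / \<rho>\<^sup>2" if y: "\<rho> < norm y" "norm y \<le> 2 * \<rho>" for y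
    proof -
      have "f y = 0" using f0 \<rho>(3) y by simp
      have e1: "norm (\<eta>' (N y)) \<le> A / \<rho>\<^sup>2"
        using q(6)[of "N y / \<rho>\<^sup>2"] unfolding \<eta>'_def norm_of_real by (simp add: divide_right_mono)
      have e2: "norm (\<eta>'' (N y)) \<le> A / \<rho> ^ 4"
        using q(7)[of "N y / \<rho>\<^sup>2"] unfolding \<eta>''_def norm_of_real by (simp add: divide_right_mono)
      have "N y \<le> (2 * \<rho>)\<^sup>2" unfolding N_def using y by (intro power_mono) auto
      then have N: "N y \<le> 4 * \<rho>\<^sup>2" "0 \<le> N y" by (auto simp: N_def power_mult_distrib)
      have "1 * norm (w y) \<le> norm y * norm (w y)" using y \<rho>(1) by (intro mult_right_mono) auto
      then have wy: "norm (w y) \<le> d" using r(1)[of y] y \<rho>(2) by simp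
      have s: "norm (\<Sum>b\<in>Basis. of_real (y \<bullet> b) * w' b y) \<le> d" using r(2) y \<rho>(2) by simp
      have "norm (6 * \<eta>' (N y) + 4 * of_real (N y) * \<eta>'' (N y)) \<le> 6 * norm (\<eta>' (N y)) + 4 * N y * norm (\<eta>'' (N y))"
        using norm_triangle_ineq[of "6 * \<eta>' (N y)" "4 * of_real (N y) * \<eta>'' (N y)"] N(2) by (simp add: norm_mult)
      also have "\<dots> \<le> 6 * (A / \<rho>\<^sup>2) + 4 * (4 * \<rho>\<^sup>2) * (A / \<rho> ^ 4)"
        using e1 e2 N A by (intro add_mono mult_mono) auto
      also have "\<dots> = 22 * (A / \<rho>\<^sup>2)" using \<rho>(5) by (simp add: field_simps eval_nat_numeral)
      finally have c: "norm (6 * \<eta>' (N y) + 4 * of_real (N y) * \<eta>'' (N y)) \<le> 22 * (A / \<rho>\<^sup>2)" .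
      have "norm (g y) \<le> norm (4 * \<eta>' (N y) * (\<Sum>b\<in>Basis. of_real (y \<bullet> b) * w' b y))
          + norm ((6 * \<eta>' (N y) + 4 * of_real (N y) * \<eta>'' (N y)) * w y)"
        unfolding geq \<open>f y = 0\<close> mult_zero_right add_0 by (rule norm_triangle_ineq)
      also have "\<dots> \<le> 4 * (A / \<rho>\<^sup>2) * d + 22 * (A / \<rho>\<^sup>2) * d"
        unfolding norm_mult[of _ "w y"] norm_mult[of "4 * \<eta>' (N y)"]
        using e1 c s wy A \<rho>(5) by (intro add_mono mult_mono) (auto simp: norm_mult)
      also have "\<dots> = 26 * A * d / \<rho>\<^sup>2" by (simp add: field_simps)
      finally show ?thesis .
    qed
    have cg: "continuous_on UNIV g"
    proof -
      note P = C2_partials_mult[OF C\<eta> w]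
      have "continuous_on UNIV (\<lambda>y. \<eta> (N y) * w y)" using P unfolding C2_partials_def by blast
      moreover have "continuous_on UNIV (\<lambda>y. \<eta> (N y) * w'' b y + 2 * (of_real (2 * (y \<bullet> b)) * \<eta>' (N y)) * w' b y + h b y * w y)"
        if "b \<in> Basis" for b
        using P that unfolding C2_partials_def by blast
      ultimately show ?thesis unfolding g_def [abs_def]
        by (intro continuous_on_add[OF continuous_on_sum continuous_on_mult[OF continuous_on_const]])
    qed
    \<comment> \<open>Points this close to \<open>x\<close> have norm at least \<open>M\<close>,
      where \<open>f\<close> is 0, and at most \<open>\<rho>\<close>, where \<open>g\<close> equals
      \<open>f\<close>.\<close>
    define d' where "d' = min (norm x - M) 1"
    have d': "d' > 0" using x by (simp add: d'_def)
    have g0: "g y = 0" if "dist y x < d'" for y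
    proof -
      have "norm (y - x) < norm x - M" "norm (y - x) < 1" using that by (auto simp: dist_norm d'_def)
      then have "norm y \<ge> M" "norm y \<le> \<rho>"
        using norm_triangle_ineq2[of x y, unfolded norm_minus_commute[of x y]] norm_triangle_ineq2[of y x]
          \<rho>(4) norm_ge_zero[of x] by linarith+
      then show ?thesis using in_ f0 by simp
    qed
    have rep: "(\<integral>y. ?K y * g y \<partial>lborel) = - kernel_const * w x"
    proof -
      have "(\<integral>y. ?K y * g y \<partial>lborel) = - kernel_const * (\<eta> (N x) * w x)"
        by (rule representation_compact_support[OF C2_partials_mult[OF C\<eta> w], where M="2*\<rho>" and d=d'])
          (use d' g0 out in \<open>simp_all add: g_def\<close>)
      moreover have "\<eta> (N x) = 1" using q(4)[OF Nle[of x]] \<rho> norm_ge_zero[of x] by (simp add: \<eta>_def)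
      ultimately show ?thesis by simp
    qed
    have ig: "integrable lborel (\<lambda>y. ?K y * g y)"
      by (rule integrable_spherical_kernel_mult[OF cg, where M="2*\<rho>" and d=d']) (use d' g0 out in auto)
    have bd: "norm (?K y * f y - ?K y * g y) \<le> 52 * A * d / \<rho> ^ 3 * indicator (cball 0 (2 * \<rho>)) y" for y
    proof (cases "norm y \<le> \<rho> \<or> norm y > 2 * \<rho>")
      case True
      moreover have "f y = 0" if "norm y > 2 * \<rho>" using f0 that \<rho> by simp
      ultimately show ?thesis using in_ out A d \<rho>(5) by (auto simp: indicator_def)
    next
      case False
      then have y: "\<rho> < norm y" "norm y \<le> 2 * \<rho>" by auto
      have "f y = 0" using f0 y \<rho> by simp
      have "\<rho> / 2 \<le> norm (y - x)" using norm_triangle_ineq2[of y x] y \<rho>(4) norm_ge_zero[of x] by linarith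
      then have "norm (?K y) \<le> 1 / (\<rho> / 2)"
        using \<rho>(5) by (simp add: norm_spherical_kernel frac_le del: divide_divide_eq_right)
      then have "norm (?K y) * norm (g y) \<le> (1 / (\<rho> / 2)) * (26 * A * d / \<rho>\<^sup>2)"
        using mid[OF y] \<rho>(5) by (intro mult_mono) auto
      also have "\<dots> = 52 * A * d / \<rho> ^ 3" by (simp add: eval_nat_numeral)
      finally show ?thesis using y \<open>f y = 0\<close> by (simp add: norm_mult)
    qed
    have "norm (\<integral>y. ?K y * f y - ?K y * g y \<partial>lborel) \<le> (\<integral>y. 52 * A * d / \<rho> ^ 3 * indicator (cball (0::real^3) (2 * \<rho>)) y \<partial>lborel)"
    proof (rule Bochner_Integration.integral_norm_bound_integral)
      show "integrable lborel (\<lambda>y. ?K y * f y - ?K y * g y)"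
        by (intro Bochner_Integration.integrable_diff intf ig)
      show "integrable lborel (\<lambda>y. 52 * A * d / \<rho> ^ 3 * indicator (cball (0::real^3) (2 * \<rho>)) y)"
        by (intro integrable_mult_right integrable_real_indicator)
          (use emeasure_bounded_finite[of "cball (0::real^3) (2 * \<rho>)"] in auto)
    qed (rule bd)
    also have "\<dots> = 52 * A * d / \<rho> ^ 3 * measure lborel (cball (0::real^3) (2 * \<rho>))" by simp
    also have "measure lborel (cball (0::real^3) (2 * \<rho>)) = V * (2 * \<rho>) ^ 3"
      using \<rho>(5) by (simp add: content_cball V_def)
    also have "52 * A * d / \<rho> ^ 3 * (V * (2 * \<rho>) ^ 3) = 416 * A * V * d"
      using \<rho>(5) by (simp add: field_simps)
    finally show ?thesis using intf ig rep by simp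
  qed
  have "norm ((\<integral>y. ?K y * f y \<partial>lborel) - (- kernel_const * w x)) \<le> 0"
  proof (rule field_le_epsilon)
    fix e :: real assume e: "e > 0"
    \<comment> \<open>The summand 1 prevents a division by zero when \<open>A * V\<close> is
      0.\<close>
    have p: "416 * A * V + 1 > 0" using A V by (simp add: add_nonneg_pos)
    have "416 * A * V * (e / (416 * A * V + 1)) \<le> e"
      using p e A V by (simp add: field_simps)
    then show "norm ((\<integral>y. ?K y * f y \<partial>lborel) - (- kernel_const * w x)) \<le> 0 + e"
      using bound[of "e / (416 * A * V + 1)"] p e by simp
  qed
  then show ?thesis by (simp add: eq_neg_iff_add_eq_0)
qed

section \<open>Analyticity of solutions along analytic curves\<close>

text \<open>The right-hand side is holomorphic on the half-plane of positive real part, which is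
  what allows the squared distance to become complex.\<close>

lemma helmholtz_kernel_csqrt:
  assumes "s \<ge> 0"
  shows "spherical_kernel k s = exp (\<i> * k * csqrt (of_real s)) / csqrt (of_real s)"
  using assms by (simp add: spherical_kernel_def csqrt_of_real_nonneg)

lemma holomorphic_on_integral_cbox:
  fixes f :: "'a::euclidean_space \<Rightarrow> complex" and G :: "complex \<Rightarrow> 'a \<Rightarrow> complex"
  assumes f: "continuous_on (cbox a b) f" and U: "convex U"
    and G: "\<And>t y. t \<in> U \<Longrightarrow> y \<in> cbox a b \<Longrightarrow> ((\<lambda>t. G t y) has_field_derivative G' t y) (at t)"
    and cG: "\<And>t. t \<in> U \<Longrightarrow> continuous_on (cbox a b) (G t)"
    and cG': "continuous_on (U \<times> cbox a b) (\<lambda>p. G' (fst p) (snd p))"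
  shows "(\<lambda>t. integral (cbox a b) (\<lambda>y. f y * G t y)) holomorphic_on U"
proof (rule leibniz_rule_holomorphic[where fx="\<lambda>t y. f y * G' t y"])
  show "((\<lambda>t. f y * G t y) has_field_derivative f y * G' t y) (at t within U)" if "t \<in> U" "y \<in> cbox a b" for t y
    using has_field_derivative_at_within[OF DERIV_cmult[OF G[OF that]]] .
  show "(\<lambda>y. f y * G t y) integrable_on cbox a b" if "t \<in> U" for t
    by (intro integrable_continuous continuous_on_mult f cG that)
  have "continuous_on (U \<times> cbox a b) (\<lambda>p. f (snd p) * G' (fst p) (snd p))"
    by (intro continuous_on_mult cG' continuous_on_compose2[OF f] continuous_intros) auto
  then show "continuous_on (U \<times> cbox a b) (\<lambda>(t, y). f y * G' t y)"
    by (simp add: split_beta)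
qed (rule U)

lemma integral_lborel_eq_cbox:
  fixes h :: "'a::euclidean_space \<Rightarrow> complex"
  assumes "integrable lborel h" "\<And>y. y \<notin> cbox a b \<Longrightarrow> h y = 0"
  shows "(\<integral>y. h y \<partial>lborel) = integral (cbox a b) h"
proof -
  have "(\<integral>y. h y \<partial>lborel) = integral UNIV h" by (rule integral_lborel[OF assms(1), symmetric])
  also have "integral UNIV h = integral UNIV (\<lambda>y. if y \<in> cbox a b then h y else 0)"
    by (rule arg_cong[where f="integral UNIV"]) (use assms(2) in auto)
  also have "\<dots> = integral (cbox a b) h" by (rule integral_restrict_UNIV)
  finally show ?thesis .
qed

section \<open>Solutions near a point as volume potentials\<close>

lemma local_cutoff:
  fixes x0 :: "'a::euclidean_space"
  assumes d: "d > 0"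
  obtains \<theta> \<theta>' \<theta>'' where "C2_partials UNIV \<theta> \<theta>' \<theta>''"
    "\<And>y b. norm (y - x0) \<le> d \<Longrightarrow> \<theta> y = 1 \<and> \<theta>' b y = 0 \<and> \<theta>'' b y = 0"
    "\<And>y b. norm (y - x0) \<ge> 2 * d \<Longrightarrow> \<theta> y = 0 \<and> \<theta>' b y = 0 \<and> \<theta>'' b y = 0"
proof -
  obtain q q' q'' :: "real \<Rightarrow> real" and A :: real where q:
    "\<And>s. (q has_real_derivative q' s) (at s)" "\<And>s. (q' has_real_derivative q'' s) (at s)"
    "continuous_on UNIV q''"
    "\<And>s. s \<le> 1 \<Longrightarrow> q s = 1 \<and> q' s = 0 \<and> q'' s = 0"
    "\<And>s. s \<ge> 4 \<Longrightarrow> q s = 0 \<and> q' s = 0 \<and> q'' s = 0"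
    "\<And>s. \<bar>q' s\<bar> \<le> A" "\<And>s. \<bar>q'' s\<bar> \<le> A"
    using smooth_step by metis
  define \<eta> \<eta>' \<eta>'' where "\<eta> s = complex_of_real (q (s / d\<^sup>2))" and "\<eta>' s = complex_of_real (q' (s / d\<^sup>2) / d\<^sup>2)"
    and "\<eta>'' s = complex_of_real (q'' (s / d\<^sup>2) / d\<^sup>2 / d\<^sup>2)" for s
  have dq: "((\<lambda>s. F (s / d\<^sup>2)) has_real_derivative F' (s / d\<^sup>2) / d\<^sup>2) (at s)"
    if "\<And>s. (F has_real_derivative F' s) (at s)" for F F' :: "real \<Rightarrow> real" and s
  proof -
    have "((\<lambda>s. s / d\<^sup>2) has_real_derivative 1 / d\<^sup>2) (at s)" by (rule DERIV_cdivide[OF DERIV_ident])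
    from DERIV_chain2[OF that this] show ?thesis by simp
  qed
  have \<eta>1: "(\<eta> has_vector_derivative \<eta>' s) (at s)" for s
    unfolding \<eta>_def [abs_def] \<eta>'_def
    by (intro has_vector_derivative_of_real) (simp add: dq[OF q(1)])
  have \<eta>2: "(\<eta>' has_vector_derivative \<eta>'' s) (at s)" for s
    unfolding \<eta>'_def [abs_def] \<eta>''_def
    by (intro has_vector_derivative_of_real DERIV_cdivide dq[OF q(2)])
  have "continuous_on {0..} (\<lambda>s. q'' (s / d\<^sup>2))"
    by (rule continuous_on_compose2[OF q(3)]) (use d in \<open>auto intro!: continuous_intros\<close>)
  then have \<eta>3: "continuous_on {0..} \<eta>''"
    unfolding \<eta>''_def [abs_def]
    by (intro continuous_on_of_real continuous_on_divide continuous_on_const) (use d in auto)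
  show thesis
  proof (rule that)
    show "C2_partials UNIV (\<lambda>y. \<eta> ((norm (y - x0))\<^sup>2 + 0)) (\<lambda>b y. of_real (2 * ((y - x0) \<bullet> b)) * \<eta>' ((norm (y - x0))\<^sup>2 + 0))
      (\<lambda>b y. 2 * \<eta>' ((norm (y - x0))\<^sup>2 + 0) + of_real (4 * ((y - x0) \<bullet> b)\<^sup>2) * \<eta>'' ((norm (y - x0))\<^sup>2 + 0))"
      by (rule C2_partials_radial[OF \<eta>1 \<eta>2 \<eta>3])
  next
    fix y b assume "norm (y - x0) \<le> d"
    then have "(norm (y - x0))\<^sup>2 / d\<^sup>2 \<le> 1" using d by (simp add: power_mono)
    from q(4)[OF this]
    show "\<eta> ((norm (y - x0))\<^sup>2 + 0) = 1 \<and> of_real (2 * ((y - x0) \<bullet> b)) * \<eta>' ((norm (y - x0))\<^sup>2 + 0) = 0 \<and>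
       2 * \<eta>' ((norm (y - x0))\<^sup>2 + 0) + of_real (4 * ((y - x0) \<bullet> b)\<^sup>2) * \<eta>'' ((norm (y - x0))\<^sup>2 + 0) = 0"
      by (simp add: \<eta>_def \<eta>'_def \<eta>''_def)
  next
    fix y b assume "norm (y - x0) \<ge> 2 * d"
    then have "(2 * d)\<^sup>2 \<le> (norm (y - x0))\<^sup>2" using d by (intro power_mono) auto
    then have "(norm (y - x0))\<^sup>2 / d\<^sup>2 \<ge> 4" using d by (simp add: field_simps)
    from q(5)[OF this]
    show "\<eta> ((norm (y - x0))\<^sup>2 + 0) = 0 \<and> of_real (2 * ((y - x0) \<bullet> b)) * \<eta>' ((norm (y - x0))\<^sup>2 + 0) = 0 \<and>
       2 * \<eta>' ((norm (y - x0))\<^sup>2 + 0) + of_real (4 * ((y - x0) \<bullet> b)\<^sup>2) * \<eta>'' ((norm (y - x0))\<^sup>2 + 0) = 0"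
      by (simp add: \<eta>_def \<eta>'_def \<eta>''_def)
  qed
qed

definition helmholtz_partials ::
    "real \<Rightarrow> (real^3) set \<Rightarrow> (real^3 \<Rightarrow> complex) \<Rightarrow> (real^3 \<Rightarrow> real^3 \<Rightarrow> complex) \<Rightarrow> (real^3 \<Rightarrow> real^3 \<Rightarrow> complex) \<Rightarrow> bool"
  where "helmholtz_partials k U u u' u'' \<longleftrightarrow>
    C2_partials U u u' u'' \<and> (\<forall>y\<in>U. (\<Sum>b\<in>Basis. u'' b y) + of_real (k\<^sup>2) * u y = 0)"

text \<open>Apply the Helmholtz operator to theta u, where the cutoff theta is 1 near
  \<open>x0\<close>. The result vanishes wherever theta is locally constant, so the density sits in
  the shell d <= |y - x0| <= 2 d, and points within d/2 of \<open>x0\<close> keep a distance of at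
  least d/2 from it.\<close>

lemma local_representation:
  assumes u: "helmholtz_partials k (ball x0 r) u u' u''" and r: "r > 0"
  obtains f d where "d > 0" "continuous_on UNIV f" "\<And>y. norm (y - x0) < d \<Longrightarrow> f y = 0"
    "\<And>y. norm (y - x0) > 2 * d \<Longrightarrow> f y = 0"
    "\<And>x. norm (x - x0) < d / 2 \<Longrightarrow> integrable lborel (\<lambda>y. spherical_kernel k ((norm (y - x))\<^sup>2) * f y)"
    "\<And>x. norm (x - x0) < d / 2 \<Longrightarrow>
       - kernel_const * u x = (\<integral>y. spherical_kernel k ((norm (y - x))\<^sup>2) * f y \<partial>lborel)"
proof -
  \<comment> \<open>Then 2 d = r/2 is less than \<open>r\<close>, so the ball and the region where
    the cutoff is 0 overlap and cover the space.\<close>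
  define d where "d = r / 4"
  have d: "d > 0" using r by (simp add: d_def)
  obtain \<theta> \<theta>' \<theta>'' where \<theta>: "C2_partials UNIV \<theta> \<theta>' \<theta>''"
    and \<theta>1: "\<And>y b. norm (y - x0) \<le> d \<Longrightarrow> \<theta> y = 1 \<and> \<theta>' b y = 0 \<and> \<theta>'' b y = 0"
    and \<theta>0: "\<And>y b. norm (y - x0) \<ge> 2 * d \<Longrightarrow> \<theta> y = 0 \<and> \<theta>' b y = 0 \<and> \<theta>'' b y = 0"
    using local_cutoff[OF d] by metis
  have C: "C2_partials (ball x0 r) u u' u''"
    and H: "\<And>y. y \<in> ball x0 r \<Longrightarrow> (\<Sum>b\<in>Basis. u'' b y) + of_real (k\<^sup>2) * u y = 0"
    using u unfolding helmholtz_partials_def by auto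
  have op: "open {y. norm (y - x0) > 2 * d}" by (intro open_Collect_less continuous_intros)
  have cov: "ball x0 r \<union> {y. norm (y - x0) > 2 * d} = UNIV"
    using r by (auto simp: d_def dist_norm norm_minus_commute)
  define h where "h b y = \<theta> y * u'' b y + 2 * \<theta>' b y * u' b y + \<theta>'' b y * u y" for b y
  define f where "f y = (\<Sum>b\<in>Basis. h b y) + of_real (k\<^sup>2) * (\<theta> y * u y)" for y
  have w: "C2_partials UNIV (\<lambda>x. \<theta> x * u x) (\<lambda>b x. \<theta> x * u' b x + \<theta>' b x * u x) h"
    unfolding h_def [abs_def]
    by (rule C2_partials_cutoff[OF open_ball op cov \<theta> C]) (use \<theta>0 in auto)
  have cf: "continuous_on UNIV f"
  proof -
    have "continuous_on UNIV (\<lambda>x. \<theta> x * u x)" "\<And>b. b \<in> Basis \<Longrightarrow> continuous_on UNIV (h b)"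
      using w unfolding C2_partials_def by blast+
    then show ?thesis unfolding f_def [abs_def]
      by (intro continuous_on_add[OF continuous_on_sum continuous_on_mult[OF continuous_on_const]])
  qed
  have f1: "f y = 0" if "norm (y - x0) < d" for y
  proof -
    have "f y = (\<Sum>b\<in>Basis. u'' b y) + of_real (k\<^sup>2) * u y"
      using \<theta>1[of y] that by (simp add: f_def h_def)
    also have "\<dots> = 0" by (rule H) (use that r in \<open>auto simp: d_def dist_norm norm_minus_commute\<close>)
    finally show ?thesis .
  qed
  have f2: "f y = 0" if "norm (y - x0) > 2 * d" for y
    using \<theta>0[of y] that by (simp add: f_def h_def)
  define M where "M = norm x0 + 2 * d"
  have M: "norm (y - x0) > 2 * d" if "norm y > M" for y
    using that norm_triangle_ineq2[of y x0] by (simp add: M_def)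
  have f0: "f y = 0" if "norm (x - x0) < d / 2" "dist y x < d / 2" for x y
  proof (rule f1)
    show "norm (y - x0) < d" using that norm_triangle_ineq[of "y - x" "x - x0"] by (simp add: dist_norm)
  qed
  show thesis
  proof (rule that[OF d cf f1 f2])
    fix x assume x: "norm (x - x0) < d / 2"
    show "integrable lborel (\<lambda>y. spherical_kernel k ((norm (y - x))\<^sup>2) * f y)"
      by (rule integrable_spherical_kernel_mult[OF cf, where M=M and d="d/2"]) (use M f2 f0[OF x] d in auto)
    have "(\<integral>y. spherical_kernel k ((norm (y - x))\<^sup>2) * f y \<partial>lborel) = - kernel_const * (\<theta> x * u x)"
      by (rule representation_compact_support[OF w, where M=M and d="d/2"])
        (use \<theta>0 M f0[OF x] d in \<open>auto simp: f_def less_imp_le\<close>)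
    then show "- kernel_const * u x = (\<integral>y. spherical_kernel k ((norm (y - x))\<^sup>2) * f y \<partial>lborel)"
      using \<theta>1[of x] x d by simp
  qed auto
qed

text \<open>Moving one coordinate by at most h <= 1 changes the real part of its square by at most
  h^2 + 2 h L <= h (1 + 2 L); three coordinates give 3 + 6 L. The bound serves to keep the
  complexified squared distance in the right half-plane.\<close>

lemma Re_complexified_dist_pos:
  fixes x0 y :: "real^3" and z :: "3 \<Rightarrow> complex"
  assumes z: "\<And>i. norm (z i - of_real (x0 $ i)) \<le> h" and L: "\<And>i. \<bar>x0 $ i - y $ i\<bar> \<le> L" and h: "h \<ge> 0" "h \<le> 1"
  shows "Re (\<Sum>i\<in>UNIV. (z i - of_real (y $ i))\<^sup>2) \<ge> (norm (y - x0))\<^sup>2 - h * (3 + 6 * L)"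
proof -
  have 1: "Re ((z i - of_real (y $ i))\<^sup>2) \<ge> (y $ i - x0 $ i)\<^sup>2 - h * (1 + 2 * L)" for i
  proof -
    define D where "D = z i - of_real (x0 $ i)"
    define c where "c = x0 $ i - y $ i"
    have "(z i - of_real (y $ i))\<^sup>2 = D\<^sup>2 + 2 * D * of_real c + of_real (c\<^sup>2)"
      by (simp add: D_def c_def power2_eq_square algebra_simps)
    then have "Re ((z i - of_real (y $ i))\<^sup>2) = Re (D\<^sup>2 + 2 * D * of_real c) + c\<^sup>2" by simp
    moreover have "\<bar>Re (D\<^sup>2 + 2 * D * of_real c)\<bar> \<le> norm (D\<^sup>2 + 2 * D * of_real c)" by (rule abs_Re_le_cmod)
    moreover have "norm (D\<^sup>2 + 2 * D * of_real c) \<le> norm D * norm D + 2 * norm D * \<bar>c\<bar>"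
      using norm_triangle_ineq[of "D\<^sup>2" "2 * D * of_real c"] by (simp add: norm_mult power2_eq_square)
    moreover have "norm D * norm D \<le> h * 1" using z[of i] h by (intro mult_mono) (auto simp: D_def)
    moreover have "2 * norm D * \<bar>c\<bar> \<le> 2 * h * L" using z[of i] L[of i] h by (intro mult_mono) (auto simp: D_def c_def)
    moreover have "c\<^sup>2 = (y $ i - x0 $ i)\<^sup>2" by (simp add: c_def power2_commute)
    ultimately show ?thesis by (simp add: algebra_simps)
  qed
  have "(norm (y - x0))\<^sup>2 = (\<Sum>i\<in>UNIV. (y $ i - x0 $ i)\<^sup>2)"
    by (simp add: norm_vec_def L2_set_def sum_nonneg)
  then have "(norm (y - x0))\<^sup>2 - h * (3 + 6 * L) = (\<Sum>i\<in>UNIV. (y $ i - x0 $ i)\<^sup>2 - h * (1 + 2 * L))"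
    by (simp add: sum_subtractf algebra_simps)
  also have "\<dots> \<le> (\<Sum>i\<in>UNIV. Re ((z i - of_real (y $ i))\<^sup>2))" by (intro sum_mono 1)
  finally show ?thesis by simp
qed

text \<open>Only the squared distance inside the volume potential depends on the curve. Its
  coordinates are replaced by their holomorphic extensions; the density lives at a positive distance
  from \<open>x0\<close>, so for a parameter near \<open>t0\<close> the kernel is still holomorphic
  and one may differentiate under the integral.\<close>

lemma helmholtz_holomorphic_along_curve:
  fixes x0 :: "real^3" and \<gamma> :: "real \<Rightarrow> real^3" and \<Gamma> :: "3 \<Rightarrow> complex \<Rightarrow> complex"
  assumes u: "helmholtz_partials k (ball x0 r) u u' u''" and r: "r > 0"
    and \<rho>: "\<rho> > 0" and \<Gamma>: "\<And>i. \<Gamma> i holomorphic_on ball (of_real t0) \<rho>"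
    and \<gamma>: "\<And>t i. \<bar>t - t0\<bar> < \<rho> \<Longrightarrow> \<Gamma> i (of_real t) = of_real (\<gamma> t $ i)" and x0: "\<gamma> t0 = x0"
  obtains e F where "e > 0" "F holomorphic_on ball (of_real t0) e"
    "\<And>t. \<bar>t - t0\<bar> < e \<Longrightarrow> F (of_real t) = u (\<gamma> t)"
proof (rule local_representation[OF u r])
  fix f d
  assume d: "d > 0" and cf: "continuous_on UNIV f" and f1: "\<And>y. norm (y - x0) < d \<Longrightarrow> f y = 0"
    and f2: "\<And>y. norm (y - x0) > 2 * d \<Longrightarrow> f y = 0"
    and intf: "\<And>x. norm (x - x0) < d / 2 \<Longrightarrow> integrable lborel (\<lambda>y. spherical_kernel k ((norm (y - x))\<^sup>2) * f y)"
    and rep: "\<And>x. norm (x - x0) < d / 2 \<Longrightarrow>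
       - kernel_const * u x = (\<integral>y. spherical_kernel k ((norm (y - x))\<^sup>2) * f y \<partial>lborel)"
  obtain a where a: "cball x0 (2 * d) \<subseteq> cbox (- a) a"
    by (rule bounded_subset_cbox_symmetric[OF bounded_cball])
  obtain L where L: "\<And>y. y \<in> cbox (- a) a \<Longrightarrow> norm (y - x0) \<le> L"
  proof -
    have "bounded ((\<lambda>y. y - x0) ` cbox (- a) a)" by (intro bounded_translation_minus bounded_cbox)
    then obtain L where "\<forall>y\<in>cbox (- a) a. norm (y - x0) \<le> L" unfolding bounded_iff by auto
    then show thesis by (intro that) auto
  qed
  have L0: "L \<ge> 0"
  proof -
    have "x0 \<in> cbox (- a) a" using a d by auto
    from L[OF this] show ?thesis by simp
  qed
  \<comment> \<open>Three requirements: h <= 1 for the perturbation estimate; h <= d/4 so that three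
    coordinates give a displacement of at most sqrt 3 * d/4 < d/2; the last entry makes the loss h
    (3 + 6 L) smaller than d^2.\<close>
  define h where "h = min 1 (min (d / 4) (d\<^sup>2 / (2 * (3 + 6 * L))))"
  have p: "3 + 6 * L > 0" using L0 by linarith
  have h: "h > 0" using d p by (simp add: h_def)
  have h': "h \<le> 1" "h \<le> d / 4" unfolding h_def by linarith+
  have "h \<le> d\<^sup>2 / (2 * (3 + 6 * L))" by (simp add: h_def)
  then have "h * (2 * (3 + 6 * L)) \<le> d\<^sup>2" using p by (subst (asm) pos_le_divide_eq) auto
  then have hd: "h * (3 + 6 * L) < d\<^sup>2" using d zero_less_power[OF d, of 2] by linarith
  have "\<exists>e>0. e \<le> \<rho> \<and> (\<forall>z\<in>ball (of_real t0) e. \<forall>i. norm (\<Gamma> i z - of_real (x0 $ i)) < h)"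
  proof -
    have "\<forall>\<^sub>F z in nhds (of_real t0). \<forall>i. dist (\<Gamma> i z) (\<Gamma> i (of_real t0)) < h"
    proof (rule eventually_all_finite)
      fix i
      have "isCont (\<Gamma> i) (of_real t0)"
        using holomorphic_on_imp_continuous_on[OF \<Gamma>[of i]] \<rho> by (simp add: continuous_on_eq_continuous_at)
      then show "\<forall>\<^sub>F z in nhds (of_real t0). dist (\<Gamma> i z) (\<Gamma> i (of_real t0)) < h"
        using h unfolding continuous_at_eps_delta eventually_nhds_metric by blast
    qed
    then obtain e where "e > 0" "\<And>z. dist z (of_real t0) < e \<Longrightarrow> \<forall>i. dist (\<Gamma> i z) (\<Gamma> i (of_real t0)) < h"
      unfolding eventually_nhds_metric by blast
    then show ?thesis using \<rho> \<gamma>[of t0] x0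
      by (intro exI[of _ "min e \<rho>"]) (auto simp: dist_norm norm_minus_commute)
  qed
  then obtain e where e: "e > 0" "e \<le> \<rho>" and close: "\<And>z i. z \<in> ball (of_real t0) e \<Longrightarrow> norm (\<Gamma> i z - of_real (x0 $ i)) < h"
    by blast
  define U where "U = ball (complex_of_real t0) e"
  have \<Gamma>U: "\<Gamma> i holomorphic_on U" for i
    unfolding U_def by (rule holomorphic_on_subset[OF \<Gamma> subset_ball[OF e(2)]])
  have c\<Gamma>: "continuous_on U (\<Gamma> i)" "continuous_on U (deriv (\<Gamma> i))" for i
    using \<Gamma>U[of i] by (auto simp: U_def intro!: holomorphic_on_imp_continuous_on holomorphic_deriv)
  \<comment> \<open>\<open>m\<close> vanishes where \<open>f\<close> does not; it keeps \<open>Re Q\<close> positive on the whole box.\<close>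
  define m where "m y = max 0 (d\<^sup>2 - (norm (y - x0))\<^sup>2)" for y
  define Q where "Q z y = (\<Sum>i\<in>UNIV. (\<Gamma> i z - of_real (y $ i))\<^sup>2) + of_real (m y)" for z y
  define Q' where "Q' z y = (\<Sum>i\<in>UNIV. 2 * (\<Gamma> i z - of_real (y $ i)) * deriv (\<Gamma> i) z)" for z y
  have ReQ: "Re (Q z y) > 0" if "z \<in> U" "y \<in> cbox (- a) a" for z y
  proof -
    have "Re (\<Sum>i\<in>UNIV. (\<Gamma> i z - of_real (y $ i))\<^sup>2) \<ge> (norm (y - x0))\<^sup>2 - h * (3 + 6 * L)"
    proof (rule Re_complexified_dist_pos)
      show "norm (\<Gamma> i z - of_real (x0 $ i)) \<le> h" for i using close that(1) unfolding U_def by (simp add: less_imp_le)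
      show "\<bar>x0 $ i - y $ i\<bar> \<le> L" for i
        using component_le_norm_cart[of "y - x0" i] L[OF that(2)] by (simp add: abs_minus_commute)
    qed (use h h' in auto)
    moreover have "(norm (y - x0))\<^sup>2 + m y \<ge> d\<^sup>2" by (simp add: m_def)
    ultimately show ?thesis using hd by (simp add: Q_def)
  qed
  define E where "E q = exp (\<i> * k * csqrt q) / csqrt q" for q
  have hE: "E holomorphic_on {q. Re q > 0}"
    unfolding E_def [abs_def]
    by (intro holomorphic_intros) (auto simp: complex_nonpos_Reals_iff)
  have oR: "open {q::complex. Re q > 0}" by (simp add: open_halfspace_Re_gt)
  have cE: "continuous_on {q. Re q > 0} E" "continuous_on {q. Re q > 0} (deriv E)"
    using hE oR by (auto intro!: holomorphic_on_imp_continuous_on holomorphic_deriv)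
  have cQ: "continuous_on (U \<times> cbox (- a) a) (\<lambda>p. Q (fst p) (snd p))"
    unfolding Q_def m_def
    by (intro continuous_intros continuous_on_compose2[OF c\<Gamma>(1)]) auto
  have cQ': "continuous_on (U \<times> cbox (- a) a) (\<lambda>p. Q' (fst p) (snd p))"
    unfolding Q'_def
    by (intro continuous_intros continuous_on_compose2[OF c\<Gamma>(1)] continuous_on_compose2[OF c\<Gamma>(2)]) auto
  have hol: "(\<lambda>z. integral (cbox (- a) a) (\<lambda>y. f y * E (Q z y))) holomorphic_on U"
  proof (rule holomorphic_on_integral_cbox[where G'="\<lambda>z y. deriv E (Q z y) * Q' z y"])
    show "continuous_on (cbox (- a) a) f" using cf continuous_on_subset by blast
    show "convex U" by (simp add: U_def)
  next
    fix z y assume zy: "z \<in> U" "y \<in> cbox (- a) a"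
    have "(\<Gamma> i has_field_derivative deriv (\<Gamma> i) z) (at z)" for i
      using \<Gamma>U[of i] zy(1) holomorphic_derivI[of "\<Gamma> i" U z] by (auto simp: U_def)
    then have "((\<lambda>z. Q z y) has_field_derivative Q' z y) (at z)"
      unfolding Q_def Q'_def by (auto intro!: derivative_eq_intros sum.cong)
    moreover have "(E has_field_derivative deriv E (Q z y)) (at (Q z y))"
      using holomorphic_derivI[OF hE oR] ReQ[OF zy] by simp
    ultimately show "((\<lambda>z. E (Q z y)) has_field_derivative deriv E (Q z y) * Q' z y) (at z)"
      by (rule DERIV_chain2[rotated])
  next
    fix z assume z: "z \<in> U"
    have "continuous_on (cbox (- a) a) (\<lambda>y. (\<lambda>p. Q (fst p) (snd p)) (z, y))"
      by (rule continuous_on_compose2[OF cQ]) (use z in \<open>auto intro!: continuous_intros\<close>)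
    then have "continuous_on (cbox (- a) a) (\<lambda>y. Q z y)" by simp
    then show "continuous_on (cbox (- a) a) (\<lambda>y. E (Q z y))"
      by (rule continuous_on_compose2[OF cE(1)]) (use ReQ[OF z] in auto)
  next
    show "continuous_on (U \<times> cbox (- a) a) (\<lambda>p. deriv E (Q (fst p) (snd p)) * Q' (fst p) (snd p))"
      by (intro continuous_on_mult cQ' continuous_on_compose2[OF cE(2) cQ]) (use ReQ in auto)
  qed
  define F where "F z = - integral (cbox (- a) a) (\<lambda>y. f y * E (Q z y)) / kernel_const" for z
  have "F holomorphic_on ball (of_real t0) e"
    unfolding F_def [abs_def] using hol unfolding U_def
    by (intro holomorphic_intros) (simp_all add: kernel_const_nonzero)
  moreover have "F (of_real t) = u (\<gamma> t)" if t: "\<bar>t - t0\<bar> < e" for t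
  proof -
    have tU: "complex_of_real t \<in> ball (of_real t0) e"
      using t by (simp add: dist_norm norm_minus_commute flip: of_real_diff)
    have \<Gamma>t: "\<Gamma> i (of_real t) = of_real (\<gamma> t $ i)" for i using \<gamma> t e(2) by simp
    have comp: "\<bar>(\<gamma> t - x0) $ i\<bar> \<le> d / 4" for i
      using close[OF tU, of i] h'(2) unfolding \<Gamma>t of_real_diff [symmetric] norm_of_real by simp
    have "norm (\<gamma> t - x0) \<le> sqrt (\<Sum>i\<in>(UNIV::3 set). (d / 4)\<^sup>2)"
      unfolding norm_vec_def L2_set_def real_norm_def
      by (intro real_sqrt_le_mono sum_mono) (use comp in \<open>auto intro!: power2_le_iff_abs_le[THEN iffD2] simp: power2_le_iff_abs_le d less_imp_le\<close>)
    also have "\<dots> < d / 2"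
      by (rule real_less_lsqrt) (use d in \<open>auto simp: power2_eq_square\<close>)
    finally have near: "norm (\<gamma> t - x0) < d / 2" .
    have eq: "spherical_kernel k ((norm (y - \<gamma> t))\<^sup>2) * f y = f y * E (Q (of_real t) y)" for y
    proof (cases "norm (y - x0) < d")
      case True
      then show ?thesis by (simp add: f1)
    next
      case False
      then have "d\<^sup>2 \<le> (norm (y - x0))\<^sup>2" using d by (intro power_mono) auto
      then have "m y = 0" by (simp add: m_def)
      have "(norm (y - \<gamma> t))\<^sup>2 = (\<Sum>i\<in>UNIV. (y $ i - \<gamma> t $ i)\<^sup>2)"
        by (simp add: norm_vec_def L2_set_def sum_nonneg)
      also have "\<dots> = (\<Sum>i\<in>UNIV. (\<gamma> t $ i - y $ i)\<^sup>2)" by (simp add: power2_commute)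
      finally have "Q (of_real t) y = of_real ((norm (y - \<gamma> t))\<^sup>2)"
        by (simp add: Q_def \<Gamma>t \<open>m y = 0\<close> flip: of_real_diff of_real_power)
      then show ?thesis by (simp add: E_def helmholtz_kernel_csqrt)
    qed
    have out: "f y = 0" if "y \<notin> cbox (- a) a" for y
    proof (rule f2)
      have "y \<notin> cball x0 (2 * d)" using that a by blast
      then show "norm (y - x0) > 2 * d" by (simp add: dist_norm norm_minus_commute)
    qed
    have "- kernel_const * u (\<gamma> t) = integral (cbox (- a) a) (\<lambda>y. f y * E (Q (of_real t) y))"
      unfolding rep[OF near] eq
      by (rule integral_lborel_eq_cbox) (use intf[OF near] out in \<open>auto simp: eq\<close>)
    then show ?thesis unfolding F_def using kernel_const_nonzero by (metis minus_mult_left minus_minus nonzero_mult_div_cancel_left)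
  qed
  ultimately show thesis using that e(1) by blast
qed

text \<open>The local extensions around different parameters are not assumed to agree, so vanishing
  is propagated along the interval: the parameters near which \<open>f\<close> is identically 0 form
  a relatively open and closed set.\<close>

lemma identity_theorem_unit_interval:
  fixes f :: "real \<Rightarrow> complex"
  assumes loc: "\<And>t. t \<in> {0..1} \<Longrightarrow> \<exists>e>0. \<exists>F. F holomorphic_on ball (of_real t) e \<and> (\<forall>s. \<bar>s - t\<bar> < e \<longrightarrow> F (of_real s) = f s)"
    and h: "h > 0" and zero: "\<And>s. \<bar>s\<bar> < h \<Longrightarrow> f s = 0"
  shows "f 1 = 0"
proof -
  define T where "T = {t \<in> {0..1}. \<exists>h>0. \<forall>s. \<bar>s - t\<bar> < h \<longrightarrow> f s = 0}"
  \<comment> \<open>A single point of \<open>T\<close> in the disc of an extension forces that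
    extension to vanish on the whole disc. This makes the complement of \<open>T\<close> relatively
    open.\<close>
  have key: "\<exists>e>0. \<forall>t'\<in>T. \<bar>t' - t\<bar> < e \<longrightarrow> (\<forall>s. \<bar>s - t\<bar> < e \<longrightarrow> f s = 0)" if t: "t \<in> {0..1}" for t
  proof -
    obtain e F where e: "e > 0" "F holomorphic_on ball (of_real t) e" and F: "\<And>s. \<bar>s - t\<bar> < e \<Longrightarrow> F (of_real s) = f s"
      using loc[OF t] by blast
    have "f s = 0" if t': "t' \<in> T" "\<bar>t' - t\<bar> < e" and s: "\<bar>s - t\<bar> < e" for t' s
    proof -
      obtain h where h: "h > 0" "\<And>s. \<bar>s - t'\<bar> < h \<Longrightarrow> f s = 0" using t'(1) unfolding T_def by blast
      have inb: "complex_of_real r \<in> ball (of_real t) e \<longleftrightarrow> \<bar>r - t\<bar> < e" for r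
        by (simp add: dist_norm abs_minus_commute flip: of_real_diff)
      have "F (of_real s) = 0"
      proof (rule analytic_continuation[OF e(2), where U="complex_of_real ` {r. \<bar>r - t'\<bar> < min h (e - \<bar>t' - t\<bar>)}" and \<xi>="of_real t'"])
        show "complex_of_real ` {r. \<bar>r - t'\<bar> < min h (e - \<bar>t' - t\<bar>)} \<subseteq> ball (of_real t) e"
          unfolding image_subset_iff inb by auto
        show "complex_of_real t' \<in> ball (of_real t) e" using t'(2) inb by blast
        show "complex_of_real s \<in> ball (of_real t) e" using s inb by blast
        show "F z = 0" if "z \<in> complex_of_real ` {r. \<bar>r - t'\<bar> < min h (e - \<bar>t' - t\<bar>)}" for z
        proof -
          obtain r where r: "z = of_real r" "\<bar>r - t'\<bar> < h" "\<bar>r - t'\<bar> < e - \<bar>t' - t\<bar>" using \<open>z \<in> _\<close> by auto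
          have "\<bar>r - t\<bar> < e" using r(3) by linarith
          then show ?thesis using F h(2) r by simp
        qed
        show "complex_of_real t' islimpt complex_of_real ` {r. \<bar>r - t'\<bar> < min h (e - \<bar>t' - t\<bar>)}"
          unfolding islimpt_approachable
        proof (intro allI impI)
          fix c :: real assume c: "c > 0"
          define M where "M = min c (min h (e - \<bar>t' - t\<bar>))"
          have "M > 0" "M \<le> c" "M \<le> min h (e - \<bar>t' - t\<bar>)" using c h(1) t'(2) by (auto simp: M_def)
          moreover define g where "g = M / 2"
          ultimately have g: "g > 0" "g < c" "g < min h (e - \<bar>t' - t\<bar>)" by linarith+
          then have mem: "complex_of_real (t' + g) \<in> complex_of_real ` {r. \<bar>r - t'\<bar> < min h (e - \<bar>t' - t\<bar>)}"
            by (intro imageI) simp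
          show "\<exists>x'\<in>complex_of_real ` {r. \<bar>r - t'\<bar> < min h (e - \<bar>t' - t\<bar>)}. x' \<noteq> of_real t' \<and> dist x' (of_real t') < c"
            using g by (intro bexI[OF _ mem]) (auto simp: dist_norm)
        qed
      qed auto
      then show ?thesis using F[OF s] by simp
    qed
    with e(1) show ?thesis by blast
  qed
  have "openin (top_of_set {0..1}) T"
    unfolding openin_euclidean_subtopology_iff
  proof (intro conjI ballI)
    show "T \<subseteq> {0..1}" by (auto simp: T_def)
    fix t assume "t \<in> T"
    then obtain h where h: "h > 0" "\<And>s. \<bar>s - t\<bar> < h \<Longrightarrow> f s = 0" unfolding T_def by blast
    show "\<exists>e>0. \<forall>t'\<in>{0..1}. dist t' t < e \<longrightarrow> t' \<in> T"
    proof (intro exI[of _ "h / 2"] conjI ballI impI)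
      fix t' :: real assume t': "t' \<in> {0..1}" "dist t' t < h / 2"
      have "f s = 0" if "\<bar>s - t'\<bar> < h / 2" for s
        by (rule h(2)) (use that t'(2) in \<open>simp add: dist_real_def abs_if split: if_splits\<close>)
      then show "t' \<in> T" unfolding T_def using t'(1) h(1) half_gt_zero by blast
    qed (use h(1) in simp)
  qed
  moreover have "closedin (top_of_set {0..1}) T"
  proof -
    have "openin (top_of_set {0..1}) ({0..1} - T)"
      unfolding openin_euclidean_subtopology_iff
    proof (intro conjI ballI)
      fix t assume t: "t \<in> {0..1} - T"
      then obtain e where e: "e > 0" "\<And>t' s. t' \<in> T \<Longrightarrow> \<bar>t' - t\<bar> < e \<Longrightarrow> \<bar>s - t\<bar> < e \<Longrightarrow> f s = 0"
        using key[of t] by blast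
      show "\<exists>e>0. \<forall>t'\<in>{0..1}. dist t' t < e \<longrightarrow> t' \<in> {0..1} - T"
      proof (intro exI[of _ e] conjI ballI impI e(1))
        fix t' :: real assume t': "t' \<in> {0..1}" "dist t' t < e"
        have "t' \<notin> T"
        proof
          assume "t' \<in> T"
          then have "\<forall>s. \<bar>s - t\<bar> < e \<longrightarrow> f s = 0" using e(2) t'(2) by (auto simp: dist_real_def)
          then have "t \<in> T" unfolding T_def using t e(1) by blast
          then show False using t by blast
        qed
        then show "t' \<in> {0..1} - T" using t' by blast
      qed
    qed auto
    then show ?thesis unfolding closedin_def by (auto simp: T_def)
  qed
  moreover have "0 \<in> T" unfolding T_def using h zero by auto
  ultimately have "T = {0..1}"
    using connected_Icc[of 0 "1::real"] unfolding connected_clopen by blast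
  then have "1 \<in> T" by simp
  then obtain h where "h > 0" "\<And>s. \<bar>s - 1\<bar> < h \<Longrightarrow> f s = 0" unfolding T_def by blast
  then show ?thesis by simp
qed

section \<open>Unique continuation\<close>

text \<open>Because \<open>has_sum\<close> is unconditional, the double series restricted to a line
  can be regrouped by total degree into a single power series in the line parameter, and a real
  power series converges on the complex disc of the same radius.\<close>

lemma real_analytic_on_line_holomorphic:
  fixes \<sigma> :: "real^2 \<Rightarrow> real^3"
  assumes \<sigma>: "real_analytic_on W \<sigma>" and p: "p \<in> W"
  obtains \<rho> \<Gamma> where "\<rho> > 0" "\<And>i. \<Gamma> i holomorphic_on ball (of_real t0) \<rho>"
    "\<And>t i. \<bar>t - t0\<bar> < \<rho> \<Longrightarrow> \<Gamma> i (of_real t) = of_real (\<sigma> (p + (t - t0) *\<^sub>R \<xi>) $ i)"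
proof -
  obtain r and a :: "nat \<times> nat \<Rightarrow> real^3" where r: "r > 0" and
    ser: "\<And>w. w \<in> ball p r \<Longrightarrow>
      ((\<lambda>(m, n). ((w$1 - p$1) ^ m * (w$2 - p$2) ^ n) *\<^sub>R a (m, n)) has_sum \<sigma> w) UNIV"
    using \<sigma> p unfolding real_analytic_on_def by blast
  \<comment> \<open>The added 1 covers the direction \<open>\<xi> = 0\<close>.\<close>
  define \<rho> where "\<rho> = r / (norm \<xi> + 1)"
  have \<rho>: "\<rho> > 0" using r by (simp add: \<rho>_def add_nonneg_pos)
  define c where "c i k = (\<Sum>m\<le>k. \<xi>$1 ^ m * \<xi>$2 ^ (k - m) * (a (m, k - m) $ i))" for i k
  have sums_real: "(\<lambda>k. c i k * s ^ k) sums (\<sigma> (p + s *\<^sub>R \<xi>) $ i)" if s: "\<bar>s\<bar> < \<rho>" for s i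
  proof -
    have "\<bar>s\<bar> * norm \<xi> \<le> \<bar>s\<bar> * (norm \<xi> + 1)" by (intro mult_left_mono) auto
    also have "\<dots> < r" using s by (simp add: \<rho>_def pos_less_divide_eq add_nonneg_pos)
    finally have "p + s *\<^sub>R \<xi> \<in> ball p r" by (simp add: dist_norm)
    from has_sum_bounded_linear[OF bounded_linear_vec_nth ser[OF this], of i]
    have "((\<lambda>(m, n). (s * \<xi>$1) ^ m * (s * \<xi>$2) ^ n * (a (m, n) $ i)) has_sum (\<sigma> (p + s *\<^sub>R \<xi>) $ i)) UNIV"
      by (simp add: o_def case_prod_unfold)
    \<comment> \<open>Reindexing by the total degree \<open>k = m + n\<close>.\<close>
    moreover have "bij_betw (\<lambda>(k, m). (m, k - m)) (Sigma UNIV (\<lambda>k. {..k})) (UNIV :: (nat \<times> nat) set)"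
      by (rule bij_betwI[where g="\<lambda>(m, n). (m + n, m)"]) auto
    ultimately have "((\<lambda>(k, m). (s * \<xi>$1) ^ m * (s * \<xi>$2) ^ (k - m) * (a (m, k - m) $ i)) has_sum (\<sigma> (p + s *\<^sub>R \<xi>) $ i))
        (Sigma UNIV (\<lambda>k. {..k}))"
      by (subst (asm) has_sum_reindex_bij_betw[symmetric]) (auto simp: case_prod_unfold)
    then have "((\<lambda>k. \<Sum>m\<le>k. (s * \<xi>$1) ^ m * (s * \<xi>$2) ^ (k - m) * (a (m, k - m) $ i)) has_sum (\<sigma> (p + s *\<^sub>R \<xi>) $ i)) UNIV"
      by (rule has_sum_SigmaD[where g="\<lambda>k. \<Sum>m\<le>k. (s * \<xi>$1) ^ m * (s * \<xi>$2) ^ (k - m) * (a (m, k - m) $ i)"])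
        (auto intro: has_sum_finite)
    moreover have "(\<Sum>m\<le>k. (s * \<xi>$1) ^ m * (s * \<xi>$2) ^ (k - m) * (a (m, k - m) $ i)) = c i k * s ^ k" for k
      unfolding c_def sum_distrib_right
    proof (rule sum.cong[OF refl])
      fix m assume "m \<in> {..k}"
      then have "s ^ k = s ^ m * s ^ (k - m)" by (simp flip: power_add)
      then show "(s * \<xi>$1) ^ m * (s * \<xi>$2) ^ (k - m) * (a (m, k - m) $ i) = \<xi>$1 ^ m * \<xi>$2 ^ (k - m) * (a (m, k - m) $ i) * s ^ k"
        by (simp add: power_mult_distrib)
    qed
    ultimately show ?thesis by (simp add: has_sum_imp_sums)
  qed
  define \<Gamma> where "\<Gamma> i z = (\<Sum>k. of_real (c i k) * (z - of_real t0) ^ k)" for i and z :: complex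
  have summ: "summable (\<lambda>k. complex_of_real (c i k) * z ^ k)" if z: "norm z < \<rho>" for i z
  proof -
    \<comment> \<open>Convergence is known at real parameters only; a real \<open>s\<close> of
      larger modulus carries it to the complex \<open>z\<close>.\<close>
    obtain s where s: "norm z < s" "s < \<rho>" using dense[OF z] by blast
    have "s > 0" using s(1) norm_ge_zero[of z] by linarith
    then have s0: "\<bar>s\<bar> < \<rho>" "norm z < norm (complex_of_real s)" using s by simp_all
    have "summable (\<lambda>k. complex_of_real (c i k * s ^ k))"
      using sums_summable[OF sums_real[OF s0(1)]] by (rule summable_of_real)
    then have "summable (\<lambda>k. complex_of_real (c i k) * (complex_of_real s) ^ k)" by simp
    from powser_inside[OF this s0(2)] show ?thesis .
  qed
  show thesis
  proof (rule that[OF \<rho>])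
    show "\<Gamma> i holomorphic_on ball (of_real t0) \<rho>" for i
    proof (rule power_series_holomorphic)
      fix w assume "w \<in> ball (complex_of_real t0) \<rho>"
      then have "norm (w - of_real t0) < \<rho>" by (simp add: dist_norm norm_minus_commute)
      from summable_sums[OF summ[OF this]]
      show "(\<lambda>k. complex_of_real (c i k) * (w - of_real t0) ^ k) sums \<Gamma> i w" unfolding \<Gamma>_def .
    qed
    fix t i assume t: "\<bar>t - t0\<bar> < \<rho>"
    have "(\<lambda>k. complex_of_real (c i k * (t - t0) ^ k)) sums of_real (\<sigma> (p + (t - t0) *\<^sub>R \<xi>) $ i)"
      by (rule sums_of_real[OF sums_real[OF t]])
    then show "\<Gamma> i (of_real t) = of_real (\<sigma> (p + (t - t0) *\<^sub>R \<xi>) $ i)"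
      unfolding \<Gamma>_def by (simp add: sums_iff)
  qed
qed

section \<open>Propagation of zeros in open sets and on analytic surfaces\<close>

lemma helmholtz_partials_subset:
  "helmholtz_partials k U u u' u'' \<Longrightarrow> V \<subseteq> U \<Longrightarrow> helmholtz_partials k V u u' u''"
  unfolding helmholtz_partials_def using C2_partials_subset by blast

text \<open>Call a point good if \<open>u\<close> vanishes on a relative neighbourhood of it. The
  good points are relatively open; by \<open>step\<close> a point that is not good has a
  neighbourhood free of good points, so they are relatively closed as well. Stated for an arbitrary
  connected set in order to serve both open regions and surfaces.\<close>

lemma connected_induction_zero:
  fixes u :: "'a::metric_space \<Rightarrow> complex"
  assumes Y: "connected Y" and D: "openin (top_of_set Y) D" "D \<noteq> {}" "\<And>x. x \<in> D \<Longrightarrow> u x = 0"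
    and step: "\<And>p. p \<in> Y \<Longrightarrow> \<exists>N. openin (top_of_set Y) N \<and> p \<in> N \<and>
      (\<forall>q\<in>N. \<forall>M. openin (top_of_set Y) M \<and> q \<in> M \<and> (\<forall>x\<in>M. u x = 0) \<longrightarrow>
         (\<exists>M'. openin (top_of_set Y) M' \<and> p \<in> M' \<and> (\<forall>x\<in>M'. u x = 0)))"
    and x: "x \<in> Y"
  shows "u x = 0"
proof -
  define T where "T = \<Union>{M. openin (top_of_set Y) M \<and> (\<forall>x\<in>M. u x = 0)}"
  have opT: "openin (top_of_set Y) T" unfolding T_def by (rule openin_Union) auto
  have TY: "T \<subseteq> Y" using openin_imp_subset[OF opT] .
  have "openin (top_of_set Y) (Y - T)"
  proof (subst openin_subopen, intro ballI)
    fix p assume p: "p \<in> Y - T"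
    from step[OF DiffD1[OF p]] obtain N where N: "openin (top_of_set Y) N" "p \<in> N"
      and st: "\<forall>q\<in>N. \<forall>M. openin (top_of_set Y) M \<and> q \<in> M \<and> (\<forall>x\<in>M. u x = 0) \<longrightarrow>
         (\<exists>M'. openin (top_of_set Y) M' \<and> p \<in> M' \<and> (\<forall>x\<in>M'. u x = 0))"
      by (elim exE conjE) (rule that)
    have "N \<inter> T = {}"
    proof (rule ccontr)
      assume "N \<inter> T \<noteq> {}"
      then obtain q M where "q \<in> N" "openin (top_of_set Y) M \<and> q \<in> M \<and> (\<forall>x\<in>M. u x = 0)"
        unfolding T_def by blast
      from st[rule_format, OF this] have "p \<in> T" unfolding T_def by blast
      then show False using p by blast
    qed
    then show "\<exists>N. openin (top_of_set Y) N \<and> p \<in> N \<and> N \<subseteq> Y - T"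
      using N(1,2) openin_imp_subset[OF N(1)] by blast
  qed
  then have "closedin (top_of_set Y) T" unfolding closedin_def using TY by simp
  moreover have "T \<noteq> {}" using D unfolding T_def by blast
  ultimately have "T = Y" using spec[OF Y[unfolded connected_clopen], of T] opT by simp
  then show ?thesis using x unfolding T_def by blast
qed

lemma helmholtz_zero_along_curve:
  fixes \<gamma> :: "real \<Rightarrow> real^3"
  assumes u: "helmholtz_partials k U u u' u''" and U: "open U"
    and \<gamma>: "\<And>t. t \<in> {0..1} \<Longrightarrow> \<gamma> t \<in> U \<and> (\<exists>\<rho>>0. \<exists>\<Gamma>. (\<forall>i. \<Gamma> i holomorphic_on ball (of_real t) \<rho>) \<and>
        (\<forall>s i. \<bar>s - t\<bar> < \<rho> \<longrightarrow> \<Gamma> i (of_real s) = of_real (\<gamma> s $ i)))"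
    and h: "h > 0" "\<And>s. \<bar>s\<bar> < h \<Longrightarrow> u (\<gamma> s) = 0"
  shows "u (\<gamma> 1) = 0"
proof (rule identity_theorem_unit_interval[where f="\<lambda>t. u (\<gamma> t)", OF _ h])
  fix t :: real assume t: "t \<in> {0..1}"
  from conjunct2[OF \<gamma>[OF t]] obtain \<rho> \<Gamma> where \<rho>: "\<rho> > 0"
    and \<Gamma>: "\<forall>i. \<Gamma> i holomorphic_on ball (of_real t) \<rho>"
      "\<forall>s i. \<bar>s - t\<bar> < \<rho> \<longrightarrow> \<Gamma> i (of_real s) = of_real (\<gamma> s $ i)"
    by (elim exE conjE) (rule that, assumption+)
  obtain r where r: "r > 0" "ball (\<gamma> t) r \<subseteq> U"
    using U conjunct1[OF \<gamma>[OF t]] unfolding open_contains_ball by blast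
  show "\<exists>e>0. \<exists>F. F holomorphic_on ball (of_real t) e \<and> (\<forall>s. \<bar>s - t\<bar> < e \<longrightarrow> F (of_real s) = u (\<gamma> s))"
  proof (rule helmholtz_holomorphic_along_curve[OF helmholtz_partials_subset[OF u r(2)] r(1) \<rho> \<Gamma>[rule_format] refl])
    fix e F assume "e > 0" "F holomorphic_on ball (complex_of_real t) e"
      "\<And>s. \<bar>s - t\<bar> < e \<Longrightarrow> F (complex_of_real s) = u (\<gamma> s)"
    then show ?thesis by (intro exI[of _ e] exI[of _ F] conjI allI impI)
  qed
qed

text \<open>Segments starting at a good point \<open>q\<close> reach every point of a ball around
  \<open>q\<close>. The solution vanishes on an initial piece of each segment, hence at its
  end.\<close>

lemma helmholtz_unique_continuation:
  assumes u: "helmholtz_partials k U u u' u''" and U: "open U" "connected U"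
    and D: "open D" "D \<noteq> {}" "D \<subseteq> U" "\<And>x. x \<in> D \<Longrightarrow> u x = 0" and x: "x \<in> U"
  shows "u x = 0"
proof (rule connected_induction_zero[OF U(2) _ D(2,4) _ x])
  show "openin (top_of_set U) D" using D by (simp add: openin_open_eq U)
  fix p assume p: "p \<in> U"
  obtain R where R: "R > 0" "ball p R \<subseteq> U" using U(1) p open_contains_ball by blast
  show "\<exists>N. openin (top_of_set U) N \<and> p \<in> N \<and>
      (\<forall>q\<in>N. \<forall>M. openin (top_of_set U) M \<and> q \<in> M \<and> (\<forall>x\<in>M. u x = 0) \<longrightarrow>
         (\<exists>M'. openin (top_of_set U) M' \<and> p \<in> M' \<and> (\<forall>x\<in>M'. u x = 0)))"
  \<comment> \<open>Half the radius, so that for every \<open>q\<close> in this ball the ball of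
    radius \<open>R / 2\<close> about \<open>q\<close> lies in \<open>U\<close> and contains
    \<open>p\<close>.\<close>
  proof (rule exI[of _ "ball p (R / 2)"], intro conjI ballI allI impI)
    have sub: "ball p (R / 2) \<subseteq> U" using R subset_ball[of "R / 2" R p] by auto
    then show "openin (top_of_set U) (ball p (R / 2))" by (simp add: openin_open_eq U)
    show "p \<in> ball p (R / 2)" using R by simp
    fix q M assume q: "q \<in> ball p (R / 2)" and M: "openin (top_of_set U) M \<and> q \<in> M \<and> (\<forall>x\<in>M. u x = 0)"
    have "open M" using M U(1) openin_open_eq by blast
    then obtain c where c: "c > 0" "ball q c \<subseteq> M" using M open_contains_ball by blast
    have qR: "ball q (R / 2) \<subseteq> U"
    proof
      fix y assume "y \<in> ball q (R / 2)"
      then have "dist p y < R" using q dist_triangle[of p y q] by simp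
      then show "y \<in> U" using R(2) by auto
    qed
    have z: "u v = 0" if v: "v \<in> ball q (R / 2)" for v
    proof -
      define \<gamma> where "\<gamma> t = q + t *\<^sub>R (v - q)" for t
      have "u (\<gamma> 1) = 0"
      proof (rule helmholtz_zero_along_curve[where \<gamma>=\<gamma>, OF u U(1)])
        \<comment> \<open>For parameters below this value the segment stays in
          \<open>ball q c\<close>, where \<open>u\<close> is 0; the added 1 covers
          \<open>v = q\<close>.\<close>
        show "c / (norm (v - q) + 1) > 0" using c(1) by (simp add: add_nonneg_pos)
        show "u (\<gamma> s) = 0" if s: "\<bar>s\<bar> < c / (norm (v - q) + 1)" for s
        proof -
          have "\<bar>s\<bar> * norm (v - q) \<le> \<bar>s\<bar> * (norm (v - q) + 1)" by (intro mult_left_mono) auto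
          also have "\<dots> < c" using s by (simp add: pos_less_divide_eq add_nonneg_pos)
          finally have "\<gamma> s \<in> ball q c" by (simp add: \<gamma>_def dist_norm)
          then show ?thesis using c(2) M by blast
        qed
        fix t :: real assume t: "t \<in> {0..1}"
        have "norm (t *\<^sub>R (v - q)) \<le> norm (v - q)" using t by (simp add: mult_left_le_one_le)
        then have "\<gamma> t \<in> U" using v qR by (auto simp: \<gamma>_def dist_norm norm_minus_commute subset_iff)
        moreover have "\<exists>\<rho>>0. \<exists>\<Gamma>. (\<forall>i. \<Gamma> i holomorphic_on ball (of_real t) \<rho>) \<and>
           (\<forall>s i. \<bar>s - t\<bar> < \<rho> \<longrightarrow> \<Gamma> i (of_real s) = of_real (\<gamma> s $ i))"
          by (rule exI[of _ 1], intro conjI exI[of _ "\<lambda>i z. of_real (q $ i) + z * of_real ((v - q) $ i)"])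
            (auto intro!: holomorphic_intros simp: \<gamma>_def)
        ultimately show "\<gamma> t \<in> U \<and> (\<exists>\<rho>>0. \<exists>\<Gamma>. (\<forall>i. \<Gamma> i holomorphic_on ball (of_real t) \<rho>) \<and>
           (\<forall>s i. \<bar>s - t\<bar> < \<rho> \<longrightarrow> \<Gamma> i (of_real s) = of_real (\<gamma> s $ i)))" ..
      qed
      then show ?thesis by (simp add: \<gamma>_def)
    qed
    show "\<exists>M'. openin (top_of_set U) M' \<and> p \<in> M' \<and> (\<forall>x\<in>M'. u x = 0)"
      by (rule exI[of _ "ball q (R / 2)"]) (use qR q z in \<open>auto simp: openin_open_eq U dist_commute\<close>)
  qed
qed simp

text \<open>Segments in the parameter domain of an analytic chart are carried to analytic curves on
  the surface. Zeros therefore spread within \<open>Y\<close> as they do in an open set, although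
  \<open>u\<close> may be nonzero off \<open>Y\<close>.\<close>

lemma helmholtz_zero_on_analytic_surface:
  assumes u: "helmholtz_partials k U u u' u''" and U: "open U"
    and Y: "real_analytic_surface Y" "connected Y" "Y \<subseteq> U"
    and D: "openin (top_of_set Y) D" "D \<noteq> {}" "\<And>x. x \<in> D \<Longrightarrow> u x = 0" and x: "x \<in> Y"
  shows "u x = 0"
proof (rule connected_induction_zero[OF Y(2) D _ x])
  fix p assume p: "p \<in> Y"
  obtain V W \<sigma> \<tau> where V: "open V" "p \<in> V" and W: "open W" and \<sigma>: "real_analytic_on W \<sigma>"
    and hom: "homeomorphism W (Y \<inter> V) \<sigma> \<tau>"
    using Y(1) p unfolding embedded_surface_def by metis
  \<comment> \<open>Charts are homeomorphisms onto relatively open pieces, so balls in the parameter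
    domain yield the relative neighbourhoods for the connectedness argument.\<close>
  have op: "openin (top_of_set Y) (\<sigma> ` B)" if B: "open B" "B \<subseteq> W" for B
  proof -
    have "openin (top_of_set W) B" using B W by (simp add: openin_open_eq)
    then have "openin (top_of_set (Y \<inter> V)) (\<sigma> ` B)" by (rule homeomorphism_imp_open_map[OF hom])
    moreover have "openin (top_of_set Y) (Y \<inter> V)" using V(1) by (rule openin_open_Int)
    ultimately show ?thesis by (rule openin_trans)
  qed
  define w where "w = \<tau> p"
  have w: "w \<in> W" "\<sigma> w = p" using hom p V(2) unfolding homeomorphism_def w_def by blast+
  have \<sigma>Y: "\<sigma> v \<in> Y" if "v \<in> W" for v using hom that unfolding homeomorphism_def by blast
  obtain R where R: "R > 0" "ball w R \<subseteq> W" using W w(1) open_contains_ball by blast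
  have sub: "ball w (R / 2) \<subseteq> W" using R subset_ball[of "R / 2" R w] by auto
  show "\<exists>N. openin (top_of_set Y) N \<and> p \<in> N \<and>
      (\<forall>q\<in>N. \<forall>M. openin (top_of_set Y) M \<and> q \<in> M \<and> (\<forall>x\<in>M. u x = 0) \<longrightarrow>
         (\<exists>M'. openin (top_of_set Y) M' \<and> p \<in> M' \<and> (\<forall>x\<in>M'. u x = 0)))"
  proof (rule exI[of _ "\<sigma> ` ball w (R / 2)"], intro conjI ballI allI impI)
    show "openin (top_of_set Y) (\<sigma> ` ball w (R / 2))" by (rule op[OF open_ball sub])
    show "p \<in> \<sigma> ` ball w (R / 2)" using w(2) R(1) by (auto intro!: rev_image_eqI[of w])
    fix q M assume q: "q \<in> \<sigma> ` ball w (R / 2)" and M: "openin (top_of_set Y) M \<and> q \<in> M \<and> (\<forall>x\<in>M. u x = 0)"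
    obtain a where a: "a \<in> ball w (R / 2)" "q = \<sigma> a" using q by blast
    have aW: "a \<in> W" using a(1) sub by blast
    have aR: "ball a (R / 2) \<subseteq> W"
    proof
      fix y assume "y \<in> ball a (R / 2)"
      then have "dist w y < R" using a(1) dist_triangle[of w y a] by simp
      then show "y \<in> W" using R(2) by auto
    qed
    have "continuous_on W \<sigma>" using hom unfolding homeomorphism_def by blast
    obtain M0 where M0: "open M0" "M = Y \<inter> M0" using M unfolding openin_open by blast
    have "open (W \<inter> \<sigma> -` M0)" using \<open>continuous_on W \<sigma>\<close> W M0(1) continuous_open_preimage by blast
    moreover have "a \<in> W \<inter> \<sigma> -` M0" using aW M M0(2) a(2) by blast
    ultimately obtain c where c: "c > 0" "ball a c \<subseteq> W \<inter> \<sigma> -` M0" using open_contains_ball by blast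
    have c0: "u (\<sigma> v) = 0" if "v \<in> ball a c" for v
      using that c(2) \<sigma>Y M M0(2) by blast
    have z: "u (\<sigma> v) = 0" if v: "v \<in> ball a (R / 2)" for v
    proof -
      define \<gamma> where "\<gamma> t = \<sigma> (a + t *\<^sub>R (v - a))" for t
      have "u (\<gamma> 1) = 0"
      proof (rule helmholtz_zero_along_curve[where \<gamma>=\<gamma>, OF u U])
        show "c / (norm (v - a) + 1) > 0" using c(1) by (simp add: add_nonneg_pos)
        show "u (\<gamma> s) = 0" if s: "\<bar>s\<bar> < c / (norm (v - a) + 1)" for s
        proof -
          have "\<bar>s\<bar> * norm (v - a) \<le> \<bar>s\<bar> * (norm (v - a) + 1)" by (intro mult_left_mono) auto
          also have "\<dots> < c" using s by (simp add: pos_less_divide_eq add_nonneg_pos)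
          finally have "a + s *\<^sub>R (v - a) \<in> ball a c" by (simp add: dist_norm)
          then show ?thesis unfolding \<gamma>_def by (rule c0)
        qed
        fix t :: real assume t: "t \<in> {0..1}"
        have "norm (t *\<^sub>R (v - a)) \<le> norm (v - a)" using t by (simp add: mult_left_le_one_le)
        then have tW: "a + t *\<^sub>R (v - a) \<in> W" using v aR by (auto simp: dist_norm norm_minus_commute subset_iff)
        obtain \<rho> \<Gamma> where "\<rho> > 0" "\<And>i. \<Gamma> i holomorphic_on ball (of_real t) \<rho>"
          "\<And>s i. \<bar>s - t\<bar> < \<rho> \<Longrightarrow> \<Gamma> i (of_real s) = of_real (\<sigma> (a + t *\<^sub>R (v - a) + (s - t) *\<^sub>R (v - a)) $ i)"
          using real_analytic_on_line_holomorphic[OF \<sigma> tW, of t "v - a"] by blast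
        moreover have "a + t *\<^sub>R (v - a) + (s - t) *\<^sub>R (v - a) = a + s *\<^sub>R (v - a)" for s
          by (simp add: algebra_simps)
        ultimately have "\<exists>\<rho>>0. \<exists>\<Gamma>. (\<forall>i. \<Gamma> i holomorphic_on ball (of_real t) \<rho>) \<and>
           (\<forall>s i. \<bar>s - t\<bar> < \<rho> \<longrightarrow> \<Gamma> i (of_real s) = of_real (\<gamma> s $ i))"
          unfolding \<gamma>_def by (intro exI[of _ \<rho>] conjI exI[of _ \<Gamma>]) auto
        moreover have "\<gamma> t \<in> U" using \<sigma>Y[OF tW] Y(3) unfolding \<gamma>_def by blast
        ultimately show "\<gamma> t \<in> U \<and> (\<exists>\<rho>>0. \<exists>\<Gamma>. (\<forall>i. \<Gamma> i holomorphic_on ball (of_real t) \<rho>) \<and>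
           (\<forall>s i. \<bar>s - t\<bar> < \<rho> \<longrightarrow> \<Gamma> i (of_real s) = of_real (\<gamma> s $ i)))" by blast
      qed
      then show ?thesis by (simp add: \<gamma>_def)
    qed
    show "\<exists>M'. openin (top_of_set Y) M' \<and> p \<in> M' \<and> (\<forall>x\<in>M'. u x = 0)"
    proof (intro exI[of _ "\<sigma> ` ball a (R / 2)"] conjI)
      show "openin (top_of_set Y) (\<sigma> ` ball a (R / 2))" by (rule op[OF open_ball aR])
      have "w \<in> ball a (R / 2)" using a(1) by (simp add: dist_commute)
      then show "p \<in> \<sigma> ` ball a (R / 2)" using w(2) by blast
      show "\<forall>x\<in>\<sigma> ` ball a (R / 2). u x = 0" using z by blast
    qed
  qed
qed simp

section \<open>Far field along rays\<close>

text \<open>By analytic continuation exp(2ik/z) g = h holds on the punctured disc. Along z = i t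
  with t tending to 0 from above the exponential is exp(2k/t) while \<open>h\<close> stays bounded,
  so \<open>g\<close> decays faster than every power of t and cannot have a zero of finite order at
  0.\<close>

lemma exp_reciprocal_uniqueness:
  fixes g h :: "complex \<Rightarrow> complex" and k e :: real
  assumes e: "e > 0" and k: "k > 0" and g: "g holomorphic_on ball 0 e" and h: "h holomorphic_on ball 0 e"
    and eq: "\<And>t. 0 < t \<Longrightarrow> t < e \<Longrightarrow> exp (\<i> * k / of_real t) * g (of_real t) = exp (- (\<i> * k / of_real t)) * h (of_real t)"
    and z: "z \<in> ball 0 e"
  shows "g z = 0"
proof (rule ccontr)
  assume gz: "g z \<noteq> 0"
  define S where "S = ball (0::complex) e - {0}"
  define D where "D w = exp (\<i> * k / w) * g w - exp (- (\<i> * k / w)) * h w" for w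
  have S: "open S" "connected S"
    unfolding S_def by (auto intro!: connected_open_delete simp: open_delete)
  have gS: "g holomorphic_on S" "h holomorphic_on S"
    using g h unfolding S_def by (auto intro: holomorphic_on_subset)
  have DS: "D holomorphic_on S"
    unfolding D_def [abs_def] by (intro holomorphic_intros gS) (auto simp: S_def)
  have D0: "D w = 0" if w: "w \<in> S" for w
  proof (rule analytic_continuation[OF DS S, where U="complex_of_real ` {0<..<e}" and \<xi>="of_real (e / 2)"])
    show "complex_of_real ` {0<..<e} \<subseteq> S" by (auto simp: S_def)
    show "complex_of_real (e / 2) \<in> S" using e by (auto simp: S_def)
    show "D w = 0" if "w \<in> complex_of_real ` {0<..<e}" for w
      using that eq by (auto simp: D_def)
    show "complex_of_real (e / 2) islimpt complex_of_real ` {0<..<e}"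
      unfolding islimpt_approachable
    proof (intro allI impI)
      fix c :: real assume c: "c > 0"
      define d where "d = min c e / 4"
      have d: "d > 0" "d < c" "e / 2 + d < e" using c e by (auto simp: d_def min_def)
      then have mem: "complex_of_real (e / 2 + d) \<in> complex_of_real ` {0<..<e}"
        using e by (intro imageI) simp
      have "dist (complex_of_real (e / 2 + d)) (of_real (e / 2)) = d"
        using d(1) unfolding dist_norm of_real_diff [symmetric] norm_of_real by simp
      moreover have "complex_of_real (e / 2 + d) \<noteq> of_real (e / 2)" using d(1) unfolding of_real_eq_iff by simp
      ultimately show "\<exists>x'\<in>complex_of_real ` {0<..<e}. x' \<noteq> of_real (e / 2) \<and> dist x' (of_real (e / 2)) < c"
        using d(2) by (intro bexI[OF _ mem]) simp
    qed
  qed (rule w)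
  \<comment> \<open>Take \<open>n = 0\<close> if \<open>g 0\<close> is nonzero. Otherwise
    \<open>g\<close> is not constant because \<open>g z\<close> is nonzero, and its zero at 0 has a
    finite order \<open>n\<close>.\<close>
  obtain n r g1 where r: "r > 0" "r < e" and g1: "continuous_on (cball 0 r) g1" "g1 0 \<noteq> 0"
    and fac: "\<And>w. w \<in> ball 0 r \<Longrightarrow> g w = w ^ n * g1 w"
  proof (cases "g 0 = 0")
    case False
    show thesis
    proof (rule that[of "e / 2" g 0])
      show "continuous_on (cball 0 (e / 2)) g"
        using holomorphic_on_imp_continuous_on[OF g] by (rule continuous_on_subset) (use e in auto)
    qed (use e False in auto)
  next
    case True
    have nc: "\<not> g constant_on ball 0 e"
      using True gz z e unfolding constant_on_def by (metis centre_in_ball)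
    have c0: "0 \<in> ball (0::complex) e" using e by simp
    show thesis
    proof (rule holomorphic_factor_zero_nonconstant[OF g open_ball connected_ball c0 True nc])
      fix g1 r n
      assume r: "0 < n" "0 < r" "ball 0 r \<subseteq> ball 0 e" "g1 holomorphic_on ball 0 r"
        "\<And>w. w \<in> ball 0 r \<Longrightarrow> g w = (w - 0) ^ n * g1 w" "\<And>w. w \<in> ball 0 r \<Longrightarrow> g1 w \<noteq> 0"
      have m: "0 < min r e / 2" "min r e / 2 < e" "min r e / 2 < r" using r(2) e by (auto simp: min_def)
      show thesis
      proof (rule that[of "min r e / 2" g1 n])
        show "continuous_on (cball 0 (min r e / 2)) g1"
          using holomorphic_on_imp_continuous_on[OF r(4)] by (rule continuous_on_subset) (use m in auto)
        show "g w = w ^ n * g1 w" if "w \<in> ball 0 (min r e / 2)" for w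
        proof -
          have "w \<in> ball 0 r" using that m(3) unfolding mem_ball_0 by linarith
          from r(5)[OF this] show ?thesis by simp
        qed
        show "g1 0 \<noteq> 0" using r(2,6) by simp
      qed (use m in auto)
    qed
  qed
  obtain B where B: "B \<ge> 0" "\<And>w. w \<in> cball 0 r \<Longrightarrow> norm (h w) \<le> B"
  proof -
    have "continuous_on (cball 0 r) h"
      using holomorphic_on_imp_continuous_on[OF h] by (rule continuous_on_subset) (use r in auto)
    then show thesis using continuous_on_compact_bound[OF compact_cball] that by metis
  qed
  \<comment> \<open>Chosen so that \<open>\<i> * k / w j\<close> is (j + 1)/2; the quotient of the
    two exponentials is then exp(j + 1).\<close>
  define t where "t j = 2 * k / real (Suc j)" for j
  define w where "w j = \<i> * complex_of_real (t j)" for j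
  have t: "t j > 0" for j using k by (simp add: t_def)
  have t0: "t \<longlonglongrightarrow> 0"
    using tendsto_mult[OF tendsto_const[of "2 * k"] LIMSEQ_inverse_real_of_nat] by (simp add: t_def [abs_def] divide_inverse)
  have w0: "w \<longlonglongrightarrow> 0"
    unfolding w_def [abs_def] using tendsto_mult[OF tendsto_const[of \<i>] tendsto_of_real[OF t0]] by simp
  have ev: "\<forall>\<^sub>F j in sequentially. t j < r" using order_tendstoD(2)[OF t0 r(1)] .
  have bnd: "norm (g1 (w j)) \<le> B / (2 * k) ^ n * (real (Suc j) ^ n / exp (real (Suc j)))" if j: "t j < r" for j
  proof -
    have wr: "w j \<in> ball 0 r" "w j \<noteq> 0" using j t[of j] by (auto simp: w_def norm_mult)
    have "D (w j) = 0" by (rule D0) (use wr r in \<open>auto simp: S_def\<close>)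
    then have "exp (\<i> * k / w j) * g (w j) = exp (- (\<i> * k / w j)) * h (w j)" by (simp add: D_def)
    moreover have "\<i> * k / w j = of_real (real (Suc j) / 2)"
      using k by (simp add: w_def t_def field_simps)
    ultimately have "exp (of_real (real (Suc j) / 2)) * g (w j) = exp (- of_real (real (Suc j) / 2)) * h (w j)" by simp
    then have "norm (exp (of_real (real (Suc j) / 2)) * g (w j)) = norm (exp (- complex_of_real (real (Suc j) / 2)) * h (w j))" by simp
    then have "exp (real (Suc j) / 2) * norm (g (w j)) = exp (- (real (Suc j) / 2)) * norm (h (w j))"
      unfolding norm_mult norm_exp_eq_Re by simp
    then have "norm (g (w j)) = exp (- (real (Suc j) / 2)) / exp (real (Suc j) / 2) * norm (h (w j))"
      by (simp add: field_simps)
    also have "exp (- (real (Suc j) / 2)) / exp (real (Suc j) / 2) = exp (- (real (Suc j) / 2) - real (Suc j) / 2)"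
      by (rule exp_diff [symmetric])
    also have "- (real (Suc j) / 2) - real (Suc j) / 2 = - real (Suc j)" by (simp add: field_simps)
    finally have "norm (g (w j)) \<le> exp (- real (Suc j)) * B"
      using B(2)[of "w j"] wr(1) by (simp add: mult_left_mono)
    moreover have "norm (g (w j)) = t j ^ n * norm (g1 (w j))"
      using fac[OF wr(1)] t[of j] by (simp add: norm_mult norm_power w_def)
    ultimately have "t j ^ n * norm (g1 (w j)) \<le> exp (- real (Suc j)) * B" by simp
    then have "norm (g1 (w j)) \<le> exp (- real (Suc j)) * B / t j ^ n"
      using t[of j] by (simp add: field_simps)
    also have "\<dots> = B / (2 * k) ^ n * (real (Suc j) ^ n / exp (real (Suc j)))"
      by (simp only: t_def power_divide exp_minus) (simp add: field_simps)
    finally show ?thesis .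
  qed
  have "((\<lambda>x::real. x ^ n / exp x) \<longlongrightarrow> 0) at_top" by (rule tendsto_power_div_exp_0)
  moreover have "filterlim (\<lambda>j. real (Suc j)) at_top sequentially"
    using filterlim_real_sequentially filterlim_sequentially_Suc by blast
  ultimately have "(\<lambda>j. real (Suc j) ^ n / exp (real (Suc j))) \<longlonglongrightarrow> 0" by (rule filterlim_compose)
  then have lim: "(\<lambda>j. B / (2 * k) ^ n * (real (Suc j) ^ n / exp (real (Suc j)))) \<longlonglongrightarrow> 0"
    by (rule tendsto_mult_right_zero)
  have "(\<lambda>j. g1 (w j)) \<longlonglongrightarrow> 0"
    by (rule Lim_null_comparison[OF eventually_mono[OF ev bnd] lim])
  moreover have "(\<lambda>j. g1 (w j)) \<longlonglongrightarrow> g1 0"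
  proof -
    have "isCont g1 0" using g1(1) r(1) by (meson centre_in_ball continuous_on_interior interior_cball mem_interior_cball continuous_on_eq_continuous_at open_ball ball_subset_cball continuous_on_subset)
    then show ?thesis using w0 isCont_tendsto_compose by blast
  qed
  ultimately show False using g1(2) LIMSEQ_unique by blast
qed

text \<open>After the factor exp(ikr)/r is split off, the potential is a convergent power series in
  1/r on a fixed ray, an expansion of Atkinson-Wilcox type. The radius ensures |z| |y| <= 1/4, hence
  |R - 1| <= 1/2 + 1/16 < 1 and the square root is holomorphic; the 1 in L + 1 covers L = 0.\<close>

lemma ray_expansion:
  fixes f :: "real^3 \<Rightarrow> complex" and \<omega> :: "real^3" and k L :: real
  assumes f: "continuous_on (cbox a b) f" and L: "\<And>y. y \<in> cbox a b \<Longrightarrow> norm y \<le> L" "L \<ge> 0"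
    and \<omega>: "norm \<omega> = 1"
  obtains g where "g holomorphic_on ball 0 (1 / (4 * (L + 1)))"
    "\<And>r. r > 4 * (L + 1) \<Longrightarrow> integral (cbox a b) (\<lambda>y. f y * spherical_kernel k ((norm (y - r *\<^sub>R \<omega>))\<^sup>2)) =
        exp (\<i> * k * of_real r) / of_real r * g (of_real (1 / r))"
proof -
  \<comment> \<open>For \<open>z = 1 / r\<close> one has \<open>|y - r \<omega>| = r P\<close>, and \<open>|y - r \<omega>| - r = (P - 1) / z = (z B - 2 A) / (P + 1)\<close>,
    where the last form is regular at \<open>z = 0\<close>.\<close>
  define e where "e = 1 / (4 * (L + 1))"
  have e: "e > 0" "e * L \<le> 1 / 4" using L(2) by (auto simp: e_def field_simps)
  define A where "A y = complex_of_real (\<omega> \<bullet> y)" for y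
  define B where "B y = complex_of_real ((norm y)\<^sup>2)" for y :: "real^3"
  define R where "R z y = 1 - 2 * z * A y + z\<^sup>2 * B y" for z y
  define P where "P z y = csqrt (R z y)" for z y
  define P' where "P' z y = (2 * z * B y - 2 * A y) * inverse (2 * P z y)" for z y
  define X where "X z y = exp (\<i> * k * ((z * B y - 2 * A y) / (P z y + 1)))" for z y
  define G where "G z y = X z y / P z y" for z y
  define G' where "G' z y = (X z y * (\<i> * k * ((B y * (P z y + 1) - (z * B y - 2 * A y) * P' z y) / ((P z y + 1) * (P z y + 1)))) * P z y
      - X z y * P' z y) / (P z y * P z y)" for z y
  define U where "U = ball (0::complex) e"
  have ReR: "Re (R z y) > 0" if z: "z \<in> U" and y: "y \<in> cbox a b" for z y
  proof -
    have zy: "norm z * norm y \<le> 1 / 4"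
    proof -
      have "norm z * norm y \<le> e * L" using z L(1)[OF y] e by (intro mult_mono) (auto simp: U_def)
      then show ?thesis using e(2) by linarith
    qed
    have "norm (R z y - 1) \<le> norm (2 * z * A y) + norm (z\<^sup>2 * B y)"
      unfolding R_def using norm_triangle_ineq[of "- (2 * z * A y)" "z\<^sup>2 * B y"] by simp
    moreover have "norm (2 * z * A y) \<le> 2 * (norm z * norm y)"
      using Cauchy_Schwarz_ineq2[of \<omega> y] \<omega> by (simp add: norm_mult A_def mult_left_mono)
    moreover have "norm (z\<^sup>2 * B y) = (norm z * norm y)\<^sup>2"
      by (simp add: norm_mult norm_power B_def power_mult_distrib)
    moreover have "(norm z * norm y)\<^sup>2 \<le> (1 / 4)\<^sup>2" using zy by (intro power_mono) auto
    ultimately have "norm (R z y - 1) < 1" using zy by (simp add: power2_eq_square)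
    moreover have "\<bar>Re (R z y - 1)\<bar> \<le> norm (R z y - 1)" by (rule abs_Re_le_cmod)
    ultimately have "\<bar>Re (R z y) - 1\<bar> < 1" by simp
    then show ?thesis by linarith
  qed
  have P0: "P z y \<noteq> 0" "P z y + 1 \<noteq> 0" if "z \<in> U" "y \<in> cbox a b" for z y
  proof -
    show "P z y \<noteq> 0" using ReR[OF that] by (auto simp: P_def)
    have "Re (P z y) \<ge> 0" unfolding P_def by (rule Re_csqrt)
    then show "P z y + 1 \<noteq> 0" by (auto simp: complex_eq_iff)
  qed
  have oR: "open {q::complex. Re q > 0}" by (simp add: open_halfspace_Re_gt)
  have "csqrt holomorphic_on {q. Re q > 0}"
    using holomorphic_on_csqrt by (rule holomorphic_on_subset) (auto simp: complex_nonpos_Reals_iff)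
  then have cs: "continuous_on {q. Re q > 0} csqrt" by (rule holomorphic_on_imp_continuous_on)
  have cA: "continuous_on S A" "continuous_on S B" for S
    unfolding A_def [abs_def] B_def [abs_def] by (intro continuous_intros)+
  have cA': "continuous_on S (\<lambda>p. A (snd p))" "continuous_on S (\<lambda>p. B (snd p))" for S :: "(complex \<times> (real^3)) set"
    unfolding A_def B_def by (intro continuous_intros)+
  have cR: "continuous_on (U \<times> cbox a b) (\<lambda>p. R (fst p) (snd p))"
    unfolding R_def by (intro continuous_intros cA')
  have cP: "continuous_on (U \<times> cbox a b) (\<lambda>p. P (fst p) (snd p))"
    unfolding P_def by (rule continuous_on_compose2[OF cs cR]) (use ReR in auto)
  have cP': "continuous_on (U \<times> cbox a b) (\<lambda>p. P' (fst p) (snd p))"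
    unfolding P'_def by (intro continuous_intros cA' cP) (use P0 in auto)
  have cX: "continuous_on (U \<times> cbox a b) (\<lambda>p. X (fst p) (snd p))"
    unfolding X_def by (intro continuous_intros cA' cP) (use P0 in auto)
  have cG: "continuous_on (U \<times> cbox a b) (\<lambda>p. G (fst p) (snd p))"
    unfolding G_def by (intro continuous_intros cX cP) (use P0 in auto)
  have cG': "continuous_on (U \<times> cbox a b) (\<lambda>p. G' (fst p) (snd p))"
    unfolding G'_def by (intro continuous_intros cA' cX cP cP') (use P0 in auto)
  have hol: "(\<lambda>z. integral (cbox a b) (\<lambda>y. f y * G z y)) holomorphic_on U"
  proof (rule holomorphic_on_integral_cbox[OF f, where G'=G'])
    fix z y assume zy: "z \<in> U" "y \<in> cbox a b"
    have "R z y \<notin> \<real>\<^sub>\<le>\<^sub>0" using ReR[OF zy] by (auto simp: complex_nonpos_Reals_iff)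
    then have "(csqrt has_field_derivative inverse (2 * csqrt (R z y))) (at (R z y))"
      by (rule has_field_derivative_csqrt)
    moreover have "((\<lambda>z. R z y) has_field_derivative (2 * z * B y - 2 * A y)) (at z)"
      unfolding R_def by (auto intro!: derivative_eq_intros)
    ultimately have dP: "((\<lambda>z. P z y) has_field_derivative P' z y) (at z)"
      unfolding P_def P'_def by (subst mult.commute) (rule DERIV_chain2)
    have dX: "((\<lambda>z. X z y) has_field_derivative
        X z y * (\<i> * k * ((B y * (P z y + 1) - (z * B y - 2 * A y) * P' z y) / ((P z y + 1) * (P z y + 1))))) (at z)"
      unfolding X_def using P0[OF zy]
      by (auto intro!: derivative_eq_intros dP simp: algebra_simps)
    show "((\<lambda>z. G z y) has_field_derivative G' z y) (at z)"
      unfolding G_def G'_def by (rule DERIV_divide[OF dX dP]) (use P0[OF zy] in auto)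
  next
    fix z assume z: "z \<in> U"
    have "continuous_on (cbox a b) (\<lambda>y. (\<lambda>p. G (fst p) (snd p)) (z, y))"
      by (rule continuous_on_compose2[OF cG]) (use z in \<open>auto intro!: continuous_intros\<close>)
    then show "continuous_on (cbox a b) (G z)" by simp
  qed (use cG' in \<open>auto simp: U_def\<close>)
  have "integral (cbox a b) (\<lambda>y. f y * spherical_kernel k ((norm (y - r *\<^sub>R \<omega>))\<^sup>2)) =
        exp (\<i> * k * of_real r) / of_real r * integral (cbox a b) (\<lambda>y. f y * G (of_real (1 / r)) y)"
    if r: "r > 4 * (L + 1)" for r
  proof -
    have "0 < 4 * (L + 1)" using L(2) by simp
    then have r0: "r > 0" using r by (rule less_trans)
    have zU: "complex_of_real (1 / r) \<in> U"
      using r r0 L(2) by (simp add: U_def e_def norm_divide frac_less2)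
    have "f y * spherical_kernel k ((norm (y - r *\<^sub>R \<omega>))\<^sup>2) = exp (\<i> * k * of_real r) / of_real r * (f y * G (of_real (1 / r)) y)"
      if y: "y \<in> cbox a b" for y
    proof -
      define s where "s = norm (y - r *\<^sub>R \<omega>)"
      define c where "c = complex_of_real s"
      define q where "q = complex_of_real r"
      have "\<omega> \<bullet> \<omega> = 1" using \<omega> by (simp add: norm_eq_sqrt_inner)
      then have s2: "s\<^sup>2 = (norm y)\<^sup>2 - 2 * r * (\<omega> \<bullet> y) + r\<^sup>2"
        unfolding s_def power2_norm_eq_inner
        by (simp add: inner_diff_left inner_diff_right inner_commute[of y \<omega>] power2_eq_square right_diff_distrib)
      have q0: "q \<noteq> 0" using r0 by (simp add: q_def)
      have c2: "c\<^sup>2 = B y - 2 * q * A y + q\<^sup>2"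
        unfolding c_def B_def A_def q_def by (simp flip: of_real_power add: s2)
      have "R (of_real (1 / r)) y = of_real ((s / r)\<^sup>2)"
      proof -
        have "R (of_real (1 / r)) y = c\<^sup>2 / q\<^sup>2"
          unfolding c2 R_def using q0 by (simp add: q_def [symmetric] field_simps power2_eq_square)
        then show ?thesis by (simp add: c_def q_def power_divide)
      qed
      then have P: "P (of_real (1 / r)) y = c / q"
        using r0 by (simp add: P_def s_def c_def q_def flip: of_real_power of_real_divide)
      have c0: "c \<noteq> 0" using P0(1)[OF zU y] P by auto
      have cq: "c / q + 1 \<noteq> 0" using P0(2)[OF zU y] P by auto
      then have cq': "c + q \<noteq> 0" using q0 by (simp add: field_simps)
      \<comment> \<open>Difference of squares: \<open>c\<^sup>2 - q\<^sup>2\<close> divided by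
        \<open>q\<close>. It trades the phase difference \<open>c - q\<close> for the form that is
        regular at infinite distance.\<close>
      have "B y / q - 2 * A y = (c - q) * (c / q + 1)"
        using c2 q0 by (simp add: field_simps power2_eq_square)
      then have "(of_real (1 / r) * B y - 2 * A y) / (c / q + 1) = c - q"
        using cq by (simp add: q_def [symmetric])
      then have G: "G (of_real (1 / r)) y = exp (\<i> * k * (c - q)) / (c / q)"
        unfolding G_def X_def P by (simp only:)
      have "\<i> * k * c = \<i> * k * q + \<i> * k * (c - q)" by (simp add: algebra_simps)
      then have "exp (\<i> * k * c) = exp (\<i> * k * q) * exp (\<i> * k * (c - q))" by (simp only: exp_add)
      then have K: "spherical_kernel k ((norm (y - r *\<^sub>R \<omega>))\<^sup>2) = exp (\<i> * k * q) * exp (\<i> * k * (c - q)) / c"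
        by (simp add: spherical_kernel_def c_def s_def)
      show ?thesis unfolding G K q_def [symmetric] using c0 q0 by simp
    qed
    then have "integral (cbox a b) (\<lambda>y. f y * spherical_kernel k ((norm (y - r *\<^sub>R \<omega>))\<^sup>2)) =
        integral (cbox a b) (\<lambda>y. exp (\<i> * k * of_real r) / of_real r * (f y * G (of_real (1 / r)) y))"
      by (rule integral_cong)
    then show ?thesis by simp
  qed
  with hol show thesis unfolding U_def e_def by (rule that)
qed

section \<open>Radiation solutions\<close>

lemma C2_upto_subset: "C2_upto U A f \<Longrightarrow> V \<subseteq> U \<Longrightarrow> B \<subseteq> A \<Longrightarrow> C2_upto V B f"
  unfolding C2_upto_def by (meson continuous_on_subset subsetD)

lemma C2_upto_diff:
  assumes "C2_upto U A f" "C2_upto U A g"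
  shows "C2_upto U A (\<lambda>x. f x - g x)"
proof -
  obtain f' f'' where f: "\<And>x. x \<in> U \<Longrightarrow> (f has_derivative blinfun_apply (f' x)) (at x)"
    "\<And>x. x \<in> U \<Longrightarrow> (f' has_derivative blinfun_apply (f'' x)) (at x)"
    "continuous_on A f" "continuous_on A f'" "continuous_on A f''"
    using assms(1) unfolding C2_upto_def by blast
  obtain g' g'' where g: "\<And>x. x \<in> U \<Longrightarrow> (g has_derivative blinfun_apply (g' x)) (at x)"
    "\<And>x. x \<in> U \<Longrightarrow> (g' has_derivative blinfun_apply (g'' x)) (at x)"
    "continuous_on A g" "continuous_on A g'" "continuous_on A g''"
    using assms(2) unfolding C2_upto_def by blast
  show ?thesis
    unfolding C2_upto_def
  proof (intro exI[of _ "\<lambda>x. f' x - g' x"] exI[of _ "\<lambda>x. f'' x - g'' x"] conjI ballI)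
    fix x assume x: "x \<in> U"
    show "((\<lambda>x. f x - g x) has_derivative blinfun_apply (f' x - g' x)) (at x)"
      using has_derivative_diff[OF f(1)[OF x] g(1)[OF x]] by (simp only: blinfun.diff_left [symmetric])
    show "((\<lambda>x. f' x - g' x) has_derivative blinfun_apply (f'' x - g'' x)) (at x)"
      using has_derivative_diff[OF f(2)[OF x] g(2)[OF x]] by (simp only: blinfun.diff_left [symmetric])
  qed (intro continuous_on_diff f g)+
qed

lemma C2_upto_linear_image:
  fixes f :: "'a::real_normed_vector \<Rightarrow> 'b::real_normed_vector" and L :: "'b \<Rightarrow> 'c::real_normed_vector"
  assumes "C2_upto U A f" and L: "bounded_linear L"
  shows "C2_upto U A (\<lambda>x. L (f x))"
proof -
  obtain f' f'' where f: "\<And>x. x \<in> U \<Longrightarrow> (f has_derivative blinfun_apply (f' x)) (at x)"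
    "\<And>x. x \<in> U \<Longrightarrow> (f' has_derivative blinfun_apply (f'' x)) (at x)"
    "continuous_on A f" "continuous_on A f'" "continuous_on A f''"
    using assms(1) unfolding C2_upto_def by blast
  define Lb where "Lb = Blinfun L"
  have Lb: "blinfun_apply Lb = L" unfolding Lb_def by (rule bounded_linear_Blinfun_apply[OF L])
  define M where "M B = Lb o\<^sub>L B" for B :: "'a \<Rightarrow>\<^sub>L 'b"
  have M: "bounded_linear M"
    unfolding M_def [abs_def]
    by (rule bounded_bilinear.bounded_linear_right[OF bounded_bilinear_blinfun_compose])
  define Mb where "Mb = Blinfun M"
  have Mb: "blinfun_apply Mb = M" unfolding Mb_def by (rule bounded_linear_Blinfun_apply[OF M])
  have eqM: "blinfun_apply (M B) = (\<lambda>h. L (blinfun_apply B h))" for B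
    by (simp add: fun_eq_iff M_def Lb)
  have eqMb: "blinfun_apply (Mb o\<^sub>L B) = (\<lambda>h. M (blinfun_apply B h))" for B :: "'a \<Rightarrow>\<^sub>L ('a \<Rightarrow>\<^sub>L 'b)"
    by (simp add: fun_eq_iff Mb)
  show ?thesis
    unfolding C2_upto_def
  proof (intro exI[of _ "\<lambda>x. M (f' x)"] exI[of _ "\<lambda>x. Mb o\<^sub>L f'' x"] conjI ballI)
    fix x assume x: "x \<in> U"
    show "((\<lambda>x. L (f x)) has_derivative blinfun_apply (M (f' x))) (at x)"
      using bounded_linear.has_derivative[OF L f(1)[OF x]] by (simp only: eqM)
    show "((\<lambda>x. M (f' x)) has_derivative blinfun_apply (Mb o\<^sub>L f'' x)) (at x)"
      using bounded_linear.has_derivative[OF M f(2)[OF x]] by (simp only: eqMb)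
  next
    show "continuous_on A (\<lambda>x. L (f x))" "continuous_on A (\<lambda>x. M (f' x))"
      by (intro bounded_linear.continuous_on[OF L] bounded_linear.continuous_on[OF M] f)+
    show "continuous_on A (\<lambda>x. Mb o\<^sub>L f'' x)"
      by (intro bounded_bilinear.continuous_on[OF bounded_bilinear_blinfun_compose] continuous_on_const f)
  qed
qed

lemma has_derivative_imp_line_derivative:
  assumes "(f has_derivative f') (at x)"
  shows "((\<lambda>t. f (x + t *\<^sub>R b)) has_vector_derivative f' b) (at 0)"
proof -
  have "((\<lambda>t. x + t *\<^sub>R b) has_derivative (\<lambda>t. t *\<^sub>R b)) (at 0)"
    by (auto intro!: derivative_eq_intros)
  moreover have "(f has_derivative f') (at (x + 0 *\<^sub>R b))" using assms by simp
  ultimately have "((\<lambda>t. f (x + t *\<^sub>R b)) has_derivative (\<lambda>t. f' (t *\<^sub>R b))) (at 0)"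
    by (rule has_derivative_compose)
  moreover have "f' (t *\<^sub>R b) = t *\<^sub>R f' b" for t
    using linear_cmul[OF has_derivative_linear[OF assms]] .
  ultimately show ?thesis by (simp add: has_vector_derivative_def)
qed

lemma C2_upto_imp_C2_partials:
  fixes f :: "'a::euclidean_space \<Rightarrow> complex"
  assumes "\<And>x. x \<in> U \<Longrightarrow> (f has_derivative blinfun_apply (f' x)) (at x)"
    "\<And>x. x \<in> U \<Longrightarrow> (f' has_derivative blinfun_apply (f'' x)) (at x)"
    "continuous_on U f" "continuous_on U f'" "continuous_on U f''"
  shows "C2_partials U f (\<lambda>b x. f' x b) (\<lambda>b x. f'' x b b)"
  unfolding C2_partials_def
proof (intro conjI ballI)
  show "continuous_on U f" by fact
  fix b :: 'a assume "b \<in> Basis"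
  show "continuous_on U (\<lambda>x. f' x b)" "continuous_on U (\<lambda>x. f'' x b b)"
    by (intro continuous_intros assms)+
  fix x assume x: "x \<in> U"
  show "((\<lambda>t. f (x + t *\<^sub>R b)) has_vector_derivative f' x b) (at 0)"
    by (rule has_derivative_imp_line_derivative[OF assms(1)[OF x]])
  have "((\<lambda>x. f' x b) has_derivative (\<lambda>h. f'' x h b)) (at x)"
    by (rule bounded_linear.has_derivative[OF blinfun.bounded_linear_left assms(2)[OF x]])
  then show "((\<lambda>t. f' (x + t *\<^sub>R b) b) has_vector_derivative f'' x b b) (at 0)"
    by (rule has_derivative_imp_line_derivative)
qed

text \<open>\<open>laplacian\<close> iterates \<open>vector_derivative\<close>, which is determined
  only where a derivative exists. Openness of \<open>U\<close> makes the first line derivatives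
  agree with the data in a neighbourhood, so they can be differentiated again.\<close>

lemma laplacian_C2_partials:
  assumes U: "open U" and f: "C2_partials U f f' f''" and x: "x \<in> U"
  shows "laplacian f x = (\<Sum>b\<in>Basis. f'' b x)"
  unfolding laplacian_def
proof (rule sum.cong[OF refl])
  fix b :: 'a assume b: "b \<in> Basis"
  have 1: "f' b y = dir_deriv b f y" if "y \<in> U" for y
    unfolding dir_deriv_def using f b that unfolding C2_partials_def
    by (metis vector_derivative_at)
  have "((\<lambda>t. f' b (x + t *\<^sub>R b)) has_vector_derivative f'' b x) (at 0)"
    using f b x unfolding C2_partials_def by blast
  from has_vector_derivative_line_cong[OF U x 1 this]
  show "dir_deriv b (dir_deriv b f) x = f'' b x"
    unfolding dir_deriv_def[of b "dir_deriv b f"] by (rule vector_derivative_at)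
qed

lemma helmholtz_partials_iff:
  assumes U: "open U" and f: "C2_partials U f f' f''"
  shows "helmholtz_partials k U f f' f'' \<longleftrightarrow> helmholtz_on k U f"
proof -
  have "(- laplacian f x = of_real (k\<^sup>2) * f x) \<longleftrightarrow> (\<Sum>b\<in>Basis. f'' b x) + of_real (k\<^sup>2) * f x = 0" if "x \<in> U" for x
    unfolding laplacian_C2_partials[OF U f that] by (rule neg_eq_iff_add_eq_0)
  then show ?thesis using f unfolding helmholtz_partials_def helmholtz_on_def by simp
qed

lemma helmholtz_on_diff:
  assumes U: "open U" and "C2_upto U U f" "C2_upto U U g" "helmholtz_on k U f" "helmholtz_on k U g"
  shows "helmholtz_on k U (\<lambda>x. f x - g x)"
proof -
  obtain f' f'' where f: "\<And>x. x \<in> U \<Longrightarrow> (f has_derivative blinfun_apply (f' x)) (at x)"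
    "\<And>x. x \<in> U \<Longrightarrow> (f' has_derivative blinfun_apply (f'' x)) (at x)"
    "continuous_on U f" "continuous_on U f'" "continuous_on U f''"
    using assms(2) unfolding C2_upto_def by blast
  obtain g' g'' where g: "\<And>x. x \<in> U \<Longrightarrow> (g has_derivative blinfun_apply (g' x)) (at x)"
    "\<And>x. x \<in> U \<Longrightarrow> (g' has_derivative blinfun_apply (g'' x)) (at x)"
    "continuous_on U g" "continuous_on U g'" "continuous_on U g''"
    using assms(3) unfolding C2_upto_def by blast
  note pf = C2_upto_imp_C2_partials[OF f] and pg = C2_upto_imp_C2_partials[OF g]
  have "C2_partials U (\<lambda>x. f x - g x) (\<lambda>b x. f' x b - g' x b) (\<lambda>b x. f'' x b b - g'' x b b)"
    using pf pg unfolding C2_partials_def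
    by (auto intro!: continuous_on_diff has_vector_derivative_diff)
  from laplacian_C2_partials[OF U this] laplacian_C2_partials[OF U pf] laplacian_C2_partials[OF U pg]
  have l: "laplacian (\<lambda>x. f x - g x) x = laplacian f x - laplacian g x" if "x \<in> U" for x
    using that by (simp add: sum_subtractf)
  show ?thesis
    unfolding helmholtz_on_def
  proof
    fix x assume x: "x \<in> U"
    have "- laplacian (\<lambda>x. f x - g x) x = - laplacian f x - - laplacian g x" by (simp add: l[OF x])
    also have "\<dots> = of_real (k\<^sup>2) * f x - of_real (k\<^sup>2) * g x"
      using assms(4,5) x unfolding helmholtz_on_def by metis
    finally show "- laplacian (\<lambda>x. f x - g x) x = of_real (k\<^sup>2) * (f x - g x)" by (simp only: right_diff_distrib)
  qed
qed

lemma helmholtz_on_Im: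
  assumes U: "open U" and "C2_upto U U f" "helmholtz_on k U f"
  shows "helmholtz_on k U (\<lambda>x. of_real (Im (f x)))"
proof -
  obtain f' f'' where f: "\<And>x. x \<in> U \<Longrightarrow> (f has_derivative blinfun_apply (f' x)) (at x)"
    "\<And>x. x \<in> U \<Longrightarrow> (f' has_derivative blinfun_apply (f'' x)) (at x)"
    "continuous_on U f" "continuous_on U f'" "continuous_on U f''"
    using assms(2) unfolding C2_upto_def by blast
  note pf = C2_upto_imp_C2_partials[OF f]
  have L: "bounded_linear (\<lambda>z. complex_of_real (Im z))"
    by (rule bounded_linear_compose[OF bounded_linear_of_real bounded_linear_Im])
  have "C2_partials U (\<lambda>x. of_real (Im (f x))) (\<lambda>b x. of_real (Im (f' x b))) (\<lambda>b x. of_real (Im (f'' x b b)))"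
    using pf unfolding C2_partials_def
    by (auto intro!: continuous_on_Im bounded_linear.has_vector_derivative[OF L])
  from laplacian_C2_partials[OF U this] laplacian_C2_partials[OF U pf]
  have "laplacian (\<lambda>x. complex_of_real (Im (f x))) x = of_real (Im (laplacian f x))" if "x \<in> U" for x
    using that by simp
  moreover have "laplacian f x = - (of_real (k\<^sup>2) * f x)" if "x \<in> U" for x
    using assms(3) that unfolding helmholtz_on_def by (metis minus_minus)
  ultimately show ?thesis unfolding helmholtz_on_def by (simp del: of_real_power)
qed

lemma C2_partials_one_minus:
  assumes f: "C2_partials U f f' f''"
  shows "C2_partials U (\<lambda>x. 1 - f x) (\<lambda>b x. 0 - f' b x) (\<lambda>b x. 0 - f'' b x)"
  unfolding C2_partials_def
proof (intro conjI ballI)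
  show "continuous_on U (\<lambda>x. 1 - f x)"
    using f unfolding C2_partials_def by (intro continuous_on_diff continuous_on_const) blast
  fix b :: 'a assume b: "b \<in> Basis"
  show "continuous_on U (\<lambda>x. 0 - f' b x)" "continuous_on U (\<lambda>x. 0 - f'' b x)"
    using f b unfolding C2_partials_def by (intro continuous_on_diff continuous_on_const; blast)+
  fix x assume x: "x \<in> U"
  have d: "((\<lambda>t. f (x + t *\<^sub>R b)) has_vector_derivative f' b x) (at 0)"
    "((\<lambda>t. f' b (x + t *\<^sub>R b)) has_vector_derivative f'' b x) (at 0)"
    using f b x unfolding C2_partials_def by blast+
  show "((\<lambda>t. 1 - f (x + t *\<^sub>R b)) has_vector_derivative 0 - f' b x) (at 0)"
    by (rule has_vector_derivative_diff[OF has_vector_derivative_const d(1)])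
  show "((\<lambda>t. 0 - f' b (x + t *\<^sub>R b)) has_vector_derivative 0 - f'' b x) (at 0)"
    by (rule has_vector_derivative_diff[OF has_vector_derivative_const d(2)])
qed

text \<open>The decay hypothesis does not distinguish k from -k, so both kernels represent
  \<open>u\<close> far out with the same compactly supported density. On each ray this gives two
  expansions with opposite phases, which are compatible only if they vanish.\<close>

lemma helmholtz_far_field_zero:
  assumes k: "k > 0" and u: "helmholtz_partials k U u u' u''" and U: "open U"
    and far: "\<And>y. norm y > R0 \<Longrightarrow> y \<in> U"
    and decay: "\<And>d. d > 0 \<Longrightarrow> \<exists>r. \<forall>y. norm y \<ge> r \<longrightarrow>
       norm y * norm (u y) \<le> d \<and> norm (\<Sum>b\<in>Basis. of_real (y \<bullet> b) * u' b y) \<le> d"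
  shows "\<exists>R>0. \<forall>y. norm y > R \<longrightarrow> u y = 0"
proof -
  \<comment> \<open>The ball of radius \<open>d\<close> contains the complement of \<open>U\<close>,
    and \<open>\<theta>\<close> is 1 on it; \<open>(1 - \<theta> y) * u y\<close> is therefore a
    function of class C^2 on the whole space that equals \<open>u\<close> beyond radius
    \<open>2 * d\<close>.\<close>
  define d where "d = \<bar>R0\<bar> + 1"
  have d: "d > 0" "d > R0" by (auto simp: d_def)
  show ?thesis
  proof (rule local_cutoff[OF d(1), of "0 :: real^3"])
    fix \<theta> :: "real^3 \<Rightarrow> complex" and \<theta>' \<theta>'' :: "real^3 \<Rightarrow> real^3 \<Rightarrow> complex"
    assume \<theta>: "C2_partials UNIV \<theta> \<theta>' \<theta>''"
      and \<theta>1: "\<And>y b. norm (y - 0) \<le> d \<Longrightarrow> \<theta> y = 1 \<and> \<theta>' b y = 0 \<and> \<theta>'' b y = 0"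
      and \<theta>0: "\<And>y b. norm (y - 0) \<ge> 2 * d \<Longrightarrow> \<theta> y = 0 \<and> \<theta>' b y = 0 \<and> \<theta>'' b y = 0"
    have C: "C2_partials U u u' u''" and H: "\<And>y. y \<in> U \<Longrightarrow> (\<Sum>b\<in>Basis. u'' b y) + of_real (k\<^sup>2) * u y = 0"
      using u unfolding helmholtz_partials_def by auto
    have \<eta>: "C2_partials UNIV (\<lambda>y. 1 - \<theta> y) (\<lambda>b y. 0 - \<theta>' b y) (\<lambda>b y. 0 - \<theta>'' b y)"
      by (rule C2_partials_one_minus[OF \<theta>])
    define w where "w y = (1 - \<theta> y) * u y" for y
    define w' where "w' b y = (1 - \<theta> y) * u' b y + (0 - \<theta>' b y) * u y" for b y
    define w'' where "w'' b y = (1 - \<theta> y) * u'' b y + 2 * (0 - \<theta>' b y) * u' b y + (0 - \<theta>'' b y) * u y" for b y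
    have cov: "U \<union> ball 0 d = UNIV"
    proof -
      have "y \<in> U" if "y \<notin> ball 0 d" for y by (rule far) (use that d in auto)
      then show ?thesis by blast
    qed
    have w: "C2_partials UNIV w w' w''"
      unfolding w_def [abs_def] w'_def [abs_def] w''_def [abs_def]
      by (rule C2_partials_cutoff[OF U open_ball cov \<eta> C]) (use \<theta>1 in auto)
    define f where "f y = (\<Sum>b\<in>Basis. w'' b y) + of_real (k\<^sup>2) * w y" for y
    have out: "w y = u y" "\<And>b. w' b y = u' b y" "\<And>b. w'' b y = u'' b y" if "norm y \<ge> 2 * d" for y
      using \<theta>0[of y] that by (auto simp: w_def w'_def w''_def)
    have f0: "f y = 0" if "norm y \<ge> 2 * d" for y
    proof -
      have "y \<in> U" by (rule far) (use that d in linarith)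
      from H[OF this] show ?thesis by (simp add: f_def out[OF that])
    qed
    have cf: "continuous_on UNIV f"
    proof -
      have "continuous_on UNIV w" "\<And>b. b \<in> Basis \<Longrightarrow> continuous_on UNIV (w'' b)"
        using w unfolding C2_partials_def by blast+
      then show ?thesis unfolding f_def [abs_def]
        by (intro continuous_on_add[OF continuous_on_sum continuous_on_mult[OF continuous_on_const]])
    qed
    have dec: "\<exists>r. \<forall>y. norm y \<ge> r \<longrightarrow>
         norm y * norm (w y) \<le> c \<and> norm (\<Sum>b\<in>Basis. of_real (y \<bullet> b) * w' b y) \<le> c" if c: "c > 0" for c
    proof -
      obtain r where r: "\<And>y. norm y \<ge> r \<Longrightarrow> norm y * norm (u y) \<le> c \<and> norm (\<Sum>b\<in>Basis. of_real (y \<bullet> b) * u' b y) \<le> c"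
        using decay[OF c] by blast
      show ?thesis
        by (rule exI[of _ "max r (2 * d)"]) (use r out in auto)
    qed
    have f0': "f y = 0" if "norm y > 2 * d" for y using f0 that by simp
    have f0'': "f y = 0" if "dist y x < norm x - 2 * d" for x y
    proof (rule f0)
      show "norm y \<ge> 2 * d" using that norm_triangle_ineq2[of x y] by (simp add: dist_norm norm_minus_commute)
    qed
    obtain a where a: "cball (0::real^3) (2 * d) \<subseteq> cbox (- a) a"
      by (rule bounded_subset_cbox_symmetric[OF bounded_cball])
    obtain L where "\<forall>y\<in>cbox (- a) a. norm y \<le> L"
      using bounded_cbox[of "- a" a] unfolding bounded_iff by blast
    then have L: "norm y \<le> L" if "y \<in> cbox (- a) a" for y using that by (rule bspec)
    have "0 \<in> cbox (- a) a" using a d by auto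
    from L[OF this] have L0: "L \<ge> 0" by simp
    have fa: "f y = 0" if "y \<notin> cbox (- a) a" for y
    proof (rule f0')
      have "y \<notin> cball 0 (2 * d)" using that a by blast
      then show "norm y > 2 * d" by simp
    qed
    have ca: "continuous_on (cbox (- a) a) f" using cf continuous_on_subset by blast
    \<comment> \<open>The density \<open>f\<close> depends on \<open>k\<close> through its square
      only, so both \<open>k\<close> and \<open>- k\<close> may be inserted for
      \<open>\<kappa>\<close>.\<close>
    have rep: "integral (cbox (- a) a) (\<lambda>y. f y * spherical_kernel \<kappa> ((norm (y - x))\<^sup>2)) = - kernel_const * u x"
      if x: "norm x > 2 * d" and \<kappa>: "\<kappa>\<^sup>2 = k\<^sup>2" for x \<kappa>
    proof -
      have int: "integrable lborel (\<lambda>y. spherical_kernel \<kappa> ((norm (y - x))\<^sup>2) * f y)"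
        by (rule integrable_spherical_kernel_mult[OF cf f0', where d="norm x - 2 * d"]) (use x f0'' in auto)
      have "(\<integral>y. spherical_kernel \<kappa> ((norm (y - x))\<^sup>2) * f y \<partial>lborel) = - kernel_const * w x"
        by (rule representation_decaying[OF w _ f0 x dec]) (simp_all add: f_def \<kappa>)
      moreover have "(\<integral>y. spherical_kernel \<kappa> ((norm (y - x))\<^sup>2) * f y \<partial>lborel) =
          integral (cbox (- a) a) (\<lambda>y. spherical_kernel \<kappa> ((norm (y - x))\<^sup>2) * f y)"
        by (rule integral_lborel_eq_cbox[OF int]) (use fa in auto)
      ultimately show ?thesis using out(1)[of x] x by (simp add: mult.commute)
    qed
    define R where "R = max (2 * d) (4 * (L + 1))"
    show ?thesis
    proof (intro exI[of _ R] conjI allI impI)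
      show "R > 0" using d by (simp add: R_def)
      then have "R > 0" .
      fix y :: "real^3" assume y: "norm y > R"
      define r \<omega> where "r = norm y" and "\<omega> = y /\<^sub>R norm y"
      have r: "r > 4 * (L + 1)" using y by (simp add: r_def R_def)
      have "r > 0" using y \<open>R > 0\<close> unfolding r_def by linarith
      then have \<omega>: "norm \<omega> = 1" "y = r *\<^sub>R \<omega>" by (auto simp: \<omega>_def r_def)
      show "u y = 0"
      proof (rule ray_expansion[OF ca L L0 \<omega>(1), of k], assumption,
          rule ray_expansion[OF ca L L0 \<omega>(1), of "- k"], assumption)
        fix g h
        assume g: "g holomorphic_on ball 0 (1 / (4 * (L + 1)))"
          "\<And>r. r > 4 * (L + 1) \<Longrightarrow> integral (cbox (- a) a) (\<lambda>y. f y * spherical_kernel k ((norm (y - r *\<^sub>R \<omega>))\<^sup>2)) =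
            exp (\<i> * k * of_real r) / of_real r * g (of_real (1 / r))"
          and h: "h holomorphic_on ball 0 (1 / (4 * (L + 1)))"
          "\<And>r. r > 4 * (L + 1) \<Longrightarrow> integral (cbox (- a) a) (\<lambda>y. f y * spherical_kernel (- k) ((norm (y - r *\<^sub>R \<omega>))\<^sup>2)) =
            exp (\<i> * complex_of_real (- k) * of_real r) / of_real r * h (of_real (1 / r))"
        define e where "e = 1 / R"
        have e: "e > 0" "e \<le> 1 / (4 * (L + 1))" using \<open>R > 0\<close> L0 by (auto simp: e_def R_def intro!: frac_le)
        have sub: "ball (0::complex) e \<subseteq> ball 0 (1 / (4 * (L + 1)))" using e(2) by (rule subset_ball)
        have "g (of_real (1 / r)) = 0"
        proof (rule exp_reciprocal_uniqueness[OF e(1) k holomorphic_on_subset[OF g(1) sub] holomorphic_on_subset[OF h(1) sub]])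
          fix t :: real assume t: "0 < t" "t < e"
          define s where "s = 1 / t"
          have s: "s > R" using t \<open>R > 0\<close> by (simp add: s_def e_def field_simps)
          then have sL: "s > 4 * (L + 1)" and s0: "s > 0" and sd: "norm (s *\<^sub>R \<omega>) > 2 * d"
            using \<open>R > 0\<close> \<omega>(1) by (auto simp: R_def)
          have "exp (\<i> * k * of_real s) / of_real s * g (of_real (1 / s)) = - kernel_const * u (s *\<^sub>R \<omega>)"
            unfolding g(2)[OF sL, symmetric] by (rule rep[OF sd]) simp
          also have "\<dots> = exp (\<i> * complex_of_real (- k) * of_real s) / of_real s * h (of_real (1 / s))"
            unfolding h(2)[OF sL, symmetric] by (rule rep[OF sd, symmetric]) simp
          finally have "exp (\<i> * k * of_real s) * g (of_real (1 / s)) = exp (\<i> * complex_of_real (- k) * of_real s) * h (of_real (1 / s))"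
            using s0 by (simp add: field_simps)
          moreover have "of_real (1 / s) = complex_of_real t" "\<i> * k / of_real t = \<i> * k * of_real s"
            by (simp_all add: s_def)
          ultimately show "exp (\<i> * k / of_real t) * g (of_real t) = exp (- (\<i> * k / of_real t)) * h (of_real t)"
            by simp
        next
          show "complex_of_real (1 / r) \<in> ball 0 e"
            using y \<open>r > 0\<close> \<open>R > 0\<close> by (simp add: e_def r_def norm_divide frac_less2)
        qed
        then have "- kernel_const * u y = 0"
          using rep[of y k] y g(2)[OF r] \<omega>(2) by (simp add: R_def)
        then show "u y = 0" using kernel_const_nonzero by simp
      qed
    qed
  qed
qed

lemma radiation_solution_real_decay:
  assumes \<psi>: "sommerfeld \<kappa> \<psi>" and \<kappa>: "\<kappa> > 0" and U: "open U"
    and der: "\<And>x. x \<in> U \<Longrightarrow> (\<psi> has_derivative blinfun_apply (\<psi>' x)) (at x)"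
    and far: "\<And>y. norm y > R0 \<Longrightarrow> y \<in> U" and re: "\<And>x. x \<in> U \<Longrightarrow> Im (\<psi> x) = 0" and d: "d > 0"
  shows "\<exists>r. \<forall>y. norm y \<ge> r \<longrightarrow>
       norm y * norm (\<psi> y) \<le> d \<and> norm (\<Sum>b\<in>Basis. of_real (y \<bullet> b) * blinfun_apply (\<psi>' y) b) \<le> d"
proof -
  let ?S = "\<lambda>r \<omega>. of_real r * (vector_derivative (\<lambda>s. \<psi> (s *\<^sub>R \<omega>)) (at r) - \<i> * of_real \<kappa> * \<psi> (r *\<^sub>R \<omega>))"
  \<comment> \<open>The real part of the radiation expression controls \<open>r * norm D\<close>,
    the imaginary part \<open>\<kappa> * (r * norm (\<psi> y))\<close>; the minimum serves
    both.\<close>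
  define c where "c = min d (\<kappa> * d)"
  have c: "c > 0" using d \<kappa> by (simp add: c_def)
  have "\<forall>\<^sub>F r in at_top. \<forall>\<omega>\<in>sphere 0 1. dist (?S r \<omega>) 0 < c"
    using uniform_limitD[OF \<psi>[unfolded sommerfeld_def] c] .
  then obtain N where "\<forall>r\<ge>N. \<forall>\<omega>\<in>sphere 0 1. dist (?S r \<omega>) 0 < c"
    unfolding eventually_at_top_linorder by (elim exE) (rule that)
  then have N: "norm (?S r \<omega>) < c" if "r \<ge> N" "norm \<omega> = 1" for r \<omega>
    using that by simp
  have "norm y * norm (\<psi> y) \<le> d \<and> norm (\<Sum>b\<in>Basis. of_real (y \<bullet> b) * blinfun_apply (\<psi>' y) b) \<le> d"
    if y: "norm y \<ge> max N (\<bar>R0\<bar> + 1)" for y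
  proof -
    define r \<omega> where "r = norm y" and "\<omega> = y /\<^sub>R norm y"
    have r: "r > 0" "r \<ge> N" "r > R0" using y by (auto simp: r_def)
    then have \<omega>: "norm \<omega> = 1" "y = r *\<^sub>R \<omega>" by (auto simp: \<omega>_def r_def)
    have yU: "y \<in> U" by (rule far) (use r(3) in \<open>simp add: r_def\<close>)
    define D where "D = blinfun_apply (\<psi>' y) \<omega>"
    have "((\<lambda>t. \<psi> (y + t *\<^sub>R \<omega>)) has_vector_derivative D) (at (r - r))"
      unfolding D_def using has_derivative_imp_line_derivative[OF der[OF yU], of \<omega>] by simp
    moreover have "((\<lambda>t. t - r) has_vector_derivative 1) (at r)" by (auto intro!: derivative_eq_intros)
    ultimately have "((\<lambda>t. \<psi> (y + t *\<^sub>R \<omega>)) \<circ> (\<lambda>t. t - r) has_vector_derivative 1 *\<^sub>R D) (at r)"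
      by (intro vector_diff_chain_at)
    moreover have "y + (t - r) *\<^sub>R \<omega> = t *\<^sub>R \<omega>" for t using \<omega>(2) by (simp add: scaleR_diff_left)
    ultimately have dD: "((\<lambda>s. \<psi> (s *\<^sub>R \<omega>)) has_vector_derivative D) (at r)" by (simp add: o_def)
    have "Im D = 0"
    proof -
      have "((\<lambda>t. Im (\<psi> (t *\<^sub>R \<omega>))) has_vector_derivative Im D) (at r)"
        by (rule bounded_linear.has_vector_derivative[OF bounded_linear_Im dD])
      moreover have "((\<lambda>t. Im (\<psi> (t *\<^sub>R \<omega>))) has_vector_derivative 0) (at r)"
      proof (rule has_vector_derivative_transform_within_open[where f="\<lambda>_. 0"])
        show "open ((\<lambda>t. t *\<^sub>R \<omega>) -` U)" by (intro open_vimage U continuous_intros)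
      qed (use yU \<omega>(2) re in auto)
      ultimately show ?thesis by (rule vector_derivative_unique_at)
    qed
    have S: "?S r \<omega> = of_real r * (D - \<i> * of_real \<kappa> * \<psi> y)"
      using vector_derivative_at[OF dD] \<omega>(2) by simp
    have i\<psi>: "Im (\<psi> y) = 0" by (rule re[OF yU])
    have lt: "norm (?S r \<omega>) < c" by (rule N[OF r(2) \<omega>(1)])
    have e: "Re (?S r \<omega>) = r * Re D" "Im (?S r \<omega>) = - (r * (\<kappa> * Re (\<psi> y)))"
      unfolding S using \<open>Im D = 0\<close> i\<psi> by simp_all
    have 1: "\<bar>r * Re D\<bar> < c" "\<bar>r * (\<kappa> * Re (\<psi> y))\<bar> < c"
      using le_less_trans[OF abs_Re_le_cmod lt] le_less_trans[OF abs_Im_le_cmod lt] unfolding e abs_minus_cancel .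
    have "norm D = \<bar>Re D\<bar>" "norm (\<psi> y) = \<bar>Re (\<psi> y)\<bar>"
      using \<open>Im D = 0\<close> i\<psi> by (simp_all add: norm_complex_def)
    then have 2: "r * norm D \<le> d" "\<kappa> * (r * norm (\<psi> y)) \<le> \<kappa> * d"
      using 1 r(1) \<kappa> by (simp_all add: abs_mult c_def mult_ac)
    \<comment> \<open>By linearity the sum is the derivative applied to \<open>y\<close> itself,
      that is, \<open>r\<close> times the radial derivative \<open>D\<close>.\<close>
    have "(\<Sum>b\<in>Basis. of_real (y \<bullet> b) * blinfun_apply (\<psi>' y) b) = blinfun_apply (\<psi>' y) (\<Sum>b\<in>Basis. (y \<bullet> b) *\<^sub>R b)"
      by (simp only: blinfun.sum_right blinfun.scaleR_right) (simp add: scaleR_conv_of_real)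
    also have "\<dots> = blinfun_apply (\<psi>' y) y" by (simp add: euclidean_representation)
    also have "\<dots> = blinfun_apply (\<psi>' y) (r *\<^sub>R \<omega>)" using \<omega>(2) by simp
    also have "\<dots> = r *\<^sub>R D" unfolding D_def by (rule blinfun.scaleR_right)
    finally have "norm (\<Sum>b\<in>Basis. of_real (y \<bullet> b) * blinfun_apply (\<psi>' y) b) = r * norm D" using r(1) by simp
    with 2 \<kappa> show ?thesis by (simp add: r_def)
  qed
  then show ?thesis by blast
qed

text \<open>\<open>vector_derivative\<close> is additive only where both derivatives exist.
  Differentiability outside a ball is enough, because the uniform limit concerns large radii
  alone.\<close>

lemma sommerfeld_diff:
  assumes "sommerfeld \<kappa> f" "sommerfeld \<kappa> g"
    and far: "\<And>y. norm y > R0 \<Longrightarrow> f differentiable (at y) \<and> g differentiable (at y)"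
  shows "sommerfeld \<kappa> (\<lambda>x. f x - g x)"
proof -
  let ?S = "\<lambda>f r \<omega>. of_real r * (vector_derivative (\<lambda>s. f (s *\<^sub>R \<omega>)) (at r) - \<i> * of_real \<kappa> * f (r *\<^sub>R \<omega>))"
  have "uniform_limit (sphere 0 1) (\<lambda>r \<omega>. ?S f r \<omega> - ?S g r \<omega>) (\<lambda>_. 0 - 0) at_top"
    using assms(1,2) unfolding sommerfeld_def by (rule uniform_limit_minus)
  moreover have "\<forall>\<^sub>F r in at_top. \<forall>\<omega>\<in>sphere 0 1. ?S f r \<omega> - ?S g r \<omega> = ?S (\<lambda>x. f x - g x) r \<omega>"
    using eventually_gt_at_top[of "\<bar>R0\<bar>"]
  proof eventually_elim
    case (elim r)
    show ?case
    proof
      fix \<omega> :: "real^3" assume \<omega>: "\<omega> \<in> sphere 0 1"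
      then have n: "norm (r *\<^sub>R \<omega>) > R0" using elim by simp
      have line: "((\<lambda>s::real. s *\<^sub>R \<omega>) differentiable at r)"
        by (rule bounded_linear_imp_differentiable) (rule bounded_linear_scaleR_left)
      have "(\<lambda>s. f (s *\<^sub>R \<omega>)) differentiable at r" "(\<lambda>s. g (s *\<^sub>R \<omega>)) differentiable at r"
        using differentiable_chain_at[OF line, of f] differentiable_chain_at[OF line, of g] far[OF n] by (simp_all add: o_def)
      then have "vector_derivative (\<lambda>s. f (s *\<^sub>R \<omega>) - g (s *\<^sub>R \<omega>)) (at r) =
          vector_derivative (\<lambda>s. f (s *\<^sub>R \<omega>)) (at r) - vector_derivative (\<lambda>s. g (s *\<^sub>R \<omega>)) (at r)"
        by (rule vector_derivative_diff_at)
      then show "?S f r \<omega> - ?S g r \<omega> = ?S (\<lambda>x. f x - g x) r \<omega>"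
        by (simp only: right_diff_distrib) simp
    qed
  qed
  ultimately show ?thesis
    unfolding sommerfeld_def by (subst (asm) uniform_limit_cong[where g="?S (\<lambda>x. f x - g x)" and i="\<lambda>_. 0"]) auto
qed

theorem theorem4:
  fixes \<kappa> :: real
    and U B D :: "(real^3) set"
    and \<psi>\<^sub>1 \<psi>\<^sub>2 :: "real^3 \<Rightarrow> complex"
  assumes "\<kappa> > 0"
    and "exterior_region U"
    and "radiation_solution \<kappa> U \<psi>\<^sub>1" and "radiation_solution \<kappa> U \<psi>\<^sub>2"
    and "open B" and "bounded B" and "connected B"
    and "real_analytic_surface (frontier B)" and "connected (frontier B)"
    and "closure B \<subseteq> U"
    and "\<not> dirichlet_eigenvalue \<kappa> B"
    and "openin (top_of_set (frontier B)) D" and "D \<noteq> {}"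
    and "\<forall>x\<in>D. Im (\<psi>\<^sub>1 x) = Im (\<psi>\<^sub>2 x)"
  shows "\<forall>x\<in>U. \<psi>\<^sub>1 x = \<psi>\<^sub>2 x"
proof -
  have U: "open U" "connected U" using assms(2) unfolding exterior_region_def by auto
  obtain S where S: "bounded S" "U = outside S" using assms(2) unfolding exterior_region_def by blast
  \<comment> \<open>All points far out belong to \<open>U\<close>; the decay argument and the volume
    representation need this in every direction.\<close>
  have "bounded (- U)" unfolding S(2) by (rule cobounded_outside[OF S(1)])
  then obtain R0 where "\<And>y. y \<in> - U \<Longrightarrow> norm y \<le> R0" unfolding bounded_iff by blast
  then have far: "y \<in> U" if "norm y > R0" for y using that by force
  define \<psi> where "\<psi> x = \<psi>\<^sub>1 x - \<psi>\<^sub>2 x" for x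
  have c12: "C2_upto U U \<psi>\<^sub>1" "C2_upto U U \<psi>\<^sub>2"
    using assms(3,4) closure_subset[of U] C2_upto_subset[OF _ order_refl] unfolding radiation_solution_def by blast+
  have c\<psi>: "C2_upto U U \<psi>" unfolding \<psi>_def [abs_def] by (rule C2_upto_diff[OF c12])
  have h\<psi>: "helmholtz_on \<kappa> U \<psi>"
    unfolding \<psi>_def [abs_def] using assms(3,4) helmholtz_on_diff[OF U(1) c12]
    unfolding radiation_solution_def by blast
  obtain f' f'' where f: "\<And>x. x \<in> U \<Longrightarrow> (\<psi> has_derivative blinfun_apply (f' x)) (at x)"
    "\<And>x. x \<in> U \<Longrightarrow> (f' has_derivative blinfun_apply (f'' x)) (at x)"
    "continuous_on U \<psi>" "continuous_on U f'" "continuous_on U f''"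
    using c\<psi> unfolding C2_upto_def by blast
  note p\<psi> = C2_upto_imp_C2_partials[OF f]
  have hp\<psi>: "helmholtz_partials \<kappa> U \<psi> (\<lambda>b x. f' x b) (\<lambda>b x. f'' x b b)"
    using h\<psi> helmholtz_partials_iff[OF U(1) p\<psi>] by blast
  \<comment> \<open>The imaginary part is coerced back to a complex function so that the Helmholtz
    and eigenvalue predicates apply to it.\<close>
  define v where "v x = complex_of_real (Im (\<psi> x))" for x
  have L: "bounded_linear (\<lambda>z. complex_of_real (Im z))"
    by (rule bounded_linear_compose[OF bounded_linear_of_real bounded_linear_Im])
  have cv: "C2_upto U U v" unfolding v_def [abs_def] by (rule C2_upto_linear_image[OF c\<psi> L])
  have hv: "helmholtz_on \<kappa> U v" unfolding v_def [abs_def] by (rule helmholtz_on_Im[OF U(1) c\<psi> h\<psi>])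
  obtain v' v'' where v': "\<And>x. x \<in> U \<Longrightarrow> (v has_derivative blinfun_apply (v' x)) (at x)"
    "\<And>x. x \<in> U \<Longrightarrow> (v' has_derivative blinfun_apply (v'' x)) (at x)"
    "continuous_on U v" "continuous_on U v'" "continuous_on U v''"
    using cv unfolding C2_upto_def by blast
  note pv = C2_upto_imp_C2_partials[OF v']
  have hpv: "helmholtz_partials \<kappa> U v (\<lambda>b x. v' x b) (\<lambda>b x. v'' x b b)"
    using hv helmholtz_partials_iff[OF U(1) pv] by blast
  have fr: "frontier B \<subseteq> U" using assms(10) by (auto simp: frontier_def)
  have BU: "B \<subseteq> U" using assms(10) closure_subset by blast
  have vY: "v x = 0" if "x \<in> frontier B" for x
    by (rule helmholtz_zero_on_analytic_surface[OF hpv U(1) assms(8,9) fr assms(12,13) _ that])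
      (use assms(14) in \<open>simp add: v_def \<psi>_def\<close>)
  have vB: "v x = 0" if x: "x \<in> B" for x
  proof (rule ccontr)
    assume "v x \<noteq> 0"
    moreover have "C2_upto B B v" by (rule C2_upto_subset[OF cv BU BU])
    moreover have "continuous_on (closure B) v" using v'(3) assms(10) by (rule continuous_on_subset)
    moreover have "helmholtz_on \<kappa> B v" using hv BU unfolding helmholtz_on_def by blast
    ultimately have "dirichlet_eigenvalue \<kappa> B" unfolding dirichlet_eigenvalue_def using vY x by blast
    then show False using assms(11) by blast
  qed
  \<comment> \<open>The empty set has empty frontier, while the frontier of \<open>B\<close>
    contains the nonempty \<open>D\<close>. Thus \<open>B\<close> is an open set from which zeros
    can be continued to \<open>U\<close>.\<close>
  have "B \<noteq> {}" using assms(12,13) openin_imp_subset by fastforce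
  then have vU: "v x = 0" if "x \<in> U" for x
    using helmholtz_unique_continuation[OF hpv U assms(5) _ BU vB that] by blast
  have som: "sommerfeld \<kappa> \<psi>"
    unfolding \<psi>_def [abs_def]
  proof (rule sommerfeld_diff)
    show "sommerfeld \<kappa> \<psi>\<^sub>1" "sommerfeld \<kappa> \<psi>\<^sub>2" using assms(3,4) unfolding radiation_solution_def by auto
    show "\<psi>\<^sub>1 differentiable (at y) \<and> \<psi>\<^sub>2 differentiable (at y)" if "norm y > R0" for y
      using c12 far[OF that] unfolding C2_upto_def differentiable_def by blast
  qed
  have re: "Im (\<psi> x) = 0" if "x \<in> U" for x using vU[OF that] by (simp add: v_def)
  have decay: "\<exists>r. \<forall>y. norm y \<ge> r \<longrightarrow>
       norm y * norm (\<psi> y) \<le> d \<and> norm (\<Sum>b\<in>Basis. of_real (y \<bullet> b) * blinfun_apply (f' y) b) \<le> d" if "d > 0" for d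
    using radiation_solution_real_decay[OF som assms(1) U(1) f(1) far re that] .
  obtain R where R: "R > 0" "\<And>y. norm y > R \<Longrightarrow> \<psi> y = 0"
    using helmholtz_far_field_zero[OF assms(1) hp\<psi> U(1) far decay] by blast
  \<comment> \<open>The maximum with \<open>R0\<close> keeps \<open>E\<close> inside
    \<open>U\<close>; the zeros of \<open>\<psi>\<close> on \<open>E\<close> are then continued
    inwards.\<close>
  define E where "E = {y::real^3. norm y > max R R0}"
  have "open E" unfolding E_def by (intro open_Collect_less continuous_intros)
  moreover have "E \<noteq> {}"
  proof -
    obtain y :: "real^3" where "norm y = max R R0 + 1" using vector_choose_size[of "max R R0 + 1"] R(1) by auto
    then have "norm y > max R R0" by linarith
    then have "y \<in> E" unfolding E_def by (rule CollectI)
    then show ?thesis by blast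
  qed
  moreover have "E \<subseteq> U" using far by (auto simp: E_def)
  moreover have "\<psi> x = 0" if "x \<in> E" for x using R(2) that by (simp add: E_def)
  ultimately have "\<psi> x = 0" if "x \<in> U" for x
    using helmholtz_unique_continuation[OF hp\<psi> U _ _ _ _ that] by blast
  then show ?thesis by (simp add: \<psi>_def)
qed

end
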